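(* Let $\Gamma$ be a finitely presented group and let $S_1,S_2$ be two finite generating sets of $\Gamma$. Then $\mathrm{Cay}(\Gamma,S_1)$ has a coexact 1-Laplacian spectral gap (with some $D$ used in the construction of $\mathrm{Cay}^{(2)}(\Gamma,S_1)$) if and only if $\mathrm{Cay}(\Gamma,S_2)$ has a coexact 1-Laplacian spectral gap (with some $D'$ used in the construction of $\mathrm{Cay}^{(2)}(\Gamma,S_2)$).
   Context: Let $G=(V,E)$ be a countable oriented graph with uniformly bounded vertex degrees, and let $\tilde G$ be the graph obtained by forgetting orientations. For $D\in\mathbb N$, the complex $G^{(2)}$ is the oriented 2-dimensional complex obtained from $G$ by gluing a polygon along each cycle of $\tilde G$ of length $\le D$ (with an arbitrary orientation of each polygon); $F$ denotes the set of these polygons. Such $D$ is always chosen so that $G^{(2)}$ is simply connected. For $G=\mathrm{Cay}(\Gamma,S)$ with $\Gamma$ finitely presented, it is assumed that $D$ is at least the length of each defining relation; the complex is denoted $\mathrm{Cay}^{(2)}(\Gamma,S)$. A 0-, 1- or 2-cochain is a real function on $V$, $E$ or $F$ respectively. The coboundary operators $d$ and boundary operators $\partial$ between cochains of consecutive degrees are the standard ones with respect to the chosen orientations; they are bounded on $\ell^2$ and $\partial$ is the $\ell^2$-adjoint of $d$. $\ell^2_{0,c}(E)$ is the closure in $\ell^2(E)$ of $\{f\colon E\to\mathbb R \mid \partial f=0,\ \mathrm{supp}\, f \text{ finite}\}$. The 1-Laplacian is $\Delta_1=\partial d+d\partial$ on $\ell^2(E)$; it maps $\ell^2_{0,c}(E)$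 to itself. $G$ has a coexact 1-Laplacian spectral gap (with $D$) if $\mathrm{spec}(\Delta_1|_{\ell^2_{0,c}(E)})\cap[0,\varepsilon)=\varnothing$ for some $\varepsilon>0$. *)

theory Defs
  imports "HOL-Analysis.Analysis" "HOL-Algebra.Generated_Groups" "Graph_Theory.Digraph"
begin

subsection \<open>Group presentations\<close>

text \<open>A word over \<open>X\<close> is a list of letters \<open>(x, b)\<close>, where \<open>(x, True)\<close> stands for \<open>x\<close> and
  \<open>(x, False)\<close> for its formal inverse.\<close>

definition words :: "'x set \<Rightarrow> ('x \<times> bool) list set" where
  "words X = lists (X \<times> UNIV)"

primrec eval_word :: "('g, 'm) monoid_scheme \<Rightarrow> ('x \<Rightarrow> 'g) \<Rightarrow> ('x \<times> bool) list \<Rightarrow> 'g" where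
  "eval_word \<Gamma> \<phi> [] = \<one>\<^bsub>\<Gamma>\<^esub>"
| "eval_word \<Gamma> \<phi> (l # w) =
     (if snd l then \<phi> (fst l) else inv\<^bsub>\<Gamma>\<^esub> (\<phi> (fst l))) \<otimes>\<^bsub>\<Gamma>\<^esub> eval_word \<Gamma> \<phi> w"

definition word_step :: "'x set \<Rightarrow> ('x \<times> bool) list set \<Rightarrow>
    ('x \<times> bool) list \<Rightarrow> ('x \<times> bool) list \<Rightarrow> bool" where
  "word_step X R w w' \<longleftrightarrow>
     (\<exists>u r v. w = u @ r @ v \<and> w' = u @ v \<and>
        (r \<in> R \<or> (\<exists>x\<in>X. \<exists>b. r = [(x, b), (x, \<not> b)])))"

text \<open>Two words over \<open>X\<close> represent the same element of the group with generators \<open>X\<close> and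
  relators \<open>R\<close> iff they are related by the equivalence closure of \<^const>\<open>word_step\<close>. So the last
  clause says that the kernel of the map from the free group on \<open>X\<close> onto \<open>\<Gamma>\<close> extending \<open>\<phi>\<close> is the
  normal closure of \<open>R\<close>.\<close>

definition presents :: "('g, 'm) monoid_scheme \<Rightarrow> 'x set \<Rightarrow> ('x \<Rightarrow> 'g) \<Rightarrow>
    ('x \<times> bool) list set \<Rightarrow> bool" where
  "presents \<Gamma> X \<phi> R \<longleftrightarrow>
     \<phi> ` X \<subseteq> carrier \<Gamma> \<and> generate \<Gamma> (\<phi> ` X) = carrier \<Gamma> \<and> R \<subseteq> words X \<and>
     (\<forall>w\<in>words X. eval_word \<Gamma> \<phi> w = \<one>\<^bsub>\<Gamma>\<^esub> \<longleftrightarrow> equivclp (word_step X R) w [])"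

definition finitely_presented :: "('g, 'm) monoid_scheme \<Rightarrow> bool" where
  "finitely_presented \<Gamma> \<longleftrightarrow>
     (\<exists>(n::nat) \<phi> R. finite R \<and> presents \<Gamma> {..<n} \<phi> R)"

subsection \<open>Cycles in the underlying unoriented graph\<close>

text \<open>A step \<open>(e, True)\<close> traverses the arc \<open>e\<close> along its orientation, \<open>(e, False)\<close> against it.
  Forgetting orientations does not identify arcs: two arcs joining the same pair of vertices remain
  different edges of the underlying multigraph.\<close>

definition step_src :: "('v, 'e) pre_digraph \<Rightarrow> 'e \<times> bool \<Rightarrow> 'v" where
  "step_src G s = (if snd s then tail G (fst s) else head G (fst s))"

definition step_dst :: "('v, 'e) pre_digraph \<Rightarrow> 'e \<times> bool \<Rightarrow> 'v" where
  "step_dst G s = (if snd s then head G (fst s) else tail G (fst s))"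

primrec walk :: "('v, 'e) pre_digraph \<Rightarrow> 'v \<Rightarrow> ('e \<times> bool) list \<Rightarrow> 'v \<Rightarrow> bool" where
  "walk G u [] v \<longleftrightarrow> u = v \<and> u \<in> verts G"
| "walk G u (s # p) v \<longleftrightarrow> fst s \<in> arcs G \<and> step_src G s = u \<and> walk G (step_dst G s) p v"

text \<open>Distinctness of the arcs excludes going back and forth along one edge. A loop is a cycle of
  length 1, and two different arcs with the same end vertices form a cycle of length 2.\<close>

definition cycle_walk :: "('v, 'e) pre_digraph \<Rightarrow> ('e \<times> bool) list \<Rightarrow> bool" where
  "cycle_walk G p \<longleftrightarrow>
     p \<noteq> [] \<and> (\<exists>u. walk G u p u) \<and> distinct (map (step_src G) p) \<and> distinct (map fst p)"

subsection \<open>The 2-dimensional complex\<close>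

text \<open>A cycle is determined up to starting point and direction by its set of edges, so the polygons
  are represented by these sets.\<close>

definition polygons :: "('v, 'e) pre_digraph \<Rightarrow> nat \<Rightarrow> 'e set set" where
  "polygons G D = {fst ` set p | p. cycle_walk G p \<and> length p \<le> D}"

text \<open>An orientation of the polygons chooses for each of them a walk around its boundary.\<close>

definition polygon_orientation :: "('v, 'e) pre_digraph \<Rightarrow> nat \<Rightarrow>
    ('e set \<Rightarrow> ('e \<times> bool) list) \<Rightarrow> bool" where
  "polygon_orientation G D \<omega> \<longleftrightarrow>
     (\<forall>c\<in>polygons G D. cycle_walk G (\<omega> c) \<and> fst ` set (\<omega> c) = c)"

text \<open>Simple connectedness via the edge-path group: the complex is connected and every closed
  edge path can be transformed into the constant one by inserting and deleting backtrackings and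
  boundaries of polygons (read from any starting point and in any direction).\<close>

definition homotopy_step :: "('v, 'e) pre_digraph \<Rightarrow> nat \<Rightarrow> 'v \<Rightarrow> 'v \<Rightarrow>
    ('e \<times> bool) list \<Rightarrow> ('e \<times> bool) list \<Rightarrow> bool" where
  "homotopy_step G D a b p q \<longleftrightarrow>
     walk G a p b \<and> walk G a q b \<and>
     (\<exists>u r v. p = u @ r @ v \<and> q = u @ v \<and>
        ((\<exists>e t. r = [(e, t), (e, \<not> t)]) \<or> (cycle_walk G r \<and> fst ` set r \<in> polygons G D)))"

definition simply_connected_complex :: "('v, 'e) pre_digraph \<Rightarrow> nat \<Rightarrow> bool" where
  "simply_connected_complex G D \<longleftrightarrow>
     verts G \<noteq> {} \<and>
     (\<forall>a\<in>verts G. \<forall>b\<in>verts G. \<exists>p. walk G a p b) \<and>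
     (\<forall>a p. walk G a p a \<longrightarrow> equivclp (homotopy_step G D a a) p [])"

subsection \<open>Cochains\<close>

text \<open>A cochain is represented by a function that vanishes outside of the set of cells.\<close>

definition coboundary0 :: "('v, 'e) pre_digraph \<Rightarrow> ('v \<Rightarrow> real) \<Rightarrow> 'e \<Rightarrow> real" where
  "coboundary0 G f e = (if e \<in> arcs G then f (head G e) - f (tail G e) else 0)"

definition boundary1 :: "('v, 'e) pre_digraph \<Rightarrow> ('e \<Rightarrow> real) \<Rightarrow> 'v \<Rightarrow> real" where
  "boundary1 G f v =
     (\<Sum>e | e \<in> arcs G \<and> head G e = v. f e) - (\<Sum>e | e \<in> arcs G \<and> tail G e = v. f e)"

definition incidence :: "('e \<times> bool) list \<Rightarrow> 'e \<Rightarrow> real" where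
  "incidence p e = (if (e, True) \<in> set p then 1 else if (e, False) \<in> set p then - 1 else 0)"

definition coboundary1 :: "('v, 'e) pre_digraph \<Rightarrow> nat \<Rightarrow> ('e set \<Rightarrow> ('e \<times> bool) list) \<Rightarrow>
    ('e \<Rightarrow> real) \<Rightarrow> 'e set \<Rightarrow> real" where
  "coboundary1 G D \<omega> f c = (if c \<in> polygons G D then \<Sum>e\<in>c. incidence (\<omega> c) e * f e else 0)"

definition boundary2 :: "('v, 'e) pre_digraph \<Rightarrow> nat \<Rightarrow> ('e set \<Rightarrow> ('e \<times> bool) list) \<Rightarrow>
    ('e set \<Rightarrow> real) \<Rightarrow> 'e \<Rightarrow> real" where
  "boundary2 G D \<omega> h e = (\<Sum>c | c \<in> polygons G D \<and> e \<in> c. incidence (\<omega> c) e * h c)"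

definition laplacian1 :: "('v, 'e) pre_digraph \<Rightarrow> nat \<Rightarrow> ('e set \<Rightarrow> ('e \<times> bool) list) \<Rightarrow>
    ('e \<Rightarrow> real) \<Rightarrow> 'e \<Rightarrow> real" where
  "laplacian1 G D \<omega> f e =
     boundary2 G D \<omega> (coboundary1 G D \<omega> f) e + coboundary0 G (boundary1 G f) e"

subsection \<open>Square-summable functions and the spectral gap\<close>

definition ell2 :: "'i set \<Rightarrow> ('i \<Rightarrow> real) set" where
  "ell2 A = {f. (\<forall>i. i \<notin> A \<longrightarrow> f i = 0) \<and> (\<lambda>i. (f i)\<^sup>2) summable_on A}"

definition ell2_norm :: "'i set \<Rightarrow> ('i \<Rightarrow> real) \<Rightarrow> real" where
  "ell2_norm A f = sqrt (\<Sum>\<^sub>\<infinity>i\<in>A. (f i)\<^sup>2)"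

definition ell2_closure :: "'i set \<Rightarrow> ('i \<Rightarrow> real) set \<Rightarrow> ('i \<Rightarrow> real) set" where
  "ell2_closure A M =
     {f \<in> ell2 A. \<forall>\<delta>>0. \<exists>g\<in>M. ell2_norm A (\<lambda>i. f i - g i) < \<delta>}"

definition bounded_operator_on :: "'i set \<Rightarrow> ('i \<Rightarrow> real) set \<Rightarrow>
    (('i \<Rightarrow> real) \<Rightarrow> 'i \<Rightarrow> real) \<Rightarrow> bool" where
  "bounded_operator_on A H B \<longleftrightarrow>
     (\<forall>f\<in>H. B f \<in> H) \<and>
     (\<forall>f\<in>H. \<forall>g\<in>H. B (\<lambda>i. f i + g i) = (\<lambda>i. B f i + B g i)) \<and>
     (\<forall>a. \<forall>f\<in>H. B (\<lambda>i. a * f i) = (\<lambda>i. a * B f i)) \<and>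
     (\<exists>C. \<forall>f\<in>H. ell2_norm A (B f) \<le> C * ell2_norm A f)"

text \<open>The real points of the spectrum of the restriction of \<open>T\<close> to an invariant closed subspace
  \<open>H\<close> of \<open>ell2 A\<close>. (For the self-adjoint operator considered below this is the whole spectrum.)\<close>

definition spectrum_on :: "'i set \<Rightarrow> ('i \<Rightarrow> real) set \<Rightarrow>
    (('i \<Rightarrow> real) \<Rightarrow> 'i \<Rightarrow> real) \<Rightarrow> real set" where
  "spectrum_on A H T =
     {\<mu>. \<not> (\<exists>B. bounded_operator_on A H B \<and>
        (\<forall>f\<in>H. B (\<lambda>i. T f i - \<mu> * f i) = f \<and> (\<lambda>i. T (B f) i - \<mu> * B f i) = f))}"

definition ell2_0c :: "('v, 'e) pre_digraph \<Rightarrow> ('e \<Rightarrow> real) set" where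
  "ell2_0c G = ell2_closure (arcs G)
     {f. (\<forall>e. e \<notin> arcs G \<longrightarrow> f e = 0) \<and> finite {e. f e \<noteq> 0} \<and> (\<forall>v\<in>verts G. boundary1 G f v = 0)}"

definition coexact_spectral_gap :: "('v, 'e) pre_digraph \<Rightarrow> nat \<Rightarrow>
    ('e set \<Rightarrow> ('e \<times> bool) list) \<Rightarrow> bool" where
  "coexact_spectral_gap G D \<omega> \<longleftrightarrow>
     (\<exists>\<epsilon>>0. spectrum_on (arcs G) (ell2_0c G) (laplacian1 G D \<omega>) \<inter> {0..<\<epsilon>} = {})"

subsection \<open>Cayley graphs\<close>

definition cayley_graph :: "('g, 'm) monoid_scheme \<Rightarrow> 'g set \<Rightarrow> ('g, 'g \<times> 'g) pre_digraph" where
  "cayley_graph \<Gamma> S =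
     \<lparr>verts = carrier \<Gamma>, arcs = carrier \<Gamma> \<times> S, tail = fst, head = (\<lambda>(g, s). g \<otimes>\<^bsub>\<Gamma>\<^esub> s)\<rparr>"

text \<open>The values of \<open>D\<close> allowed in the construction of the Cayley complex: \<open>D\<close> bounds the length of
  the defining relations of some presentation with generating set \<open>S\<close>, and the complex is simply
  connected.\<close>

definition admissible_length :: "('g, 'm) monoid_scheme \<Rightarrow> 'g set \<Rightarrow> nat \<Rightarrow> bool" where
  "admissible_length \<Gamma> S D \<longleftrightarrow>
     (\<exists>R. finite R \<and> presents \<Gamma> S (\<lambda>s. s) R \<and> (\<forall>r\<in>R. length r \<le> D)) \<and>
     simply_connected_complex (cayley_graph \<Gamma> S) D"

end

theory Submission
  imports Defs
begin

text \<open>The spectral gap is first freed from spectral theory. On the closure of the finite cycles the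
  Laplacian is \<open>\<partial>d\<close>, and \<open>\<langle>\<partial>d f, f\<rangle> = \<parallel>d f\<parallel>\<^sup>2\<close>. If \<open>0\<close> is not in the spectrum, then every finite cycle
  \<open>z\<close> is \<open>\<partial>d y\<close> for some \<open>y\<close> with \<open>\<parallel>d y\<parallel> \<le> c \<parallel>z\<parallel>\<close>, and \<open>y\<close> may be taken to be a finite cycle at the price of
  a small error (\<open>gap_imp_approximate_solution\<close>). Conversely, an inequality \<open>\<parallel>z\<parallel> \<le> c \<parallel>d z\<parallel>\<close> for all finite
  cycles \<open>z\<close> makes \<open>\<partial>d - \<mu>\<close> coercive for all small \<open>\<mu>\<close>, hence invertible by a contraction argument
  (\<open>inequality_imp_gap\<close>).

  Now let \<open>G\<^sub>1\<close> and \<open>G\<^sub>2\<close> be the Cayley graphs. Writing each generator as a word in the other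
  generating set gives maps \<open>\<phi>\<close> from edges of \<open>G\<^sub>2\<close> to walks in \<open>G\<^sub>1\<close> and \<open>\<psi>\<close> in the other direction,
  both preserving endpoints. For a finite cycle \<open>z\<close> of \<open>G\<^sub>2\<close>,
  \<open>\<langle>z, z\<rangle> = \<langle>z, z - \<psi>\<phi>z\<rangle> + \<langle>\<psi>\<^sup>*z, \<phi>z\<rangle>\<close>. In the first summand \<open>z\<close> is summed along the closed walks
  \<open>e (\<psi>\<phi>e)\<inverse>\<close> of bounded length. In the second one \<open>\<phi>z\<close> is a finite cycle of \<open>G\<^sub>1\<close>, so the gap of
  \<open>G\<^sub>1\<close> gives \<open>\<phi>z \<approx> \<partial>h\<close> with \<open>\<parallel>h\<parallel> \<le> c \<parallel>z\<parallel>\<close>, and \<open>\<langle>\<psi>\<^sup>*z, \<partial>h\<rangle>\<close> sums \<open>z\<close> along the closed walks \<open>\<psi>(\<partial>c)\<close>,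
  where \<open>c\<close> ranges over the polygons of \<open>G\<^sub>1\<close>. A sum of \<open>z\<close> along a closed walk of length at most \<open>D'\<close> is
  bounded by the values of \<open>d z\<close> on the polygons inside that walk (\<open>closed_walk_sum_le\<close>), and each
  polygon is used boundedly often; so both summands are at most a constant times \<open>\<parallel>z\<parallel> \<parallel>d z\<parallel>\<close>
  (\<open>coexact_spectral_gap_transfer\<close>).

  This needs \<open>D'\<close> to be large. Admissibility is no obstacle, because all large lengths are admissible
  (\<open>admissible_length_eventually\<close>): by a Tietze argument a finitely presented group is presented over
  any finite generating set by all relations up to some length, and short closed walks contract in the
  complex by cutting them into cycles.\<close>

section \<open>Square-summable functions\<close>

lemma ell2_sum_le:
  assumes "f \<in> ell2 A" "finite X" "X \<subseteq> A"
  shows "(\<Sum>i\<in>X. (f i)\<^sup>2) \<le> (ell2_norm A f)\<^sup>2"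
proof -
  have s: "(\<lambda>i. (f i)\<^sup>2) summable_on A" using assms by (simp add: ell2_def)
  have "(\<Sum>i\<in>X. (f i)\<^sup>2) \<le> (\<Sum>\<^sub>\<infinity>i\<in>A. (f i)\<^sup>2)"
    by (rule finite_sum_le_infsum[OF s]) (use assms in auto)
  moreover have "0 \<le> (\<Sum>\<^sub>\<infinity>i\<in>A. (f i)\<^sup>2)" by (rule infsum_nonneg) simp
  ultimately show ?thesis by (simp add: ell2_norm_def)
qed

lemma ell2_norm_nonneg [simp]: "0 \<le> ell2_norm A f"
  unfolding ell2_norm_def by (simp add: infsum_nonneg)

lemma L2_set_le_ell2_norm:
  assumes "f \<in> ell2 A" "finite X" "X \<subseteq> A"
  shows "L2_set f X \<le> ell2_norm A f"
  using ell2_sum_le[OF assms] unfolding L2_set_def by (simp add: real_le_lsqrt sum_nonneg)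

lemma abs_le_ell2_norm:
  assumes "f \<in> ell2 A"
  shows "\<bar>f i\<bar> \<le> ell2_norm A f"
proof (cases "i \<in> A")
  case True
  then show ?thesis using L2_set_le_ell2_norm[OF assms, of "{i}"] by simp
next
  case False
  then show ?thesis using assms by (simp add: ell2_def)
qed

lemma
  assumes out: "\<And>i. i \<notin> A \<Longrightarrow> f i = 0" and "C \<ge> 0"
    and b: "\<And>X. finite X \<Longrightarrow> X \<subseteq> A \<Longrightarrow> L2_set f X \<le> C"
  shows ell2_boundedI: "f \<in> ell2 A" and ell2_norm_leI: "ell2_norm A f \<le> C"
proof -
  have b2: "(\<Sum>i\<in>X. (f i)\<^sup>2) \<le> C\<^sup>2" if "finite X" "X \<subseteq> A" for X
    using b[OF that] unfolding L2_set_def by (simp add: sqrt_le_D)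
  have s: "(\<lambda>i. (f i)\<^sup>2) summable_on A"
    by (rule nonneg_bdd_above_summable_on) (use b2 in \<open>auto simp: bdd_above_def\<close>)
  then show "f \<in> ell2 A" using out by (simp add: ell2_def)
  have "(\<Sum>\<^sub>\<infinity>i\<in>A. (f i)\<^sup>2) \<le> C\<^sup>2"
    by (rule infsum_le_finite_sums[OF s]) (use b2 in auto)
  then show "ell2_norm A f \<le> C"
    unfolding ell2_norm_def using \<open>C \<ge> 0\<close> by (simp add: real_le_lsqrt)
qed

lemma ell2_outside: "f \<in> ell2 A \<Longrightarrow> i \<notin> A \<Longrightarrow> f i = 0"
  by (simp add: ell2_def)

lemma
  assumes "f \<in> ell2 A" "g \<in> ell2 A"
  shows ell2_add: "(\<lambda>i. f i + g i) \<in> ell2 A"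
    and ell2_norm_add_le: "ell2_norm A (\<lambda>i. f i + g i) \<le> ell2_norm A f + ell2_norm A g"
proof -
  have b: "L2_set (\<lambda>i. f i + g i) X \<le> ell2_norm A f + ell2_norm A g" if "finite X" "X \<subseteq> A" for X
    using L2_set_triangle_ineq[of f g X] L2_set_le_ell2_norm[OF assms(1) that]
      L2_set_le_ell2_norm[OF assms(2) that] by linarith
  show "(\<lambda>i. f i + g i) \<in> ell2 A"
    by (rule ell2_boundedI[OF _ _ b]) (use assms in \<open>auto simp: ell2_def\<close>)
  show "ell2_norm A (\<lambda>i. f i + g i) \<le> ell2_norm A f + ell2_norm A g"
    by (rule ell2_norm_leI[OF _ _ b]) (use assms in \<open>auto simp: ell2_def\<close>)
qed

lemma ell2_norm_scale: "ell2_norm A (\<lambda>i. a * f i) = \<bar>a\<bar> * ell2_norm A f"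
proof -
  have "(\<Sum>\<^sub>\<infinity>i\<in>A. (a * f i)\<^sup>2) = a\<^sup>2 * (\<Sum>\<^sub>\<infinity>i\<in>A. (f i)\<^sup>2)"
    by (simp add: power_mult_distrib infsum_cmult_right')
  then show ?thesis by (simp add: ell2_norm_def real_sqrt_mult)
qed

lemma ell2_scale: "f \<in> ell2 A \<Longrightarrow> (\<lambda>i. a * f i) \<in> ell2 A"
  by (auto simp: ell2_def power_mult_distrib intro: summable_on_cmult_right)

lemma ell2_diff: "f \<in> ell2 A \<Longrightarrow> g \<in> ell2 A \<Longrightarrow> (\<lambda>i. f i - g i) \<in> ell2 A"
  using ell2_add[OF _ ell2_scale[of g A "-1"], of f] by simp

lemma ell2_norm_uminus: "ell2_norm A (\<lambda>i. - f i) = ell2_norm A f"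
  using ell2_norm_scale[of A "-1" f] by simp

lemma ell2_norm_minus_commute: "ell2_norm A (\<lambda>i. f i - g i) = ell2_norm A (\<lambda>i. g i - f i)"
  using ell2_norm_uminus[of A "\<lambda>i. f i - g i"] by simp

lemma ell2_norm_diff_le:
  "f \<in> ell2 A \<Longrightarrow> g \<in> ell2 A \<Longrightarrow> ell2_norm A (\<lambda>i. f i - g i) \<le> ell2_norm A f + ell2_norm A g"
  using ell2_norm_add_le[OF _ ell2_scale[of g A "-1"], of f] ell2_norm_uminus[of A g] by simp

lemma ell2_norm_zero [simp]: "ell2_norm A (\<lambda>i. 0) = 0"
  by (simp add: ell2_norm_def)

lemma ell2_norm_eq_0: "f \<in> ell2 A \<Longrightarrow> ell2_norm A f = 0 \<Longrightarrow> f = (\<lambda>i. 0)"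
  using abs_le_ell2_norm[of f A] by fastforce

lemma ell2_finite_support:
  assumes "finite X" "X \<subseteq> A" "\<And>i. i \<notin> X \<Longrightarrow> f i = 0"
  shows "f \<in> ell2 A" and "(ell2_norm A f)\<^sup>2 = (\<Sum>i\<in>X. (f i)\<^sup>2)"
proof -
  have *: "(\<lambda>i. (f i)\<^sup>2) summable_on A \<longleftrightarrow> (\<lambda>i. (f i)\<^sup>2) summable_on X"
    by (rule summable_on_cong_neutral) (use assms in auto)
  then show "f \<in> ell2 A" using assms by (auto simp: ell2_def)
  have "(\<Sum>\<^sub>\<infinity>i\<in>A. (f i)\<^sup>2) = (\<Sum>\<^sub>\<infinity>i\<in>X. (f i)\<^sup>2)"
    by (rule infsum_cong_neutral) (use assms in auto)
  then show "(ell2_norm A f)\<^sup>2 = (\<Sum>i\<in>X. (f i)\<^sup>2)"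
    using assms by (simp add: ell2_norm_def sum_nonneg)
qed

text \<open>In every inner product below one factor has finite support, so this finite sum is the inner
  product of \<open>\<ell>\<^sup>2\<close>.\<close>

definition pairing :: "('i \<Rightarrow> real) \<Rightarrow> ('i \<Rightarrow> real) \<Rightarrow> real" where
  "pairing f g = (\<Sum>i | f i * g i \<noteq> 0. f i * g i)"

lemma pairing_eq_sum:
  assumes "finite X" "\<And>i. i \<notin> X \<Longrightarrow> f i * g i = 0"
  shows "pairing f g = (\<Sum>i\<in>X. f i * g i)"
  unfolding pairing_def by (rule sum.mono_neutral_left) (use assms in auto)

lemma pairing_commute: "pairing f g = pairing g f"
  by (simp add: pairing_def mult.commute)

lemma pairing_self:
  assumes "finite {i. f i \<noteq> 0}" "\<And>i. i \<notin> A \<Longrightarrow> f i = 0"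
  shows "pairing f f = (ell2_norm A f)\<^sup>2"
  by (subst ell2_finite_support(2)[of "{i. f i \<noteq> 0}"], use assms in auto,
      auto simp: pairing_def power2_eq_square)

lemma pairing_diff_left:
  assumes "finite {i. f i \<noteq> 0}" "finite {i. g i \<noteq> 0}"
  shows "pairing (\<lambda>i. f i - g i) h = pairing f h - pairing g h"
proof -
  let ?X = "{i. f i \<noteq> 0} \<union> {i. g i \<noteq> 0}"
  have "pairing (\<lambda>i. f i - g i) h = (\<Sum>i\<in>?X. (f i - g i) * h i)"
    by (rule pairing_eq_sum) (use assms in auto)
  moreover have "pairing f h = (\<Sum>i\<in>?X. f i * h i)" "pairing g h = (\<Sum>i\<in>?X. g i * h i)"
    by (rule pairing_eq_sum; use assms in auto)+
  ultimately show ?thesis by (simp add: left_diff_distrib sum_subtractf)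
qed

lemma pairing_le_ell2_norm:
  assumes "finite {i. f i \<noteq> 0}" "f \<in> ell2 A" "g \<in> ell2 A"
  shows "\<bar>pairing f g\<bar> \<le> ell2_norm A f * ell2_norm A g"
proof -
  let ?X = "{i. f i \<noteq> 0}"
  have X: "?X \<subseteq> A" using assms by (auto simp: ell2_def)
  have "\<bar>pairing f g\<bar> \<le> (\<Sum>i\<in>?X. \<bar>f i\<bar> * \<bar>g i\<bar>)"
    by (subst pairing_eq_sum[of ?X]) (use assms in \<open>auto simp: abs_mult intro: order_trans[OF sum_abs]\<close>)
  also have "\<dots> \<le> L2_set f ?X * L2_set g ?X" by (rule L2_set_mult_ineq)
  also have "\<dots> \<le> ell2_norm A f * ell2_norm A g"
    by (intro mult_mono L2_set_le_ell2_norm assms X) auto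
  finally show ?thesis .
qed

text \<open>The Schur test: Cauchy-Schwarz in each row, then an exchange of sums in which every \<open>i\<close> is met by
  at most \<open>m\<close> rows. Boundary and coboundary operators and sums along walks are all dominated in this
  way; the numbers \<open>n\<close> and \<open>m\<close> are where bounded geometry enters.\<close>

lemma
  fixes N :: "'j \<Rightarrow> 'i set" and M :: real
  assumes f: "f \<in> ell2 I" and out: "\<And>j. j \<notin> J \<Longrightarrow> k j = 0"
    and dom: "\<And>j. j \<in> J \<Longrightarrow> \<bar>k j\<bar> \<le> M * (\<Sum>i\<in>N j. \<bar>f i\<bar>)" and M: "0 \<le> M"
    and N: "\<And>j. j \<in> J \<Longrightarrow> N j \<subseteq> I" "\<And>j. j \<in> J \<Longrightarrow> finite (N j)" "\<And>j. j \<in> J \<Longrightarrow> card (N j) \<le> n"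
    and col: "\<And>i. finite {j\<in>J. i \<in> N j}" "\<And>i. card {j\<in>J. i \<in> N j} \<le> m"
  shows schur_ell2: "k \<in> ell2 J"
    and schur_norm_le: "ell2_norm J k \<le> M * sqrt (real (n * m)) * ell2_norm I f"
proof -
  have b: "L2_set k X \<le> M * sqrt (real (n * m)) * ell2_norm I f" if X: "finite X" "X \<subseteq> J" for X
  proof -
    let ?U = "\<Union>j\<in>X. N j"
    have U: "finite ?U" "?U \<subseteq> I" using X N by auto
    have "(k j)\<^sup>2 \<le> M\<^sup>2 * real n * (\<Sum>i\<in>N j. (f i)\<^sup>2)" if j: "j \<in> X" for j
    proof -
      have jJ: "j \<in> J" using j X by auto
      have "(\<Sum>i\<in>N j. \<bar>f i\<bar>) = (\<Sum>i\<in>N j. \<bar>f i\<bar> * \<bar>1\<bar>)" by simp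
      also have "\<dots> \<le> L2_set f (N j) * L2_set (\<lambda>i. 1) (N j)" by (rule L2_set_mult_ineq)
      finally have "(\<Sum>i\<in>N j. \<bar>f i\<bar>)\<^sup>2 \<le> (L2_set f (N j) * L2_set (\<lambda>i. 1) (N j))\<^sup>2"
        by (rule power_mono) (simp add: sum_nonneg)
      also have "\<dots> = (\<Sum>i\<in>N j. (f i)\<^sup>2) * real (card (N j))"
        by (simp add: L2_set_def power_mult_distrib sum_nonneg)
      also have "\<dots> \<le> (\<Sum>i\<in>N j. (f i)\<^sup>2) * real n"
        using N(3)[OF jJ] by (intro mult_left_mono) (auto simp: sum_nonneg)
      finally have *: "(\<Sum>i\<in>N j. \<bar>f i\<bar>)\<^sup>2 \<le> (\<Sum>i\<in>N j. (f i)\<^sup>2) * real n" .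
      have "(k j)\<^sup>2 = \<bar>k j\<bar>\<^sup>2" by simp
      also have "\<dots> \<le> (M * (\<Sum>i\<in>N j. \<bar>f i\<bar>))\<^sup>2"
        by (rule power_mono[OF dom[OF jJ]]) simp
      also have "\<dots> \<le> M\<^sup>2 * ((\<Sum>i\<in>N j. (f i)\<^sup>2) * real n)"
        unfolding power_mult_distrib by (rule mult_left_mono[OF *]) simp
      finally show ?thesis by (simp add: mult_ac)
    qed
    then have "(\<Sum>j\<in>X. (k j)\<^sup>2) \<le> (\<Sum>j\<in>X. M\<^sup>2 * real n * (\<Sum>i\<in>N j. (f i)\<^sup>2))"
      by (rule sum_mono)
    also have "\<dots> = M\<^sup>2 * real n * (\<Sum>j\<in>X. \<Sum>i\<in>{i\<in>?U. i \<in> N j}. (f i)\<^sup>2)"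
      unfolding sum_distrib_left[symmetric] by (rule arg_cong[where f = "(*) _"], rule sum.cong) (auto intro!: sum.cong)
    also have "(\<Sum>j\<in>X. \<Sum>i\<in>{i\<in>?U. i \<in> N j}. (f i)\<^sup>2) = (\<Sum>i\<in>?U. \<Sum>j\<in>{j\<in>X. i \<in> N j}. (f i)\<^sup>2)"
      by (rule sum.swap_restrict) (use X U in auto)
    also have "\<dots> \<le> (\<Sum>i\<in>?U. real m * (f i)\<^sup>2)"
    proof (rule sum_mono)
      fix i
      have "card {j\<in>X. i \<in> N j} \<le> card {j\<in>J. i \<in> N j}" by (rule card_mono) (use col X in auto)
      then have "card {j\<in>X. i \<in> N j} \<le> m" using col(2)[of i] by simp
      then show "(\<Sum>j\<in>{j\<in>X. i \<in> N j}. (f i)\<^sup>2) \<le> real m * (f i)\<^sup>2"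
        by (simp add: mult_right_mono)
    qed
    also have "\<dots> = real m * (\<Sum>i\<in>?U. (f i)\<^sup>2)" by (simp add: sum_distrib_left)
    also have "\<dots> \<le> real m * (ell2_norm I f)\<^sup>2"
      by (intro mult_left_mono ell2_sum_le f U) auto
    finally have "(\<Sum>j\<in>X. (k j)\<^sup>2) \<le> M\<^sup>2 * real n * (real m * (ell2_norm I f)\<^sup>2)"
      by (simp add: mult_left_mono)
    also have "\<dots> = (M * sqrt (real (n * m)) * ell2_norm I f)\<^sup>2"
      by (simp add: power_mult_distrib mult_ac)
    finally show ?thesis unfolding L2_set_def using M by (simp add: real_le_lsqrt)
  qed
  have nn: "0 \<le> M * sqrt (real (n * m)) * ell2_norm I f" using M by simp
  show "k \<in> ell2 J" by (rule ell2_boundedI[OF out nn b])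
  show "ell2_norm J k \<le> M * sqrt (real (n * m)) * ell2_norm I f" by (rule ell2_norm_leI[OF out nn b])
qed


section \<open>Inverting a coercive operator on a closed subspace\<close>

definition fun_subspace :: "('i \<Rightarrow> real) set \<Rightarrow> bool" where
  "fun_subspace Z \<longleftrightarrow> (\<lambda>i. 0) \<in> Z \<and> (\<forall>f\<in>Z. \<forall>g\<in>Z. (\<lambda>i. f i + g i) \<in> Z) \<and>
     (\<forall>a. \<forall>f\<in>Z. (\<lambda>i. a * f i) \<in> Z)"

lemma fun_subspaceD:
  assumes "fun_subspace Z"
  shows "(\<lambda>i. 0) \<in> Z" "f \<in> Z \<Longrightarrow> g \<in> Z \<Longrightarrow> (\<lambda>i. f i + g i) \<in> Z" "f \<in> Z \<Longrightarrow> (\<lambda>i. a * f i) \<in> Z"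
  using assms by (auto simp: fun_subspace_def)

lemma fun_subspace_diff:
  assumes "fun_subspace Z" "f \<in> Z" "g \<in> Z"
  shows "(\<lambda>i. f i - g i) \<in> Z"
  using fun_subspaceD(2)[OF assms(1,2) fun_subspaceD(3)[OF assms(1,3), of "-1"]] by simp

definition ell2_operator ::
    "'i set \<Rightarrow> 'j set \<Rightarrow> real \<Rightarrow> (('i \<Rightarrow> real) \<Rightarrow> 'j \<Rightarrow> real) \<Rightarrow> bool" where
  "ell2_operator I J M T \<longleftrightarrow> 0 \<le> M \<and> (\<forall>f\<in>ell2 I. T f \<in> ell2 J \<and> ell2_norm J (T f) \<le> M * ell2_norm I f) \<and>
     (\<forall>f\<in>ell2 I. \<forall>g\<in>ell2 I. T (\<lambda>i. f i + g i) = (\<lambda>j. T f j + T g j)) \<and>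
     (\<forall>a. \<forall>f\<in>ell2 I. T (\<lambda>i. a * f i) = (\<lambda>j. a * T f j))"

lemma ell2_operatorD:
  assumes "ell2_operator I J M T"
  shows "0 \<le> M" "f \<in> ell2 I \<Longrightarrow> T f \<in> ell2 J" "f \<in> ell2 I \<Longrightarrow> ell2_norm J (T f) \<le> M * ell2_norm I f"
    "f \<in> ell2 I \<Longrightarrow> g \<in> ell2 I \<Longrightarrow> T (\<lambda>i. f i + g i) = (\<lambda>j. T f j + T g j)"
    "f \<in> ell2 I \<Longrightarrow> T (\<lambda>i. a * f i) = (\<lambda>j. a * T f j)"
  using assms by (auto simp: ell2_operator_def)

lemma ell2_operator_diff:
  assumes "ell2_operator I J M T" "f \<in> ell2 I" "g \<in> ell2 I"
  shows "T (\<lambda>i. f i - g i) = (\<lambda>j. T f j - T g j)"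
proof -
  have "T (\<lambda>i. f i + (-1) * g i) = (\<lambda>j. T f j + (-1) * T g j)"
    using ell2_operatorD(4)[OF assms(1,2) ell2_scale[OF assms(3)], of "-1"]
      ell2_operatorD(5)[OF assms(1,3), of "-1"] by simp
  then show ?thesis by simp
qed

lemma ell2_operator_comp:
  assumes S: "ell2_operator I J M S" and T: "ell2_operator J K N T"
  shows "ell2_operator I K (N * M) (\<lambda>f. T (S f))"
  unfolding ell2_operator_def
proof (intro conjI ballI allI)
  fix f assume f: "f \<in> ell2 I"
  have "ell2_norm K (T (S f)) \<le> N * ell2_norm J (S f)"
    using ell2_operatorD(2,3) S T f by blast
  also have "\<dots> \<le> N * (M * ell2_norm I f)"
    using ell2_operatorD(1)[OF T] ell2_operatorD(3)[OF S f] by (rule mult_left_mono[rotated])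
  finally show "ell2_norm K (T (S f)) \<le> N * M * ell2_norm I f" by (simp add: mult.assoc)
qed (use ell2_operatorD[OF S] ell2_operatorD[OF T] in auto)

lemma ell2_operator_shift:
  assumes T: "ell2_operator A A M T"
  shows "ell2_operator A A (M + \<bar>\<mu>\<bar>) (\<lambda>f i. T f i - \<mu> * f i)"
  unfolding ell2_operator_def
proof (intro conjI ballI allI)
  fix f assume f: "f \<in> ell2 A"
  show "(\<lambda>i. T f i - \<mu> * f i) \<in> ell2 A"
    by (rule ell2_diff[OF ell2_operatorD(2)[OF T f] ell2_scale[OF f]])
  have "ell2_norm A (\<lambda>i. T f i - \<mu> * f i) \<le> ell2_norm A (T f) + \<bar>\<mu>\<bar> * ell2_norm A f"
    using ell2_norm_diff_le[OF ell2_operatorD(2)[OF T f] ell2_scale[OF f], of \<mu>]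
    by (simp add: ell2_norm_scale)
  then show "ell2_norm A (\<lambda>i. T f i - \<mu> * f i) \<le> (M + \<bar>\<mu>\<bar>) * ell2_norm A f"
    using ell2_operatorD(3)[OF T f] by (simp add: distrib_right)
qed (use ell2_operatorD[OF T] in \<open>auto simp: fun_eq_iff algebra_simps\<close>)

lemma ell2_closure_subset: "ell2_closure A Z \<subseteq> ell2 A"
  by (auto simp: ell2_closure_def)

lemma ell2_closure_superset: "Z \<subseteq> ell2 A \<Longrightarrow> Z \<subseteq> ell2_closure A Z"
  by (auto simp: ell2_closure_def intro!: bexI)

lemma ell2_closureE:
  assumes "f \<in> ell2_closure A Z" "0 < \<delta>"
  obtains g where "g \<in> Z" "ell2_norm A (\<lambda>i. f i - g i) < \<delta>"
  using assms by (auto simp: ell2_closure_def)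

lemma ell2_norm_triangle:
  assumes "f \<in> ell2 A" "g \<in> ell2 A" "h \<in> ell2 A"
  shows "ell2_norm A (\<lambda>i. f i - h i) \<le> ell2_norm A (\<lambda>i. f i - g i) + ell2_norm A (\<lambda>i. g i - h i)"
  using ell2_norm_add_le[OF ell2_diff[OF assms(1,2)] ell2_diff[OF assms(2,3)]] by simp

lemma ell2_norm_le_diff:
  assumes "f \<in> ell2 A" "g \<in> ell2 A"
  shows "ell2_norm A f \<le> ell2_norm A g + ell2_norm A (\<lambda>i. f i - g i)"
  using ell2_norm_add_le[OF assms(2) ell2_diff[OF assms]] by simp

lemma fun_subspace_closure:
  assumes Z: "fun_subspace Z" "Z \<subseteq> ell2 A"
  shows "fun_subspace (ell2_closure A Z)"
proof -
  have add: "(\<lambda>i. f i + g i) \<in> ell2_closure A Z" if fg: "f \<in> ell2_closure A Z" "g \<in> ell2_closure A Z" for f g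
  proof -
    have fg': "f \<in> ell2 A" "g \<in> ell2 A" using fg ell2_closure_subset[of A Z] by auto
    have "\<exists>h\<in>Z. ell2_norm A (\<lambda>i. (f i + g i) - h i) < \<delta>" if "\<delta> > 0" for \<delta>
    proof -
      have "\<delta>/2 > 0" using that by simp
      from ell2_closureE[OF fg(1) this] obtain f'
        where 1: "f' \<in> Z" "ell2_norm A (\<lambda>i. f i - f' i) < \<delta>/2" .
      from ell2_closureE[OF fg(2) \<open>\<delta>/2 > 0\<close>] obtain g'
        where 2: "g' \<in> Z" "ell2_norm A (\<lambda>i. g i - g' i) < \<delta>/2" .
      have "ell2_norm A (\<lambda>i. (f i - f' i) + (g i - g' i)) \<le> ell2_norm A (\<lambda>i. f i - f' i) + ell2_norm A (\<lambda>i. g i - g' i)"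
        by (intro ell2_norm_add_le ell2_diff) (use 1 2 Z fg' in auto)
      also have "(\<lambda>i. (f i - f' i) + (g i - g' i)) = (\<lambda>i. (f i + g i) - (f' i + g' i))" by auto
      finally show ?thesis using 1 2 fun_subspaceD(2)[OF Z(1) 1(1) 2(1)] by (intro bexI[of _ "\<lambda>i. f' i + g' i"]) auto
    qed
    then show ?thesis using fg' by (simp add: ell2_closure_def ell2_add)
  qed
  have scale: "(\<lambda>i. a * f i) \<in> ell2_closure A Z" if f: "f \<in> ell2_closure A Z" for f a
  proof -
    have f': "f \<in> ell2 A" using f ell2_closure_subset[of A Z] by auto
    have "\<exists>h\<in>Z. ell2_norm A (\<lambda>i. a * f i - h i) < \<delta>" if "\<delta> > 0" for \<delta>
    proof -
      obtain f' where 1: "f' \<in> Z" "ell2_norm A (\<lambda>i. f i - f' i) < \<delta> / (\<bar>a\<bar> + 1)"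
        using ell2_closureE[OF f, of "\<delta> / (\<bar>a\<bar> + 1)"] \<open>\<delta> > 0\<close> by auto
      have "ell2_norm A (\<lambda>i. a * f i - a * f' i) = \<bar>a\<bar> * ell2_norm A (\<lambda>i. f i - f' i)"
        using ell2_norm_scale[of A a "\<lambda>i. f i - f' i"] by (simp add: right_diff_distrib)
      also have "\<dots> \<le> \<bar>a\<bar> * (\<delta> / (\<bar>a\<bar> + 1))" using 1 by (intro mult_left_mono) auto
      also have "\<dots> < \<delta>" using \<open>\<delta> > 0\<close> by (simp add: field_simps)
      finally show ?thesis using fun_subspaceD(3)[OF Z(1) 1(1)] by (intro bexI[of _ "\<lambda>i. a * f' i"]) auto
    qed
    then show ?thesis using f' by (simp add: ell2_closure_def ell2_scale)
  qed
  show ?thesis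
    using add scale fun_subspaceD(1)[OF Z(1)] ell2_closure_superset[OF Z(2)] by (auto simp: fun_subspace_def)
qed

lemma ell2_closure_closed:
  assumes Z: "Z \<subseteq> ell2 A" and f: "f \<in> ell2 A"
    and app: "\<And>\<delta>. \<delta> > 0 \<Longrightarrow> \<exists>g\<in>ell2_closure A Z. ell2_norm A (\<lambda>i. f i - g i) < \<delta>"
  shows "f \<in> ell2_closure A Z"
proof -
  have "\<exists>h\<in>Z. ell2_norm A (\<lambda>i. f i - h i) < \<delta>" if "\<delta> > 0" for \<delta>
  proof -
    obtain g where g: "g \<in> ell2_closure A Z" "ell2_norm A (\<lambda>i. f i - g i) < \<delta>/2"
      using app[of "\<delta>/2"] \<open>\<delta> > 0\<close> by auto
    obtain h where h: "h \<in> Z" "ell2_norm A (\<lambda>i. g i - h i) < \<delta>/2"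
      using ell2_closureE[OF g(1), of "\<delta>/2"] \<open>\<delta> > 0\<close> by auto
    have "ell2_norm A (\<lambda>i. f i - h i) \<le> ell2_norm A (\<lambda>i. f i - g i) + ell2_norm A (\<lambda>i. g i - h i)"
      by (rule ell2_norm_triangle) (use f g h Z ell2_closure_subset in auto)
    then show ?thesis using g h by (intro bexI[of _ h]) auto
  qed
  then show ?thesis using f by (simp add: ell2_closure_def)
qed

lemma ell2_closure_invariant:
  assumes Z: "Z \<subseteq> ell2 A" and T: "ell2_operator A A M T" and inv: "\<And>f. f \<in> Z \<Longrightarrow> T f \<in> Z"
    and f: "f \<in> ell2_closure A Z"
  shows "T f \<in> ell2_closure A Z"
proof -
  have f': "f \<in> ell2 A" using f ell2_closure_subset[of A Z] by auto
  have M: "0 \<le> M" by (rule ell2_operatorD(1)[OF T])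
  have "\<exists>h\<in>Z. ell2_norm A (\<lambda>i. T f i - h i) < \<delta>" if "\<delta> > 0" for \<delta>
  proof -
    obtain g where g: "g \<in> Z" "ell2_norm A (\<lambda>i. f i - g i) < \<delta> / (M + 1)"
      using ell2_closureE[OF f, of "\<delta> / (M + 1)"] \<open>\<delta> > 0\<close> M by auto
    have g': "g \<in> ell2 A" using g Z by auto
    have "ell2_norm A (\<lambda>i. T f i - T g i) \<le> M * ell2_norm A (\<lambda>i. f i - g i)"
      using ell2_operatorD(3)[OF T ell2_diff[OF f' g']] ell2_operator_diff[OF T f' g'] by simp
    also have "\<dots> \<le> M * (\<delta> / (M + 1))" using g M by (intro mult_left_mono) auto
    also have "\<dots> < \<delta>" using \<open>\<delta> > 0\<close> M by (simp add: field_simps)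
    finally show ?thesis using inv[OF g(1)] by (intro bexI[of _ "T g"]) auto
  qed
  then show ?thesis using ell2_operatorD(2)[OF T f'] by (simp add: ell2_closure_def)
qed

text \<open>Both sides depend continuously on \<open>f\<close>. So the estimate has to be checked only on a dense
  subspace, which in the applications consists of finite cycles.\<close>

lemma ell2_closure_bound:
  assumes Z: "Z \<subseteq> ell2 A" and S: "ell2_operator A I M S" and T: "ell2_operator A J N T"
    and b: "\<And>f. f \<in> Z \<Longrightarrow> ell2_norm I (S f) \<le> c * ell2_norm J (T f)" and c: "0 \<le> c"
    and f: "f \<in> ell2_closure A Z"
  shows "ell2_norm I (S f) \<le> c * ell2_norm J (T f)"
proof (rule field_le_epsilon)
  fix e :: real assume "e > 0"
  have f': "f \<in> ell2 A" using f ell2_closure_subset[of A Z] by auto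
  have MN: "0 \<le> M" "0 \<le> N" using ell2_operatorD(1) S T by auto
  let ?d = "e / (M + c * N + 1)"
  have pos: "0 < M + c * N + 1" using MN c by (simp add: add_nonneg_pos)
  then have "?d > 0" using \<open>e > 0\<close> by simp
  then obtain g where g: "g \<in> Z" "ell2_norm A (\<lambda>i. f i - g i) < ?d"
    using ell2_closureE[OF f] by metis
  have g': "g \<in> ell2 A" using g Z by auto
  have "ell2_norm I (\<lambda>i. S f i - S g i) \<le> M * ell2_norm A (\<lambda>i. f i - g i)"
    using ell2_operatorD(3)[OF S ell2_diff[OF f' g']] ell2_operator_diff[OF S f' g'] by simp
  also have "\<dots> \<le> M * ?d" using g MN by (intro mult_left_mono) auto
  finally have 1: "ell2_norm I (\<lambda>i. S f i - S g i) \<le> M * ?d" .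
  have "ell2_norm J (\<lambda>i. T f i - T g i) \<le> N * ell2_norm A (\<lambda>i. f i - g i)"
    using ell2_operatorD(3)[OF T ell2_diff[OF f' g']] ell2_operator_diff[OF T f' g'] by simp
  also have "\<dots> \<le> N * ?d" using g MN by (intro mult_left_mono) auto
  finally have 2: "ell2_norm J (\<lambda>i. T g i - T f i) \<le> N * ?d"
    by (simp add: ell2_norm_minus_commute[of J "T g"])
  have "ell2_norm I (S f) \<le> ell2_norm I (S g) + M * ?d"
    using ell2_norm_le_diff[OF ell2_operatorD(2)[OF S f'] ell2_operatorD(2)[OF S g']] 1 by simp
  also have "ell2_norm I (S g) \<le> c * (ell2_norm J (T f) + N * ?d)"
    using b[OF g(1)] mult_left_mono[OF order_trans[OF ell2_norm_le_diff[OF ell2_operatorD(2)[OF T g']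
      ell2_operatorD(2)[OF T f']] add_left_mono[OF 2]] c] by simp
  also have "c * (ell2_norm J (T f) + N * ?d) + M * ?d = c * ell2_norm J (T f) + (M + c * N) * ?d"
    by (simp only: distrib_left distrib_right mult.assoc add.assoc add.commute[of "c * (N * ?d)"])
  also have "(M + c * N) * ?d \<le> (M + c * N + 1) * ?d" using \<open>?d > 0\<close> by (intro mult_right_mono) auto
  also have "\<dots> = e" using pos by simp
  finally show "ell2_norm I (S f) \<le> c * ell2_norm J (T f) + e" by simp
qed

text \<open>A Cauchy sequence converges at every point, and bounds for the differences pass to the pointwise
  limit on each finite set, hence for the norm.\<close>

lemma ell2_closure_complete:
  assumes Z: "fun_subspace Z" "Z \<subseteq> ell2 A"
  shows "Metric_space (ell2_closure A Z) (\<lambda>f g. ell2_norm A (\<lambda>i. f i - g i))"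
    and "Metric_space.mcomplete (ell2_closure A Z) (\<lambda>f g. ell2_norm A (\<lambda>i. f i - g i))"
proof -
  let ?H = "ell2_closure A Z"
  have H: "f \<in> ell2 A" if "f \<in> ?H" for f using that ell2_closure_subset[of A Z] by auto
  interpret Metric_space ?H "\<lambda>f g. ell2_norm A (\<lambda>i. f i - g i)"
  proof
    fix f g h :: "'a \<Rightarrow> real"
    show "ell2_norm A (\<lambda>i. f i - g i) = ell2_norm A (\<lambda>i. g i - f i)" by (rule ell2_norm_minus_commute)
    show "(ell2_norm A (\<lambda>i. f i - g i) = 0) = (f = g)" if "f \<in> ?H" "g \<in> ?H"
    proof
      assume "ell2_norm A (\<lambda>i. f i - g i) = 0"
      then have "(\<lambda>i. f i - g i) = (\<lambda>i. 0)" using that H by (intro ell2_norm_eq_0[of _ A] ell2_diff) auto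
      then show "f = g" by (simp add: fun_eq_iff)
    qed simp
    show "ell2_norm A (\<lambda>i. f i - h i) \<le> ell2_norm A (\<lambda>i. f i - g i) + ell2_norm A (\<lambda>i. g i - h i)"
      if "f \<in> ?H" "g \<in> ?H" "h \<in> ?H"
      using that H by (intro ell2_norm_triangle) auto
  qed simp
  show "Metric_space ?H (\<lambda>f g. ell2_norm A (\<lambda>i. f i - g i))" by unfold_locales
  show "mcomplete"
    unfolding mcomplete_def
  proof (intro allI impI)
    fix \<sigma> assume \<sigma>: "MCauchy \<sigma>"
    have \<sigma>H: "\<sigma> n \<in> ?H" for n using \<sigma> by (auto simp: MCauchy_def)
    then have \<sigma>l: "\<sigma> n \<in> ell2 A" for n using H by auto
    have cau: "\<exists>N. \<forall>n n'. N \<le> n \<longrightarrow> N \<le> n' \<longrightarrow> ell2_norm A (\<lambda>i. \<sigma> n i - \<sigma> n' i) < e" if "e > 0" for e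
      using \<sigma> that by (auto simp: MCauchy_def)
    have "Cauchy (\<lambda>n. \<sigma> n i)" for i
    proof (rule metric_CauchyI)
      fix e :: real assume "e > 0"
      then obtain N where N: "\<And>n n'. N \<le> n \<Longrightarrow> N \<le> n' \<Longrightarrow> ell2_norm A (\<lambda>i. \<sigma> n i - \<sigma> n' i) < e"
        using cau by blast
      have "dist (\<sigma> m i) (\<sigma> n i) < e" if "N \<le> m" "N \<le> n" for m n
        using abs_le_ell2_norm[OF ell2_diff[OF \<sigma>l[of m] \<sigma>l[of n]], of i] N[OF that] by (simp add: dist_real_def)
      then show "\<exists>M. \<forall>m\<ge>M. \<forall>n\<ge>M. dist (\<sigma> m i) (\<sigma> n i) < e" by blast
    qed
    then have "\<exists>l. (\<lambda>n. \<sigma> n i) \<longlonglongrightarrow> l" for i using Cauchy_convergent_iff convergent_def by blast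
    then obtain f where lim: "\<And>i. (\<lambda>n. \<sigma> n i) \<longlonglongrightarrow> f i" by metis
    have out: "f i = 0" if "i \<notin> A" for i
      using lim[of i] LIMSEQ_unique[OF _ tendsto_const] ell2_outside[OF \<sigma>l that] by simp
    have *: "\<exists>N. \<forall>n\<ge>N. (\<lambda>i. \<sigma> n i - f i) \<in> ell2 A \<and> ell2_norm A (\<lambda>i. \<sigma> n i - f i) \<le> e" if e: "e > 0" for e
    proof -
      obtain N where N: "\<And>n n'. N \<le> n \<Longrightarrow> N \<le> n' \<Longrightarrow> ell2_norm A (\<lambda>i. \<sigma> n i - \<sigma> n' i) < e"
        using cau e by blast
      have "(\<lambda>i. \<sigma> n i - f i) \<in> ell2 A \<and> ell2_norm A (\<lambda>i. \<sigma> n i - f i) \<le> e" if n: "N \<le> n" for n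
      proof -
        have b: "L2_set (\<lambda>i. \<sigma> n i - f i) X \<le> e" if X: "finite X" "X \<subseteq> A" for X
        proof (rule LIMSEQ_le_const2)
          show "(\<lambda>n'. L2_set (\<lambda>i. \<sigma> n i - \<sigma> n' i) X) \<longlonglongrightarrow> L2_set (\<lambda>i. \<sigma> n i - f i) X"
            unfolding L2_set_def by (intro tendsto_intros lim)
          have "L2_set (\<lambda>i. \<sigma> n i - \<sigma> n' i) X \<le> e" if "N \<le> n'" for n'
            using L2_set_le_ell2_norm[OF ell2_diff[OF \<sigma>l[of n] \<sigma>l[of n']] X] N[OF n that] by simp
          then show "\<exists>N. \<forall>n'\<ge>N. L2_set (\<lambda>i. \<sigma> n i - \<sigma> n' i) X \<le> e" by blast
        qed
        have o: "\<And>i. i \<notin> A \<Longrightarrow> \<sigma> n i - f i = 0" using out ell2_outside[OF \<sigma>l] by simp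
        show ?thesis using ell2_boundedI[OF o _ b] ell2_norm_leI[OF o _ b] e by auto
      qed
      then show ?thesis by blast
    qed
    obtain N where "(\<lambda>i. \<sigma> N i - f i) \<in> ell2 A" using *[of 1] by auto
    then have fl: "f \<in> ell2 A" using ell2_diff[OF \<sigma>l[of N], of "\<lambda>i. \<sigma> N i - f i"] by simp
    have lt: "\<exists>N. \<forall>n\<ge>N. ell2_norm A (\<lambda>i. \<sigma> n i - f i) < e" if "e > 0" for e
      using *[of "e/2"] that by (smt (verit) field_sum_of_halves)
    have "f \<in> ?H"
    proof (rule ell2_closure_closed[OF Z(2) fl])
      fix e :: real assume "e > 0"
      then obtain n where "ell2_norm A (\<lambda>i. \<sigma> n i - f i) < e" using lt by fastforce
      then show "\<exists>g\<in>?H. ell2_norm A (\<lambda>i. f i - g i) < e"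
        using \<sigma>H[of n] ell2_norm_minus_commute[of A f "\<sigma> n"] by (intro bexI[of _ "\<sigma> n"]) auto
    qed
    then have "limitin mtopology \<sigma> f sequentially"
      unfolding limit_metric_sequentially using lt \<sigma>H by simp
    then show "\<exists>x. limitin mtopology \<sigma> x sequentially" by (rule exI[of _ f])
  qed
qed

text \<open>If \<open>1 - t T\<close> contracts, then \<open>T f = g\<close> is the fixed point equation \<open>f = (1 - t T) f + t g\<close>.
  Contraction is assumed only on a dense subspace; in the application this consists of finite cycles,
  whose norms are finite sums.\<close>

lemma inverse_of_contraction:
  fixes T :: "('i \<Rightarrow> real) \<Rightarrow> 'i \<Rightarrow> real"
  assumes Z: "fun_subspace Z" "Z \<subseteq> ell2 A" and T: "ell2_operator A A M T"
    and inv: "\<And>f. f \<in> Z \<Longrightarrow> T f \<in> Z" and t: "0 < t" and q: "0 \<le> q" "q < 1"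
    and contr: "\<And>f. f \<in> Z \<Longrightarrow> ell2_norm A (\<lambda>i. f i - t * T f i) \<le> q * ell2_norm A f"
  shows "\<exists>B. bounded_operator_on A (ell2_closure A Z) B \<and>
    (\<forall>f\<in>ell2_closure A Z. B (T f) = f \<and> T (B f) = f)"
proof -
  let ?H = "ell2_closure A Z"
  have H: "f \<in> ell2 A" if "f \<in> ?H" for f using that ell2_closure_subset[of A Z] by auto
  have sH: "fun_subspace ?H" by (rule fun_subspace_closure[OF Z])
  have TH: "T f \<in> ?H" if "f \<in> ?H" for f by (rule ell2_closure_invariant[OF Z(2) T inv that])
  have id: "ell2_operator A A 1 (\<lambda>f. f)" by (simp add: ell2_operator_def)
  have op: "ell2_operator A A (1 + t * M) (\<lambda>f i. f i - t * T f i)"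
    unfolding ell2_operator_def
  proof (intro conjI ballI allI)
    fix f assume f: "f \<in> ell2 A"
    have "ell2_norm A (\<lambda>i. f i - t * T f i) \<le> ell2_norm A f + t * ell2_norm A (T f)"
      using ell2_norm_diff_le[OF f ell2_scale[OF ell2_operatorD(2)[OF T f], of t]] t by (simp add: ell2_norm_scale)
    also have "\<dots> \<le> ell2_norm A f + t * (M * ell2_norm A f)"
      using ell2_operatorD(3)[OF T f] t by simp
    finally show "ell2_norm A (\<lambda>i. f i - t * T f i) \<le> (1 + t * M) * ell2_norm A f"
      by (simp add: algebra_simps)
    show "(\<lambda>i. f i - t * T f i) \<in> ell2 A" by (intro ell2_diff ell2_scale f ell2_operatorD(2)[OF T])
  qed (use t ell2_operatorD[OF T] in \<open>auto simp: algebra_simps\<close>)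
  have contrH: "ell2_norm A (\<lambda>i. f i - t * T f i) \<le> q * ell2_norm A f" if "f \<in> ?H" for f
    by (rule ell2_closure_bound[OF Z(2) op id contr q(1) that])
  have lower: "(1 - q) * ell2_norm A f \<le> t * ell2_norm A (T f)" if f: "f \<in> ?H" for f
  proof -
    have "ell2_norm A f \<le> ell2_norm A (\<lambda>i. t * T f i) + ell2_norm A (\<lambda>i. f i - t * T f i)"
      by (rule ell2_norm_le_diff[OF H[OF f] ell2_scale[OF ell2_operatorD(2)[OF T H[OF f]]]])
    then show ?thesis using contrH[OF f] t by (simp add: ell2_norm_scale algebra_simps)
  qed
  have inj: "f = g" if fg: "f \<in> ?H" "g \<in> ?H" "T f = T g" for f g
  proof -
    have "T (\<lambda>i. f i - g i) = (\<lambda>i. 0)" using ell2_operator_diff[OF T H[OF fg(1)] H[OF fg(2)]] fg(3) by simp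
    then have "(1 - q) * ell2_norm A (\<lambda>i. f i - g i) \<le> 0"
      using lower[OF fun_subspace_diff[OF sH fg(1,2)]] by simp
    then have "ell2_norm A (\<lambda>i. f i - g i) \<le> 0" using q by (simp add: mult_le_0_iff)
    then have "ell2_norm A (\<lambda>i. f i - g i) = 0" using ell2_norm_nonneg[of A "\<lambda>i. f i - g i"] by linarith
    from ell2_norm_eq_0[OF ell2_diff[OF H[OF fg(1)] H[OF fg(2)]] this] show ?thesis by (simp add: fun_eq_iff)
  qed
  have surj: "\<exists>f\<in>?H. T f = g" if g: "g \<in> ?H" for g
  proof -
    let ?\<Phi> = "\<lambda>f i. (f i - t * T f i) + t * g i"
    interpret M: Metric_space ?H "\<lambda>f g. ell2_norm A (\<lambda>i. f i - g i)"
      by (rule ell2_closure_complete(1)[OF Z])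
    have "\<exists>x. x \<in> ?H \<and> ?\<Phi> x = x"
    proof (rule M.Banach_fixedpoint_thm[of ?\<Phi> q], goal_cases)
      case (6 x) then show ?case by (intro exI[of _ x] conjI)
    next
      case 1 show ?case by (rule ell2_closure_complete(2)[OF Z])
    next
      case 2 show ?case using g by auto
    next
      case 3 show ?case
        by (intro funcsetI fun_subspaceD(2,3)[OF sH] fun_subspace_diff[OF sH] TH g)
    next
      case 4 show ?case by (rule q)
    next
      case (5 f h)
      have "(\<lambda>i. ?\<Phi> f i - ?\<Phi> h i) = (\<lambda>i. (f i - h i) - t * T (\<lambda>i. f i - h i) i)"
        by (simp add: ell2_operator_diff[OF T H[OF 5(1)] H[OF 5(2)]] fun_eq_iff algebra_simps)
      then show ?case
        using contrH[OF fun_subspace_diff[OF sH 5]] by simp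
    qed
    then obtain f where f: "f \<in> ?H" "?\<Phi> f = f" by auto
    have "T f i = g i" for i using fun_cong[OF f(2), of i] t by simp
    then show ?thesis using f by auto
  qed
  define B where "B g = (SOME f. f \<in> ?H \<and> T f = g)" for g
  have B: "B g \<in> ?H" "T (B g) = g" if "g \<in> ?H" for g
    using someI_ex[of "\<lambda>f. f \<in> ?H \<and> T f = g"] surj[OF that] unfolding B_def by auto
  have BT: "B (T f) = f" if "f \<in> ?H" for f
    using inj B[OF TH[OF that]] that by blast
  have "bounded_operator_on A ?H B"
    unfolding bounded_operator_on_def
  proof (intro conjI ballI allI)
    fix f g :: "'i \<Rightarrow> real" and a :: real assume f: "f \<in> ?H"
    show "B f \<in> ?H" by (rule B[OF f])
    show "B (\<lambda>i. a * f i) = (\<lambda>i. a * B f i)"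
      by (rule inj) (use B f fun_subspaceD(3)[OF sH] ell2_operatorD(5)[OF T] H in auto)
    assume g: "g \<in> ?H"
    show "B (\<lambda>i. f i + g i) = (\<lambda>i. B f i + B g i)"
      by (rule inj) (use B f g fun_subspaceD(2)[OF sH] ell2_operatorD(4)[OF T] H in auto)
  next
    have "ell2_norm A (B f) \<le> t / (1 - q) * ell2_norm A f" if "f \<in> ?H" for f
      using lower[OF B(1)[OF that]] B(2)[OF that] q by (simp add: field_simps)
    then show "\<exists>C. \<forall>f\<in>?H. ell2_norm A (B f) \<le> C * ell2_norm A f" by blast
  qed
  then show ?thesis using B BT by blast
qed


section \<open>Words, walks and cycles\<close>

text \<open>The integral of a 1-cochain along a walk, that is, its pairing with the chain of the walk.\<close>

definition walk_sum :: "('e \<Rightarrow> real) \<Rightarrow> ('e \<times> bool) list \<Rightarrow> real" where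
  "walk_sum f p = (\<Sum>s\<leftarrow>p. if snd s then f (fst s) else - f (fst s))"

definition rev_word :: "('x \<times> bool) list \<Rightarrow> ('x \<times> bool) list" where
  "rev_word p = rev (map (\<lambda>s. (fst s, \<not> snd s)) p)"

definition subst_word :: "('x \<Rightarrow> ('y \<times> bool) list) \<Rightarrow> ('x \<times> bool) list \<Rightarrow> ('y \<times> bool) list" where
  "subst_word \<alpha> p = concat (map (\<lambda>s. if snd s then \<alpha> (fst s) else rev_word (\<alpha> (fst s))) p)"

lemma walk_sum_simps [simp]:
  "walk_sum f [] = 0"
  "walk_sum f (s # p) = (if snd s then f (fst s) else - f (fst s)) + walk_sum f p"
  "walk_sum f (p @ q) = walk_sum f p + walk_sum f q"
  by (auto simp: walk_sum_def)

lemma rev_word_simps [simp]: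
  "rev_word [] = []"
  "rev_word (s # p) = rev_word p @ [(fst s, \<not> snd s)]"
  "length (rev_word p) = length p"
  "fst ` set (rev_word p) = fst ` set p"
  by (auto simp: rev_word_def image_image)

lemma subst_word_simps [simp]:
  "subst_word \<alpha> [] = []"
  "subst_word \<alpha> (s # p) = (if snd s then \<alpha> (fst s) else rev_word (\<alpha> (fst s))) @ subst_word \<alpha> p"
  "subst_word \<alpha> (p @ q) = subst_word \<alpha> p @ subst_word \<alpha> q"
  by (auto simp: subst_word_def)

lemma walk_sum_rev_word [simp]: "walk_sum f (rev_word p) = - walk_sum f p"
  by (induction p) auto

lemma walk_sum_subst_word: "walk_sum f (subst_word \<alpha> p) = walk_sum (\<lambda>e. walk_sum f (\<alpha> e)) p"
  by (induction p) auto

lemma walk_sum_cong: "(\<And>e. e \<in> fst ` set p \<Longrightarrow> f e = g e) \<Longrightarrow> walk_sum f p = walk_sum g p"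
  by (induction p) auto

lemma edges_subst_word: "fst ` set (subst_word \<alpha> p) = (\<Union>e\<in>fst ` set p. fst ` set (\<alpha> e))"
  by (induction p) (simp_all add: image_Un)

lemma length_subst_word_le:
  "(\<And>e. e \<in> fst ` set p \<Longrightarrow> length (\<alpha> e) \<le> K) \<Longrightarrow> length (subst_word \<alpha> p) \<le> K * length p"
  by (induction p) (auto simp: add_mono)

lemma abs_walk_sum_le: "\<bar>walk_sum f p\<bar> \<le> real (length p) * (\<Sum>e\<in>fst ` set p. \<bar>f e\<bar>)"
proof (induction p)
  case (Cons s p)
  let ?S = "\<Sum>e\<in>fst ` set (s # p). \<bar>f e\<bar>"
  have 1: "\<bar>f (fst s)\<bar> \<le> ?S" by (rule member_le_sum) auto
  have "(\<Sum>e\<in>fst ` set p. \<bar>f e\<bar>) \<le> ?S" by (rule sum_mono2) auto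
  then have "real (length p) * (\<Sum>e\<in>fst ` set p. \<bar>f e\<bar>) \<le> real (length p) * ?S"
    by (rule mult_left_mono) simp
  then have "\<bar>walk_sum f p\<bar> \<le> real (length p) * ?S" using Cons.IH by linarith
  moreover have "\<bar>walk_sum f (s # p)\<bar> \<le> \<bar>f (fst s)\<bar> + \<bar>walk_sum f p\<bar>" by auto
  ultimately show ?case using 1 by (simp add: distrib_right)
qed simp

lemma walk_sum_expand:
  assumes "finite X" "fst ` set p \<subseteq> X"
  shows "walk_sum f p = (\<Sum>e\<in>X. f e * walk_sum (\<lambda>e'. of_bool (e' = e)) p)"
  using assms(2)
proof (induction p)
  case (Cons s p)
  have "(\<Sum>e\<in>X. f e * (if snd s then of_bool (fst s = e) else - of_bool (fst s = e))) =
    (if snd s then 1 else -1) * (\<Sum>e\<in>X. if fst s = e then f e else 0)"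
    by (auto simp: sum_distrib_left sum_negf[symmetric] intro!: sum.cong)
  also have "\<dots> = (if snd s then f (fst s) else - f (fst s))"
    using Cons.prems assms(1) by (simp add: sum.delta)
  finally show ?case using Cons by (simp add: distrib_left sum.distrib)
qed simp

context
  fixes G :: "('v, 'e) pre_digraph"
  assumes wf: "wf_digraph G"
begin

lemma walk_verts: "walk G u p v \<Longrightarrow> u \<in> verts G \<and> v \<in> verts G"
  using wf by (induction p arbitrary: u) (auto simp: step_src_def step_dst_def wf_digraph_def)

lemma walk_append: "walk G u (p @ q) w \<longleftrightarrow> (\<exists>v. walk G u p v \<and> walk G v q w)"
  by (induction p arbitrary: u) (auto dest: walk_verts)

lemma walk_rev_word: "walk G u p v \<Longrightarrow> walk G v (rev_word p) u"
proof (induction p arbitrary: u)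
  case (Cons s p)
  moreover have "walk G (step_dst G s) [(fst s, \<not> snd s)] u"
    using Cons.prems wf by (auto simp: step_src_def step_dst_def wf_digraph_def split: if_splits)
  ultimately show ?case by (auto simp: walk_append)
qed auto

lemma walk_subst_word:
  assumes \<alpha>: "\<And>e. e \<in> arcs G' \<Longrightarrow> walk G (tail G' e) (\<alpha> e) (head G' e)" and V: "verts G' \<subseteq> verts G"
  shows "walk G' u p v \<Longrightarrow> walk G u (subst_word \<alpha> p) v"
proof (induction p arbitrary: u)
  case (Cons s p)
  have "walk G u (if snd s then \<alpha> (fst s) else rev_word (\<alpha> (fst s))) (step_dst G' s)"
    using Cons.prems \<alpha>[of "fst s"] walk_rev_word by (auto simp: step_src_def step_dst_def)
  then show ?case using Cons by (auto simp: walk_append)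
qed (use V in auto)

lemma walk_arcs: "walk G u p v \<Longrightarrow> fst ` set p \<subseteq> arcs G"
  by (induction p arbitrary: u) auto

lemma walk_sum_coboundary0: "walk G u p v \<Longrightarrow> walk_sum (coboundary0 G f) p = f v - f u"
  by (induction p arbitrary: u) (auto simp: coboundary0_def step_src_def step_dst_def)

lemma walk_nth:
  assumes "walk G u p v" "i < length p"
  shows "fst (p ! i) \<in> arcs G"
    and "step_src G (p ! i) = (if i = 0 then u else step_dst G (p ! (i - 1)))"
    and "step_dst G (p ! i) = (if Suc i = length p then v else step_src G (p ! Suc i))"
  using assms
proof (induction p arbitrary: u i)
  case (Cons s p)
  {
    case 1 then show ?case using Cons.IH(1) by (cases i) auto
  next
    case 2 then show ?case using Cons.IH(2) by (cases i) (auto simp: nth_Cons')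
  next
    case 3
    show ?case
    proof (cases p)
      case Nil then show ?thesis using 3 by auto
    next
      case (Cons s' p')
      then show ?thesis using 3 Cons.IH(3)[of "step_dst G s" "i - 1"] by (cases i) auto
    qed
  }
qed auto

text \<open>A closed walk that repeats a vertex splits there into two shorter closed walks. If it repeats no
  vertex, it can repeat an edge only by going straight back along it, and then it ends there. So
  statements about closed walks follow from cycles and backtrackings by induction on the length.\<close>

lemma closed_walk_cases:
  assumes p: "walk G a p a" "p \<noteq> []"
  obtains (cycle) "cycle_walk G p"
  | (backtrack) e t where "p = [(e, t), (e, \<not> t)]"
  | (split) u r v b where "p = u @ r @ v" "r \<noteq> []" "u @ v \<noteq> []" "walk G b r b" "walk G a (u @ v) a"
proof (cases "distinct (map (step_src G) p)")
  case False
  then obtain i j where ij: "i < j" "j < length p" "step_src G (p ! i) = step_src G (p ! j)"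
    unfolding distinct_conv_nth by (metis length_map linorder_neqE_nat nth_map)
  let ?u = "take i p" and ?r = "take (j - i) (drop i p)" and ?v = "drop j p"
  have eq: "p = ?u @ ?r @ ?v"
  proof -
    have "drop i p = ?r @ drop (j - i) (drop i p)" by (rule append_take_drop_id[symmetric])
    also have "drop (j - i) (drop i p) = ?v" using ij(1) by simp
    finally show ?thesis by (metis append_take_drop_id)
  qed
  have r: "?r = p ! i # tl ?r"
    using ij by (cases "?r") (auto simp: hd_conv_nth[symmetric] nth_append take_Cons' Cons_nth_drop_Suc[symmetric])
  have v: "?v = p ! j # tl ?v" using ij by (simp add: Cons_nth_drop_Suc[symmetric])
  obtain b c where w: "walk G a ?u b" "walk G b ?r c" "walk G c ?v a"
    using p(1) eq by (metis walk_append)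
  have "b = step_src G (p ! i)" using w(2) r by (metis walk.simps(2))
  moreover have "c = step_src G (p ! j)" using w(3) v by (metis walk.simps(2))
  ultimately have "b = c" using ij by simp
  then show thesis using split[OF eq] r v w by (metis Nil_is_append_conv list.distinct(1) walk_append)
next
  case True
  show thesis
  proof (cases "distinct (map fst p)")
    case d: True
    show thesis by (rule cycle) (use p d True in \<open>auto simp: cycle_walk_def\<close>)
  next
    case False
    then obtain i j where ij: "i < j" "j < length p" "fst (p ! i) = fst (p ! j)"
      unfolding distinct_conv_nth by (metis length_map linorder_neqE_nat nth_map)
    have src: "x = y" if "x < length p" "y < length p" "step_src G (p ! x) = step_src G (p ! y)" for x y
      using True that by (auto simp: distinct_conv_nth)
    have opp: "snd (p ! j) = (\<not> snd (p ! i))"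
      using src[of i j] ij by (cases "snd (p ! i)"; cases "snd (p ! j)") (auto simp: step_src_def)
    then have ends: "step_dst G (p ! i) = step_src G (p ! j)" "step_dst G (p ! j) = step_src G (p ! i)"
      using ij by (auto simp: step_src_def step_dst_def)
    have j: "j = Suc i"
      using walk_nth(3)[OF p(1), of i] ends(1) src[of "Suc i" j] ij by (auto split: if_splits)
    have jl: "Suc j = length p"
    proof (rule ccontr)
      assume "Suc j \<noteq> length p"
      then show False using walk_nth(3)[OF p(1), of j] ends(2) src[of "Suc j" i] ij by auto
    qed
    have "step_src G (p ! i) = a" using walk_nth(3)[OF p(1), of j] ends(2) ij jl by auto
    moreover have "step_src G (p ! 0) = a" using walk_nth(2)[OF p(1), of 0] p(2) by auto
    ultimately have "i = 0" using src[of i 0] ij p(2) by auto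
    then have "length p = 2" using j jl by simp
    then obtain s t where st: "p = [s, t]" by (auto simp: length_Suc_conv numeral_2_eq_2)
    have "p = [(fst s, snd s), (fst s, \<not> snd s)]"
      using st ij opp \<open>i = 0\<close> j by (auto simp: prod_eq_iff)
    then show thesis by (rule backtrack)
  qed
qed

lemma walk_sum_cycle_walk:
  assumes "cycle_walk G p"
  shows "walk_sum f p = (\<Sum>e\<in>fst ` set p. incidence p e * f e)"
proof -
  have d: "inj_on fst (set p)" "distinct p"
    using assms by (auto simp: cycle_walk_def distinct_map)
  have "walk_sum f p = (\<Sum>s\<in>set p. if snd s then f (fst s) else - f (fst s))"
    unfolding walk_sum_def using d(2) by (simp add: sum_list_distinct_conv_sum_set)
  also have "\<dots> = (\<Sum>s\<in>set p. incidence p (fst s) * f (fst s))"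
  proof (rule sum.cong)
    fix s assume s: "s \<in> set p"
    have "(fst s, b) \<in> set p \<longleftrightarrow> b = snd s" for b
      using inj_onD[OF d(1), of "(fst s, b)" s] s by (cases s) auto
    then show "(if snd s then f (fst s) else - f (fst s)) = incidence p (fst s) * f (fst s)"
      by (auto simp: incidence_def)
  qed simp
  also have "\<dots> = (\<Sum>e\<in>fst ` set p. incidence p e * f e)"
    by (simp add: sum.reindex[OF d(1)] comp_def)
  finally show ?thesis .
qed

lemma incidence_nth:
  assumes "cycle_walk G p" "i < length p"
  shows "incidence p (fst (p ! i)) = (if snd (p ! i) then 1 else -1)"
proof -
  have d: "inj_on fst (set p)" using assms by (auto simp: cycle_walk_def distinct_map)
  have "(fst (p ! i), b) \<in> set p \<longleftrightarrow> b = snd (p ! i)" for b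
    using inj_onD[OF d, of "(fst (p ! i), b)" "p ! i"] assms(2) by (cases "p ! i") (auto dest: nth_mem)
  then show ?thesis by (auto simp: incidence_def)
qed

lemma incidence_squared:
  assumes "e \<in> fst ` set p"
  shows "incidence p e * incidence p e = 1"
proof -
  obtain b where "(e, b) \<in> set p" using assms by auto
  then show ?thesis by (cases b) (auto simp: incidence_def)
qed

text \<open>Kirchhoff's law at a vertex of \<open>p\<close>, applied to \<open>r\<close>, says that consecutive edges of \<open>p\<close> are
  traversed by \<open>r\<close> either both in the direction of \<open>p\<close> or both against it. Hence a polygon determines
  the sum of a cochain around its boundary up to sign, whatever walk its orientation selects.\<close>

lemma cycle_walk_unique:
  assumes p: "cycle_walk G p" and r: "cycle_walk G r" and eq: "fst ` set r = fst ` set p"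
  obtains \<sigma> :: real where "\<bar>\<sigma>\<bar> = 1" "\<And>e. e \<in> fst ` set p \<Longrightarrow> incidence r e = \<sigma> * incidence p e"
proof -
  define k where "k = length p"
  define e where "e i = fst (p ! i)" for i
  define \<rho> where "\<rho> i = incidence r (e i) * incidence p (e i)" for i
  obtain u where pu: "walk G u p u" using p by (auto simp: cycle_walk_def)
  obtain u' where ru: "walk G u' r u'" using r by (auto simp: cycle_walk_def)
  have src: "x = y" if "x < k" "y < k" "step_src G (p ! x) = step_src G (p ! y)" for x y
    using p that by (auto simp: cycle_walk_def distinct_conv_nth k_def)
  have c: "fst ` set p = e ` {..<k}"
    by (auto simp: e_def k_def set_conv_nth image_iff)
  have inj: "inj_on e {..<k}"
    using p by (auto simp: cycle_walk_def distinct_conv_nth inj_on_def e_def k_def)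
  have step: "\<rho> i = \<rho> (Suc i)" if i: "Suc i < k" for i
  proof -
    define v where "v = step_src G (p ! Suc i)"
    define \<phi> where "\<phi> = coboundary0 G (\<lambda>x. of_bool (x = v))"
    have "0 = walk_sum \<phi> r" unfolding \<phi>_def using walk_sum_coboundary0[OF ru] by simp
    also have "\<dots> = (\<Sum>j<k. incidence r (e j) * \<phi> (e j))"
      unfolding walk_sum_cycle_walk[OF r] eq c by (simp add: sum.reindex[OF inj] comp_def)
    also have "\<dots> = (\<Sum>j<k. \<rho> j * (of_bool (j = i) - of_bool (j = Suc i)))"
    proof (rule sum.cong)
      fix j assume j: "j \<in> {..<k}"
      then have jk: "j < length p" by (simp add: k_def)
      have "\<phi> (e j) = incidence p (e j) * (of_bool (step_dst G (p ! j) = v) - of_bool (step_src G (p ! j) = v))"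
        using walk_nth(1)[OF pu jk]
        by (simp add: \<phi>_def e_def incidence_nth[OF p jk] coboundary0_def step_src_def step_dst_def)
      moreover have "step_src G (p ! j) = v \<longleftrightarrow> j = Suc i" using src[of j "Suc i"] j i by (auto simp: v_def)
      moreover have "step_dst G (p ! j) = v \<longleftrightarrow> j = i"
      proof (cases "Suc j = k")
        case True
        then have "step_dst G (p ! j) = step_src G (p ! 0)"
          using walk_nth(3)[OF pu jk] walk_nth(2)[OF pu, of 0] i
          by (cases "p = []") (auto simp: k_def)
        then show ?thesis using src[of 0 "Suc i"] True i by (auto simp: v_def)
      next
        case False
        then show ?thesis
          using walk_nth(3)[OF pu jk] src[of "Suc j" "Suc i"] j i by (auto simp: v_def k_def)
      qed
      ultimately show "incidence r (e j) * \<phi> (e j) = \<rho> j * (of_bool (j = i) - of_bool (j = Suc i))"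
        by (simp add: \<rho>_def mult_ac)
    qed simp
    also have "\<dots> = \<rho> i - \<rho> (Suc i)"
    proof -
      have "(\<Sum>j<k. \<rho> j * of_bool (j = x)) = \<rho> x" if "x < k" for x
      proof -
        have "(\<Sum>j<k. \<rho> j * of_bool (j = x)) = (\<Sum>j<k. if j = x then \<rho> j else 0)"
          by (rule sum.cong) auto
        then show ?thesis using that by simp
      qed
      then show ?thesis using i by (simp add: right_diff_distrib sum_subtractf)
    qed
    finally show ?thesis by simp
  qed
  have const: "\<rho> i = \<rho> 0" if "i < k" for i
    using that by (induction i) (use step in auto)
  have k0: "0 < k" using p by (auto simp: cycle_walk_def k_def)
  have mem: "e 0 \<in> fst ` set p" using k0 by (auto simp: e_def k_def)
  have "\<rho> 0 * \<rho> 0 = 1"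
    using incidence_squared[OF mem] incidence_squared[of "e 0" r] mem eq
    by (metis \<rho>_def mult.assoc mult.commute mult_1_right)
  then have "\<bar>\<rho> 0\<bar> = 1" by (auto simp: square_eq_1_iff)
  moreover have "incidence r x = \<rho> 0 * incidence p x" if x: "x \<in> fst ` set p" for x
  proof -
    obtain i where i: "i < k" "x = e i" using x unfolding c by auto
    have "\<rho> 0 * incidence p x = incidence r x * (incidence p x * incidence p x)"
      unfolding const[OF i(1), symmetric] by (simp add: \<rho>_def i(2))
    then show ?thesis using incidence_squared[OF x] by simp
  qed
  ultimately show thesis by (rule that)
qed

lemma abs_walk_sum_cycle_walk:
  assumes "cycle_walk G p" "cycle_walk G r" "fst ` set r = fst ` set p"
  shows "\<bar>walk_sum f r\<bar> = \<bar>walk_sum f p\<bar>"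
proof -
  obtain \<sigma> :: real where \<sigma>: "\<bar>\<sigma>\<bar> = 1" "\<And>e. e \<in> fst ` set p \<Longrightarrow> incidence r e = \<sigma> * incidence p e"
    using cycle_walk_unique[OF assms] by metis
  have "walk_sum f r = \<sigma> * walk_sum f p"
    unfolding walk_sum_cycle_walk[OF assms(1)] walk_sum_cycle_walk[OF assms(2)] assms(3) sum_distrib_left
    by (rule sum.cong) (use \<sigma> in auto)
  then show ?thesis using \<sigma>(1) by (simp add: abs_mult)
qed

lemma coboundary1_eq_walk_sum:
  assumes "polygon_orientation G D \<omega>" "c \<in> polygons G D"
  shows "coboundary1 G D \<omega> f c = walk_sum f (\<omega> c)"
  using assms walk_sum_cycle_walk[of "\<omega> c" f] by (simp add: polygon_orientation_def coboundary1_def)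

lemma finite_polygons_subset: "finite X \<Longrightarrow> finite {c \<in> polygons G D. c \<subseteq> X}"
  by (rule finite_subset[of _ "Pow X"]) auto

text \<open>A combinatorial Stokes theorem: cutting at repeated vertices fills a closed walk of length at most
  \<open>D\<close> by polygons whose number is at most that length, up to backtrackings, which contribute nothing.\<close>

lemma closed_walk_sum_le:
  assumes \<omega>: "polygon_orientation G D \<omega>"
  shows "walk G a p a \<Longrightarrow> length p \<le> D \<Longrightarrow>
    \<bar>walk_sum f p\<bar> \<le> real (length p) * (\<Sum>c | c \<in> polygons G D \<and> c \<subseteq> fst ` set p. \<bar>coboundary1 G D \<omega> f c\<bar>)"
proof (induction "length p" arbitrary: p a rule: less_induct)
  case less
  define \<Sigma> where "\<Sigma> q = (\<Sum>c | c \<in> polygons G D \<and> c \<subseteq> fst ` set q. \<bar>coboundary1 G D \<omega> f c\<bar>)"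
    for q :: "('e \<times> bool) list"
  have \<Sigma>0: "0 \<le> \<Sigma> q" for q by (simp add: \<Sigma>_def sum_nonneg)
  show ?case
  proof (cases "p = []")
    case False
    from less.prems(1) this show ?thesis
    proof (cases rule: closed_walk_cases)
      case cycle
      let ?c = "fst ` set p"
      have c: "?c \<in> polygons G D" using cycle less.prems by (auto simp: polygons_def)
      then have "\<bar>walk_sum f p\<bar> = \<bar>coboundary1 G D \<omega> f ?c\<bar>"
        unfolding coboundary1_eq_walk_sum[OF \<omega> c]
        by (intro abs_walk_sum_cycle_walk) (use \<omega> cycle in \<open>auto simp: polygon_orientation_def\<close>)
      also have "\<dots> \<le> \<Sigma> p"
        unfolding \<Sigma>_def by (rule member_le_sum) (use c finite_polygons_subset[of ?c D] in auto)
      also have "\<dots> \<le> real (length p) * \<Sigma> p"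
        using False \<Sigma>0[of p] by (cases p) (auto simp: algebra_simps)
      finally show ?thesis by (simp add: \<Sigma>_def)
    next
      case (backtrack e t)
      then show ?thesis using \<Sigma>0[of p] by (auto simp: \<Sigma>_def)
    next
      case (split u r v b)
      have mono: "\<Sigma> q \<le> \<Sigma> p" if "set q \<subseteq> set p" for q
        unfolding \<Sigma>_def
      proof (rule sum_mono2[OF finite_polygons_subset])
        show "{c \<in> polygons G D. c \<subseteq> fst ` set q} \<subseteq> {c \<in> polygons G D. c \<subseteq> fst ` set p}"
          using that by blast
      qed auto
      have "\<bar>walk_sum f r\<bar> \<le> real (length r) * \<Sigma> r"
        unfolding \<Sigma>_def by (rule less.hyps[OF _ split(4)]) (use split less.prems in auto)
      also have "\<dots> \<le> real (length r) * \<Sigma> p" by (intro mult_left_mono mono) (use split in auto)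
      finally have 1: "\<bar>walk_sum f r\<bar> \<le> real (length r) * \<Sigma> p" .
      have "\<bar>walk_sum f (u @ v)\<bar> \<le> real (length (u @ v)) * \<Sigma> (u @ v)"
        unfolding \<Sigma>_def by (rule less.hyps[OF _ split(5)]) (use split less.prems in auto)
      also have "\<dots> \<le> real (length (u @ v)) * \<Sigma> p" by (intro mult_left_mono mono) (use split in auto)
      finally have 2: "\<bar>walk_sum f (u @ v)\<bar> \<le> real (length (u @ v)) * \<Sigma> p" .
      have "\<bar>walk_sum f p\<bar> \<le> \<bar>walk_sum f r\<bar> + \<bar>walk_sum f (u @ v)\<bar>" using split(1) by simp
      also have "\<dots> \<le> real (length r + length (u @ v)) * \<Sigma> p"
        using 1 2 unfolding of_nat_add distrib_right by linarith
      finally show ?thesis using split(1) by (simp add: \<Sigma>_def add_ac)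
    qed
  qed simp
qed

end


section \<open>The spectral gap as an inequality on finite cycles\<close>

definition finite_cycles :: "('v, 'e) pre_digraph \<Rightarrow> ('e \<Rightarrow> real) set" where
  "finite_cycles G =
     {f. (\<forall>e. e \<notin> arcs G \<longrightarrow> f e = 0) \<and> finite {e. f e \<noteq> 0} \<and> (\<forall>v\<in>verts G. boundary1 G f v = 0)}"

lemma finite_cyclesD:
  assumes "f \<in> finite_cycles G"
  shows "e \<notin> arcs G \<Longrightarrow> f e = 0" "finite {e. f e \<noteq> 0}" "v \<in> verts G \<Longrightarrow> boundary1 G f v = 0"
  using assms by (auto simp: finite_cycles_def)

lemma finite_cycles_ell2: "finite_cycles G \<subseteq> ell2 (arcs G)"
proof
  fix f assume f: "f \<in> finite_cycles G"
  show "f \<in> ell2 (arcs G)"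
    by (rule ell2_finite_support(1)[of "{e. f e \<noteq> 0}"]) (use finite_cyclesD[OF f] in auto)
qed

lemma ell2_0c_eq: "ell2_0c G = ell2_closure (arcs G) (finite_cycles G)"
  by (simp add: ell2_0c_def finite_cycles_def)

lemma fun_subspace_finite_cycles: "fun_subspace (finite_cycles G)"
  unfolding fun_subspace_def
proof (intro conjI ballI allI)
  show "(\<lambda>e. 0) \<in> finite_cycles G" by (simp add: finite_cycles_def boundary1_def)
next
  fix f g :: "'a \<Rightarrow> real" and a :: real
  assume f: "f \<in> finite_cycles G"
  have "finite {e. a * f e \<noteq> 0}" by (rule finite_subset[OF _ finite_cyclesD(2)[OF f]]) auto
  moreover have "boundary1 G (\<lambda>e. a * f e) v = a * boundary1 G f v" for v
    by (simp add: boundary1_def right_diff_distrib sum_distrib_left)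
  ultimately show "(\<lambda>e. a * f e) \<in> finite_cycles G" using f by (simp add: finite_cycles_def)
  assume g: "g \<in> finite_cycles G"
  have "finite {e. f e + g e \<noteq> 0}"
    by (rule finite_subset[OF _ finite_UnI[OF finite_cyclesD(2)[OF f] finite_cyclesD(2)[OF g]]]) auto
  moreover have "boundary1 G (\<lambda>e. f e + g e) v = boundary1 G f v + boundary1 G g v" for v
    by (simp add: boundary1_def sum.distrib)
  ultimately show "(\<lambda>e. f e + g e) \<in> finite_cycles G" using f g by (simp add: finite_cycles_def)
qed

lemma ell2_norm_sq_diff_scaled:
  assumes "finite {i. f i \<noteq> 0}" "finite {i. g i \<noteq> 0}" "f \<in> ell2 A" "g \<in> ell2 A"
  shows "(ell2_norm A (\<lambda>i. f i - t * g i))\<^sup>2 =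
    (ell2_norm A f)\<^sup>2 - 2 * t * pairing f g + t\<^sup>2 * (ell2_norm A g)\<^sup>2"
proof -
  let ?X = "{i. f i \<noteq> 0} \<union> {i. g i \<noteq> 0}"
  have X: "finite ?X" "?X \<subseteq> A" using assms by (auto simp: ell2_def)
  have "pairing f g = (\<Sum>i\<in>?X. f i * g i)" by (rule pairing_eq_sum) (use X in auto)
  moreover have "(ell2_norm A h)\<^sup>2 = (\<Sum>i\<in>?X. (h i)\<^sup>2)" if "\<And>i. i \<notin> ?X \<Longrightarrow> h i = 0" for h
    by (rule ell2_finite_support(2)[OF X that])
  moreover have "(f i - t * g i)\<^sup>2 = (f i)\<^sup>2 - 2 * t * (f i * g i) + t\<^sup>2 * (g i)\<^sup>2" for i
    by (simp add: power2_eq_square algebra_simps)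
  ultimately show ?thesis by (simp add: sum.distrib sum_subtractf sum_distrib_left)
qed

locale polygon_complex =
  fixes G :: "('v, 'e) pre_digraph" and D :: nat and \<omega> :: "'e set \<Rightarrow> ('e \<times> bool) list" and m :: nat
  assumes wf: "wf_digraph G" and orientation: "polygon_orientation G D \<omega>"
    and locally_finite: "finite {e \<in> arcs G. head G e = v}" "finite {e \<in> arcs G. tail G e = v}"
    and polygons_through: "finite {c \<in> polygons G D. e \<in> c}" "card {c \<in> polygons G D. e \<in> c} \<le> m"
begin

lemma polygonD:
  assumes "c \<in> polygons G D"
  shows "c \<subseteq> arcs G" "finite c" "card c \<le> D" "cycle_walk G (\<omega> c)" "fst ` set (\<omega> c) = c"
    "length (\<omega> c) \<le> D" "\<exists>u. walk G u (\<omega> c) u"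
proof -
  obtain p where p: "c = fst ` set p" "cycle_walk G p" "length p \<le> D"
    using assms by (auto simp: polygons_def)
  show "c \<subseteq> arcs G" using p walk_arcs[OF wf] unfolding cycle_walk_def by blast
  show "finite c" using p by simp
  show c: "card c \<le> D" using p card_length[of "map fst p"] by simp
  show \<omega>: "cycle_walk G (\<omega> c)" "fst ` set (\<omega> c) = c"
    using orientation assms by (auto simp: polygon_orientation_def)
  have "distinct (map fst (\<omega> c))" using \<omega>(1) by (simp add: cycle_walk_def)
  from distinct_card[OF this] show "length (\<omega> c) \<le> D" using \<omega>(2) c by simp
  show "\<exists>u. walk G u (\<omega> c) u" using \<omega>(1) by (simp add: cycle_walk_def)
qed

abbreviation "d1 \<equiv> coboundary1 G D \<omega>"
abbreviation "b2 \<equiv> boundary2 G D \<omega>"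
abbreviation "opnorm \<equiv> sqrt (real (D * m))"

lemma abs_incidence_mult_le: "\<bar>incidence p e * x\<bar> \<le> \<bar>x\<bar>"
  by (simp add: incidence_def)

lemma coboundary1_operator: "ell2_operator (arcs G) (polygons G D) opnorm d1"
  unfolding ell2_operator_def
proof (intro conjI ballI allI)
  fix f assume f: "f \<in> ell2 (arcs G)"
  have out: "d1 f c = 0" if "c \<notin> polygons G D" for c using that by (simp add: coboundary1_def)
  have dom: "\<bar>d1 f c\<bar> \<le> 1 * (\<Sum>e\<in>c. \<bar>f e\<bar>)" if "c \<in> polygons G D" for c
  proof -
    have "\<bar>d1 f c\<bar> \<le> (\<Sum>e\<in>c. \<bar>incidence (\<omega> c) e * f e\<bar>)" using that by (simp add: coboundary1_def)
    also have "\<dots> \<le> (\<Sum>e\<in>c. \<bar>f e\<bar>)"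
      by (rule sum_mono) (rule abs_incidence_mult_le)
    finally show ?thesis by simp
  qed
  show "d1 f \<in> ell2 (polygons G D)"
    by (rule schur_ell2[OF f out dom, where n = D and m = m]) (use polygonD polygons_through in auto)
  have "ell2_norm (polygons G D) (d1 f) \<le> 1 * opnorm * ell2_norm (arcs G) f"
    by (rule schur_norm_le[OF f out dom]) (use polygonD polygons_through in auto)
  then show "ell2_norm (polygons G D) (d1 f) \<le> opnorm * ell2_norm (arcs G) f" by simp
qed (auto simp: coboundary1_def fun_eq_iff distrib_left sum.distrib sum_distrib_left mult_ac)

lemma boundary2_operator: "ell2_operator (polygons G D) (arcs G) opnorm b2"
  unfolding ell2_operator_def
proof (intro conjI ballI allI)
  fix f assume f: "f \<in> ell2 (polygons G D)"
  have out: "b2 f e = 0" if "e \<notin> arcs G" for e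
    using that polygonD(1) by (auto simp: boundary2_def intro!: sum.neutral)
  have dom: "\<bar>b2 f e\<bar> \<le> 1 * (\<Sum>c | c \<in> polygons G D \<and> e \<in> c. \<bar>f c\<bar>)" if "e \<in> arcs G" for e
  proof -
    have "\<bar>b2 f e\<bar> \<le> (\<Sum>c | c \<in> polygons G D \<and> e \<in> c. \<bar>incidence (\<omega> c) e * f c\<bar>)"
      by (simp add: boundary2_def)
    also have "\<dots> \<le> (\<Sum>c | c \<in> polygons G D \<and> e \<in> c. \<bar>f c\<bar>)"
      by (rule sum_mono) (rule abs_incidence_mult_le)
    finally show ?thesis by simp
  qed
  have col: "finite {e \<in> arcs G. c \<in> {c \<in> polygons G D. e \<in> c}} \<and>
    card {e \<in> arcs G. c \<in> {c \<in> polygons G D. e \<in> c}} \<le> D" for c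
  proof (cases "c \<in> polygons G D")
    case True
    then have "{e \<in> arcs G. c \<in> {c \<in> polygons G D. e \<in> c}} = c" using polygonD(1) by auto
    then show ?thesis using polygonD True by simp
  qed simp
  show "b2 f \<in> ell2 (arcs G)"
    by (rule schur_ell2[OF f out dom, where n = m and m = D]) (use col polygons_through in auto)
  have "ell2_norm (arcs G) (b2 f) \<le> 1 * sqrt (real (m * D)) * ell2_norm (polygons G D) f"
    by (rule schur_norm_le[OF f out dom]) (use col polygons_through in auto)
  then show "ell2_norm (arcs G) (b2 f) \<le> opnorm * ell2_norm (polygons G D) f" by (simp add: mult.commute)
qed (auto simp: boundary2_def fun_eq_iff distrib_left sum.distrib sum_distrib_left mult_ac)

lemma laplacian_operator: "ell2_operator (arcs G) (arcs G) (opnorm * opnorm) (\<lambda>f. b2 (d1 f))"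
  by (rule ell2_operator_comp[OF coboundary1_operator boundary2_operator])

text \<open>The boundary operator is adjoint to \<open>d\<close>; \<open>h\<close> is arbitrary because only finitely many polygons meet
  the support of \<open>f\<close>.\<close>

lemma pairing_boundary2:
  assumes f: "finite {e. f e \<noteq> 0}"
  shows "pairing f (b2 h) = pairing (d1 f) h"
proof -
  let ?X = "{e. f e \<noteq> 0}"
  let ?Y = "\<Union>e\<in>?X. {c \<in> polygons G D. e \<in> c}"
  have Y: "finite ?Y" using f polygons_through(1) by auto
  have "pairing f (b2 h) = (\<Sum>e\<in>?X. f e * b2 h e)" by (rule pairing_eq_sum) (use f in auto)
  also have "\<dots> = (\<Sum>e\<in>?X. \<Sum>c\<in>{c\<in>?Y. e \<in> c}. f e * (incidence (\<omega> c) e * h c))"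
    unfolding boundary2_def sum_distrib_left by (intro sum.cong refl) auto
  also have "\<dots> = (\<Sum>c\<in>?Y. \<Sum>e\<in>{e\<in>?X. e \<in> c}. f e * (incidence (\<omega> c) e * h c))"
    by (rule sum.swap_restrict[OF f Y])
  also have "\<dots> = (\<Sum>c\<in>?Y. d1 f c * h c)"
  proof (rule sum.cong)
    fix c assume "c \<in> ?Y"
    then have c: "c \<in> polygons G D" by auto
    have "(\<Sum>e\<in>{e\<in>?X. e \<in> c}. f e * (incidence (\<omega> c) e * h c)) = (\<Sum>e\<in>c. f e * (incidence (\<omega> c) e * h c))"
      by (rule sum.mono_neutral_left) (use polygonD(2)[OF c] in auto)
    then show "(\<Sum>e\<in>{e\<in>?X. e \<in> c}. f e * (incidence (\<omega> c) e * h c)) = d1 f c * h c"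
      using c by (simp add: coboundary1_def sum_distrib_left mult_ac)
  qed simp
  also have "\<dots> = pairing (d1 f) h"
  proof (rule pairing_eq_sum[symmetric, OF Y])
    fix c assume "c \<notin> ?Y"
    then have "d1 f c = 0" by (auto simp: coboundary1_def intro!: sum.neutral)
    then show "d1 f c * h c = 0" by simp
  qed
  finally show ?thesis .
qed

lemma finite_support_coboundary1:
  assumes f: "finite {e. f e \<noteq> 0}"
  shows "finite {c. d1 f c \<noteq> 0}"
proof (rule finite_subset)
  show "{c. d1 f c \<noteq> 0} \<subseteq> (\<Union>e\<in>{e. f e \<noteq> 0}. {c \<in> polygons G D. e \<in> c})"
  proof
    fix c assume "c \<in> {c. d1 f c \<noteq> 0}"
    then have c: "c \<in> polygons G D" "(\<Sum>e\<in>c. incidence (\<omega> c) e * f e) \<noteq> 0"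
      by (auto simp: coboundary1_def split: if_splits)
    then obtain e where "e \<in> c" "f e \<noteq> 0" by (metis (no_types, lifting) mult_zero_right sum.neutral)
    then show "c \<in> (\<Union>e\<in>{e. f e \<noteq> 0}. {c \<in> polygons G D. e \<in> c})" using c by auto
  qed
  show "finite (\<Union>e\<in>{e. f e \<noteq> 0}. {c \<in> polygons G D. e \<in> c})" using f polygons_through(1) by auto
qed

text \<open>The boundary at \<open>v\<close> is tested against the coboundary of the indicator of \<open>v\<close>, whose sum along a walk
  telescopes. In this form it is easily computed for boundaries of polygons and for transported chains.\<close>

lemma boundary1_eq_pairing:
  assumes f: "finite {e. f e \<noteq> 0}" and out: "\<And>e. e \<notin> arcs G \<Longrightarrow> f e = 0"
  shows "boundary1 G f v = pairing f (coboundary0 G (\<lambda>x. of_bool (x = v)))"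
proof -
  let ?X = "{e. f e \<noteq> 0}"
  have *: "(\<Sum>e | e \<in> arcs G \<and> P e. f e) = (\<Sum>e\<in>?X. f e * of_bool (P e))" if "finite {e \<in> arcs G. P e}" for P
  proof -
    have "(\<Sum>e | e \<in> arcs G \<and> P e. f e) = (\<Sum>e\<in>{e\<in>?X. P e}. f e)"
      by (rule sum.mono_neutral_right) (use that out in auto)
    also have "\<dots> = (\<Sum>e\<in>?X. f e * of_bool (P e))"
      by (rule sum.mono_neutral_cong_left) (use f in auto)
    finally show ?thesis .
  qed
  have "pairing f (coboundary0 G (\<lambda>x. of_bool (x = v))) =
      (\<Sum>e\<in>?X. f e * coboundary0 G (\<lambda>x. of_bool (x = v)) e)"
    by (rule pairing_eq_sum) (use f in auto)
  also have "\<dots> = (\<Sum>e\<in>?X. f e * (of_bool (head G e = v) - of_bool (tail G e = v)))"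
    by (rule sum.cong) (use out in \<open>auto simp: coboundary0_def\<close>)
  finally show ?thesis
    by (simp add: boundary1_def * locally_finite right_diff_distrib sum_subtractf)
qed

text \<open>This contains \<open>\<partial>\<partial> = 0\<close>: the sum of a coboundary around each polygon telescopes to \<open>0\<close>.\<close>

lemma boundary2_finite_cycles:
  assumes h: "finite {c. h c \<noteq> 0}"
  shows "b2 h \<in> finite_cycles G"
proof -
  have out: "b2 h e = 0" if "e \<notin> arcs G" for e
    using that polygonD(1) by (auto simp: boundary2_def intro!: sum.neutral)
  have "{e. b2 h e \<noteq> 0} \<subseteq> (\<Union>c\<in>{c \<in> polygons G D. h c \<noteq> 0}. c)"
  proof
    fix e assume "e \<in> {e. b2 h e \<noteq> 0}"
    then have "(\<Sum>c | c \<in> polygons G D \<and> e \<in> c. incidence (\<omega> c) e * h c) \<noteq> 0" by (simp add: boundary2_def)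
    then obtain c where "c \<in> polygons G D" "e \<in> c" "h c \<noteq> 0"
      by (metis (no_types, lifting) mem_Collect_eq mult_zero_right sum.neutral)
    then show "e \<in> (\<Union>c\<in>{c \<in> polygons G D. h c \<noteq> 0}. c)" by auto
  qed
  then have fin: "finite {e. b2 h e \<noteq> 0}"
    by (rule finite_subset) (use h polygonD(2) in auto)
  have "boundary1 G (b2 h) v = 0" for v
  proof -
    let ?\<phi> = "coboundary0 G (\<lambda>x. of_bool (x = v))"
    let ?P = "{c \<in> polygons G D. h c \<noteq> 0}"
    let ?X = "\<Union>c\<in>?P. c"
    have X: "finite ?X" "finite ?P" using h polygonD(2) by auto
    have "boundary1 G (b2 h) v = pairing (b2 h) ?\<phi>" by (rule boundary1_eq_pairing[OF fin out])
    \<comment> \<open>Truncating \<open>?\<phi>\<close> to the edges of the polygons in the support of \<open>h\<close> makes adjointness applicable.\<close>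
    also have "\<dots> = pairing (\<lambda>e. of_bool (e \<in> ?X) * ?\<phi> e) (b2 h)"
      unfolding pairing_def using \<open>{e. b2 h e \<noteq> 0} \<subseteq> ?X\<close>
      by (intro sum.cong) (auto simp: mult_ac)
    also have "\<dots> = pairing (d1 (\<lambda>e. of_bool (e \<in> ?X) * ?\<phi> e)) h"
      by (rule pairing_boundary2) (rule finite_subset[OF _ X(1)], auto)
    also have "\<dots> = 0"
      unfolding pairing_def
    proof (rule sum.neutral, safe)
      fix c assume c: "d1 (\<lambda>e. of_bool (e \<in> ?X) * ?\<phi> e) c * h c \<noteq> 0"
      then have cP: "c \<in> polygons G D" "h c \<noteq> 0" by (auto simp: coboundary1_def split: if_splits)
      have "d1 (\<lambda>e. of_bool (e \<in> ?X) * ?\<phi> e) c = d1 ?\<phi> c"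
        unfolding coboundary1_def using cP by (auto intro!: sum.cong)
      also have "\<dots> = 0"
        unfolding coboundary1_eq_walk_sum[OF wf orientation cP(1)]
        using polygonD(7)[OF cP(1)] walk_sum_coboundary0[OF wf] by fastforce
      finally show "d1 (\<lambda>e. of_bool (e \<in> ?X) * ?\<phi> e) c * h c = 0" by simp
    qed
    finally show ?thesis .
  qed
  then show ?thesis using out fin by (simp add: finite_cycles_def)
qed

lemma laplacian_finite_cycles:
  assumes "f \<in> finite_cycles G"
  shows "b2 (d1 f) \<in> finite_cycles G"
  by (rule boundary2_finite_cycles[OF finite_support_coboundary1[OF finite_cyclesD(2)[OF assms]]])

lemma pairing_laplacian:
  assumes f: "f \<in> finite_cycles G"
  shows "pairing f (b2 (d1 f)) = (ell2_norm (polygons G D) (d1 f))\<^sup>2"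
  unfolding pairing_boundary2[OF finite_cyclesD(2)[OF f]]
  by (rule pairing_self[OF finite_support_coboundary1[OF finite_cyclesD(2)[OF f]]]) (simp add: coboundary1_def)

text \<open>The boundary at a vertex is a finite sum, hence continuous, and it vanishes on finite cycles. So the
  summand \<open>d\<partial>\<close> of the Laplacian drops out on the closure.\<close>

lemma boundary1_ell2_0c:
  assumes f: "f \<in> ell2_0c G" and v: "v \<in> verts G"
  shows "boundary1 G f v = 0"
proof -
  let ?I = "{e \<in> arcs G. head G e = v}" and ?O = "{e \<in> arcs G. tail G e = v}"
  let ?n = "real (card ?I + card ?O)"
  have f2: "f \<in> ell2 (arcs G)" using f ell2_closure_subset unfolding ell2_0c_eq by blast
  have "\<bar>boundary1 G f v\<bar> \<le> 0 + \<delta>" if "\<delta> > 0" for \<delta>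
  proof -
    have "0 < \<delta> / (?n + 1)" using that by simp
    then obtain g where g: "g \<in> finite_cycles G" "ell2_norm (arcs G) (\<lambda>i. f i - g i) < \<delta> / (?n + 1)"
      using ell2_closureE[OF f[unfolded ell2_0c_eq]] by blast
    have le: "\<bar>f e - g e\<bar> \<le> \<delta> / (?n + 1)" for e
      using abs_le_ell2_norm[OF ell2_diff[OF f2], of g e] g finite_cycles_ell2 by fastforce
    have "boundary1 G f v = boundary1 G (\<lambda>e. f e - g e) v"
      using finite_cyclesD(3)[OF g(1) v] by (simp add: boundary1_def sum_subtractf)
    also have "\<bar>\<dots>\<bar> \<le> \<bar>\<Sum>e\<in>?I. f e - g e\<bar> + \<bar>\<Sum>e\<in>?O. f e - g e\<bar>" by (simp add: boundary1_def)
    also have "\<dots> \<le> (\<Sum>e\<in>?I. \<delta> / (?n + 1)) + (\<Sum>e\<in>?O. \<delta> / (?n + 1))"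
      by (intro add_mono order_trans[OF sum_abs] sum_mono le)
    also have "\<dots> = ?n * (\<delta> / (?n + 1))"
      unfolding sum_constant of_nat_add by (rule distrib_right[symmetric])
    also have "\<dots> \<le> \<delta>" using that by (simp add: field_simps)
    finally show ?thesis by simp
  qed
  then show ?thesis using field_le_epsilon[of "\<bar>boundary1 G f v\<bar>" 0] by simp
qed

lemma laplacian1_ell2_0c:
  assumes "f \<in> ell2_0c G"
  shows "laplacian1 G D \<omega> f = b2 (d1 f)"
  using boundary1_ell2_0c[OF assms] wf
  by (auto simp: fun_eq_iff laplacian1_def coboundary0_def wf_digraph_def)

text \<open>Since \<open>0\<close> is not in the spectrum, \<open>\<partial>d y = z\<close> has a solution whose norm is bounded by that of \<open>z\<close>. That
  solution has infinite support in general; a nearby finite cycle solves the equation up to \<open>\<delta>\<close>. The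
  constant \<open>c\<close> is chosen before \<open>\<delta>\<close>, so the error can later be absorbed.\<close>

lemma gap_imp_approximate_solution:
  assumes gap: "coexact_spectral_gap G D \<omega>"
  obtains c where "0 \<le> c" "\<And>z \<delta>. z \<in> finite_cycles G \<Longrightarrow> 0 < \<delta> \<Longrightarrow> \<exists>y\<in>finite_cycles G.
    ell2_norm (arcs G) (\<lambda>e. z e - b2 (d1 y) e) \<le> \<delta> * ell2_norm (arcs G) z \<and>
    ell2_norm (polygons G D) (d1 y) \<le> c * ell2_norm (arcs G) z"
proof -
  let ?E = "arcs G" and ?H = "ell2_0c G" and ?C = "opnorm * opnorm"
  have "0 \<notin> spectrum_on ?E ?H (laplacian1 G D \<omega>)"
    using gap by (auto simp: coexact_spectral_gap_def)
  then obtain B where B: "bounded_operator_on ?E ?H B" "\<And>f. f \<in> ?H \<Longrightarrow> laplacian1 G D \<omega> (B f) = f"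
    by (auto simp: spectrum_on_def)
  have "\<exists>C. \<forall>f\<in>?H. ell2_norm ?E (B f) \<le> C * ell2_norm ?E f"
    using B(1) by (simp add: bounded_operator_on_def)
  then obtain b where "\<forall>f\<in>?H. ell2_norm ?E (B f) \<le> b * ell2_norm ?E f" ..
  then have b: "\<And>f. f \<in> ?H \<Longrightarrow> ell2_norm ?E (B f) \<le> b * ell2_norm ?E f" by simp
  have BH: "B f \<in> ?H" if "f \<in> ?H" for f using B(1) that by (auto simp: bounded_operator_on_def)
  have HE: "f \<in> ell2 ?E" if "f \<in> ?H" for f using that ell2_closure_subset unfolding ell2_0c_eq by blast
  have ZH: "f \<in> ?H" if "f \<in> finite_cycles G" for f
    using that ell2_closure_superset[OF finite_cycles_ell2] unfolding ell2_0c_eq by blast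
  have C: "0 \<le> ?C" by simp
  show thesis
  proof (rule that[of "opnorm * (\<bar>b\<bar> + 1)"])
    fix z and \<delta> :: real assume z: "z \<in> finite_cycles G" and \<delta>: "0 < \<delta>"
    let ?n = "ell2_norm ?E z"
    have "\<exists>y\<in>finite_cycles G. ell2_norm ?E (\<lambda>e. B z e - y e) \<le> min (\<delta> / (?C + 1)) 1 * ?n"
    proof (cases "?n = 0")
      case True
      then have "ell2_norm ?E (B z) \<le> 0" using b[OF ZH[OF z]] by simp
      then show ?thesis
        using True fun_subspaceD(1)[OF fun_subspace_finite_cycles] by (intro bexI[of _ "\<lambda>e. 0"]) auto
    next
      case False
      then have "0 < ?n" using ell2_norm_nonneg[of ?E z] by linarith
      then have "0 < min (\<delta> / (?C + 1)) 1 * ?n" using \<delta> C by (simp add: add_nonneg_pos)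
      from ell2_closureE[OF BH[OF ZH[OF z], unfolded ell2_0c_eq] this] obtain y
        where "y \<in> finite_cycles G" "ell2_norm ?E (\<lambda>e. B z e - y e) < min (\<delta> / (?C + 1)) 1 * ?n" .
      then show ?thesis by (intro bexI[of _ y]) simp_all
    qed
    then obtain y where y: "y \<in> finite_cycles G"
      "ell2_norm ?E (\<lambda>e. B z e - y e) \<le> min (\<delta> / (?C + 1)) 1 * ?n" by blast
    have y2: "y \<in> ell2 ?E" and Bz: "B z \<in> ell2 ?E" using y HE ZH BH z by auto
    have "b2 (d1 (B z)) = z"
      using laplacian1_ell2_0c[OF BH[OF ZH[OF z]]] B(2)[OF ZH[OF z]] by simp
    then have "ell2_norm ?E (\<lambda>e. z e - b2 (d1 y) e) = ell2_norm ?E (b2 (d1 (\<lambda>e. B z e - y e)))"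
      using ell2_operator_diff[OF laplacian_operator Bz y2] by simp
    also have "\<dots> \<le> ?C * ell2_norm ?E (\<lambda>e. B z e - y e)"
      by (rule ell2_operatorD(3)[OF laplacian_operator ell2_diff[OF Bz y2]])
    also have "\<dots> \<le> ?C * (\<delta> / (?C + 1) * ?n)"
      by (intro mult_left_mono C order_trans[OF y(2)] mult_right_mono) auto
    also have "\<dots> = ?C / (?C + 1) * (\<delta> * ?n)" by simp
    also have "\<dots> \<le> 1 * (\<delta> * ?n)"
      by (intro mult_right_mono) (use \<delta> C in \<open>auto simp: divide_le_eq add_nonneg_pos\<close>)
    finally have 1: "ell2_norm ?E (\<lambda>e. z e - b2 (d1 y) e) \<le> \<delta> * ?n" by simp
    have "ell2_norm ?E y \<le> ell2_norm ?E (B z) + ell2_norm ?E (\<lambda>e. y e - B z e)"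
      by (rule ell2_norm_le_diff[OF y2 Bz])
    also have "ell2_norm ?E (\<lambda>e. y e - B z e) \<le> 1 * ?n"
      unfolding ell2_norm_minus_commute[of ?E y] by (rule order_trans[OF y(2)], intro mult_right_mono) auto
    also have "ell2_norm ?E (B z) \<le> \<bar>b\<bar> * ?n"
      by (rule order_trans[OF b[OF ZH[OF z]]], intro mult_right_mono) auto
    finally have "ell2_norm ?E y \<le> (\<bar>b\<bar> + 1) * ?n" by (simp add: distrib_right)
    then have "ell2_norm (polygons G D) (d1 y) \<le> opnorm * ((\<bar>b\<bar> + 1) * ?n)"
      by (intro order_trans[OF ell2_operatorD(3)[OF coboundary1_operator y2]] mult_left_mono) auto
    then show "\<exists>y\<in>finite_cycles G. ell2_norm ?E (\<lambda>e. z e - b2 (d1 y) e) \<le> \<delta> * ?n \<and>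
      ell2_norm (polygons G D) (d1 y) \<le> opnorm * (\<bar>b\<bar> + 1) * ?n"
      using 1 y(1) by (auto simp: mult.assoc)
  qed simp
qed

text \<open>On finite cycles \<open>T = \<partial>d - \<mu>\<close> satisfies \<open>\<langle>T f, f\<rangle> = \<parallel>d f\<parallel>\<^sup>2 - \<mu> \<parallel>f\<parallel>\<^sup>2 \<ge> \<kappa> \<parallel>f\<parallel>\<^sup>2\<close> with \<open>\<kappa> = \<epsilon> - \<mu>\<close>. Expanding
  \<open>\<parallel>f - t T f\<parallel>\<^sup>2\<close> then shows that \<open>1 - t T\<close> contracts for small \<open>t\<close>.\<close>

lemma inequality_imp_gap:
  assumes c: "0 \<le> c" and ineq: "\<And>z. z \<in> finite_cycles G \<Longrightarrow>
    ell2_norm (arcs G) z \<le> c * ell2_norm (polygons G D) (d1 z)"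
  shows "coexact_spectral_gap G D \<omega>"
  unfolding coexact_spectral_gap_def
proof (intro exI conjI)
  let ?E = "arcs G" and ?C = "opnorm * opnorm"
  \<comment> \<open>The summand \<open>1\<close> guards against \<open>c = 0\<close>.\<close>
  define \<epsilon> where "\<epsilon> = 1 / (c + 1)\<^sup>2"
  show "0 < \<epsilon>" using c by (simp add: \<epsilon>_def)
  have "\<mu> \<notin> spectrum_on ?E (ell2_0c G) (laplacian1 G D \<omega>)" if \<mu>: "0 \<le> \<mu>" "\<mu> < \<epsilon>" for \<mu>
  proof -
    define \<kappa> where "\<kappa> = \<epsilon> - \<mu>"
    define T where "T = (\<lambda>f e. b2 (d1 f) e - \<mu> * f e)"
    \<comment> \<open>A bound for the norm of \<open>T\<close>, enlarged by \<open>\<kappa>\<close> so that \<open>\<kappa> \<le> M\<close> and the radicand in \<open>q\<close> is nonnegative.\<close>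
    define M where "M = ?C + \<bar>\<mu>\<bar> + \<kappa>"
    \<comment> \<open>This \<open>t\<close> minimises \<open>1 - 2 t \<kappa> + t\<^sup>2 M\<^sup>2\<close>, with minimum \<open>1 - \<kappa>\<^sup>2 / M\<^sup>2\<close>.\<close>
    define t where "t = \<kappa> / M\<^sup>2"
    have \<kappa>: "0 < \<kappa>" using \<mu> by (simp add: \<kappa>_def)
    have M: "\<kappa> \<le> M" "0 < M" using \<kappa> by (auto simp: M_def add_nonneg_pos)
    have T: "ell2_operator ?E ?E (?C + \<bar>\<mu>\<bar>) T"
      unfolding T_def by (rule ell2_operator_shift[OF laplacian_operator])
    have TZ: "T f \<in> finite_cycles G" if "f \<in> finite_cycles G" for f
      unfolding T_def using that
      by (intro fun_subspace_diff fun_subspaceD(3) fun_subspace_finite_cycles laplacian_finite_cycles)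
    define q where "q = sqrt (1 - \<kappa>\<^sup>2 / M\<^sup>2)"
    have kM: "0 < \<kappa>\<^sup>2 / M\<^sup>2" "\<kappa>\<^sup>2 / M\<^sup>2 \<le> 1"
      using \<kappa> M by (auto simp: divide_le_eq power_mono)
    have q: "0 \<le> q" "q < 1" using kM by (auto simp: q_def)
    have contr: "ell2_norm ?E (\<lambda>i. f i - t * T f i) \<le> q * ell2_norm ?E f" if f: "f \<in> finite_cycles G" for f
    proof -
      let ?n = "ell2_norm ?E f"
      have f2: "f \<in> ell2 ?E" using f finite_cycles_ell2 by blast
      have ff: "finite {e. f e \<noteq> 0}" by (rule finite_cyclesD(2)[OF f])
      have "?n \<le> (c + 1) * ell2_norm (polygons G D) (d1 f)"
        using ineq[OF f] ell2_norm_nonneg[of "polygons G D" "d1 f"] unfolding distrib_right by linarith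
      then have "?n\<^sup>2 \<le> ((c + 1) * ell2_norm (polygons G D) (d1 f))\<^sup>2"
        by (rule power_mono) simp
      then have low: "\<epsilon> * ?n\<^sup>2 \<le> (ell2_norm (polygons G D) (d1 f))\<^sup>2"
        using c by (simp add: \<epsilon>_def power_mult_distrib divide_le_eq mult.commute)
      have "pairing f (T f) = pairing (b2 (d1 f)) f - pairing (\<lambda>e. \<mu> * f e) f"
        unfolding T_def pairing_commute[of f "\<lambda>e. b2 (d1 f) e - \<mu> * f e"]
        by (rule pairing_diff_left)
          (use finite_cyclesD(2)[OF laplacian_finite_cycles[OF f]] in \<open>auto intro: finite_subset[OF _ ff]\<close>)
      also have "pairing (\<lambda>e. \<mu> * f e) f = \<mu> * ?n\<^sup>2"
      proof -
        have "pairing (\<lambda>e. \<mu> * f e) f = (\<Sum>e | f e \<noteq> 0. \<mu> * f e * f e)" by (rule pairing_eq_sum) (use ff in auto)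
        also have "\<dots> = \<mu> * (\<Sum>e | f e \<noteq> 0. (f e)\<^sup>2)"
          by (simp add: sum_distrib_left power2_eq_square mult.assoc)
        also have "(\<Sum>e | f e \<noteq> 0. (f e)\<^sup>2) = ?n\<^sup>2"
          by (rule ell2_finite_support(2)[symmetric, OF ff]) (use finite_cyclesD(1)[OF f] in auto)
        finally show ?thesis .
      qed
      finally have "\<kappa> * ?n\<^sup>2 \<le> pairing f (T f)"
        using low pairing_laplacian[OF f]
        by (simp add: pairing_commute[of f "b2 (d1 f)"] \<kappa>_def left_diff_distrib)
      then have 1: "t * (\<kappa> * ?n\<^sup>2) \<le> t * pairing f (T f)"
        using \<kappa> by (intro mult_left_mono) (auto simp: t_def)
      have "ell2_norm ?E (T f) \<le> M * ?n"
        by (rule order_trans[OF ell2_operatorD(3)[OF T f2]], intro mult_right_mono) (use \<kappa> in \<open>auto simp: M_def\<close>)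
      then have "(ell2_norm ?E (T f))\<^sup>2 \<le> (M * ?n)\<^sup>2" by (rule power_mono) simp
      then have 2: "t\<^sup>2 * (ell2_norm ?E (T f))\<^sup>2 \<le> t\<^sup>2 * (M * ?n)\<^sup>2" by (rule mult_left_mono) simp
      have "(ell2_norm ?E (\<lambda>i. f i - t * T f i))\<^sup>2 = ?n\<^sup>2 - 2 * t * pairing f (T f) + t\<^sup>2 * (ell2_norm ?E (T f))\<^sup>2"
        by (rule ell2_norm_sq_diff_scaled[OF ff finite_cyclesD(2)[OF TZ[OF f]] f2])
          (use TZ[OF f] finite_cycles_ell2 in blast)
      also have "\<dots> \<le> ?n\<^sup>2 - 2 * (t * (\<kappa> * ?n\<^sup>2)) + t\<^sup>2 * (M * ?n)\<^sup>2" using 1 2 by linarith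
      also have "\<dots> = (1 - \<kappa>\<^sup>2 / M\<^sup>2) * ?n\<^sup>2"
        using M by (simp add: t_def field_simps power2_eq_square)
      also have "\<dots> = (q * ?n)\<^sup>2" using kM by (simp add: q_def power_mult_distrib)
      finally show ?thesis by (rule power2_le_imp_le) (use q in simp)
    qed
    obtain B where B: "bounded_operator_on ?E (ell2_0c G) B"
      "\<And>f. f \<in> ell2_0c G \<Longrightarrow> B (T f) = f" "\<And>f. f \<in> ell2_0c G \<Longrightarrow> T (B f) = f"
      using inverse_of_contraction[OF fun_subspace_finite_cycles finite_cycles_ell2 T TZ _ q contr] \<kappa> M
      unfolding ell2_0c_eq by (auto simp: t_def)
    have BH: "B f \<in> ell2_0c G" if "f \<in> ell2_0c G" for f
      using B(1) that by (simp add: bounded_operator_on_def)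
    have "(\<lambda>i. laplacian1 G D \<omega> f i - \<mu> * f i) = T f" if "f \<in> ell2_0c G" for f
      using laplacian1_ell2_0c[OF that] by (simp add: T_def)
    then show ?thesis unfolding spectrum_on_def using B BH by auto
  qed
  then show "spectrum_on ?E (ell2_0c G) (laplacian1 G D \<omega>) \<inter> {0..<\<epsilon>} = {}" by auto
qed

end


section \<open>Transferring the spectral gap along chain maps\<close>

text \<open>The column condition of the Schur test for sums along the walks \<open>F x\<close>.\<close>

definition thin_family :: "'x set \<Rightarrow> ('x \<Rightarrow> ('e \<times> bool) list) \<Rightarrow> nat \<Rightarrow> bool" where
  "thin_family X F n \<longleftrightarrow>
     (\<forall>e. finite {x\<in>X. e \<in> fst ` set (F x)} \<and> card {x\<in>X. e \<in> fst ` set (F x)} \<le> n)"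

lemma thin_familyD:
  assumes "thin_family X F n"
  shows "finite {x\<in>X. e \<in> fst ` set (F x)}" "card {x\<in>X. e \<in> fst ` set (F x)} \<le> n"
  using assms by (auto simp: thin_family_def)

lemma thin_family_subst_word:
  assumes F: "thin_family X F n" and H: "thin_family Y H k"
    and FY: "\<And>x. x \<in> X \<Longrightarrow> fst ` set (F x) \<subseteq> Y"
  shows "thin_family X (\<lambda>x. subst_word H (F x)) (k * n)"
  unfolding thin_family_def
proof (intro allI)
  fix e
  let ?Y = "{y\<in>Y. e \<in> fst ` set (H y)}"
  have eq: "{x\<in>X. e \<in> fst ` set (subst_word H (F x))} = (\<Union>y\<in>?Y. {x\<in>X. y \<in> fst ` set (F x)})"
    unfolding edges_subst_word using FY by blast
  have "card (\<Union>y\<in>?Y. {x\<in>X. y \<in> fst ` set (F x)}) \<le> (\<Sum>y\<in>?Y. card {x\<in>X. y \<in> fst ` set (F x)})"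
    by (rule card_UN_le[OF thin_familyD(1)[OF H]])
  also have "\<dots> \<le> (\<Sum>y\<in>?Y. n)" by (rule sum_mono) (rule thin_familyD(2)[OF F])
  also have "\<dots> \<le> k * n" using thin_familyD(2)[OF H] by simp
  finally show "finite {x\<in>X. e \<in> fst ` set (subst_word H (F x))} \<and>
    card {x\<in>X. e \<in> fst ` set (subst_word H (F x))} \<le> k * n"
    unfolding eq using thin_familyD(1)[OF F] thin_familyD(1)[OF H] by auto
qed

lemma
  assumes F: "thin_family X F n" and L: "\<And>x. x \<in> X \<Longrightarrow> length (F x) \<le> L"
    and FE: "\<And>x. x \<in> X \<Longrightarrow> fst ` set (F x) \<subseteq> E" and f: "f \<in> ell2 E"
  defines "k \<equiv> \<lambda>x. if x \<in> X then walk_sum f (F x) else 0"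
  shows walk_sums_ell2: "k \<in> ell2 X"
    and walk_sums_norm_le: "ell2_norm X k \<le> real L * sqrt (real (L * n)) * ell2_norm E f"
proof -
  have out: "k x = 0" if "x \<notin> X" for x using that by (simp add: k_def)
  have dom: "\<bar>k x\<bar> \<le> real L * (\<Sum>e\<in>fst ` set (F x). \<bar>f e\<bar>)" if "x \<in> X" for x
  proof -
    have "\<bar>k x\<bar> \<le> real (length (F x)) * (\<Sum>e\<in>fst ` set (F x). \<bar>f e\<bar>)"
      using that abs_walk_sum_le[of f "F x"] by (simp add: k_def)
    also have "\<dots> \<le> real L * (\<Sum>e\<in>fst ` set (F x). \<bar>f e\<bar>)"
      using L[OF that] by (intro mult_right_mono) (auto simp: sum_nonneg)
    finally show ?thesis .
  qed
  have card: "card (fst ` set (F x)) \<le> L" if "x \<in> X" for x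
    using card_length[of "map fst (F x)"] L[OF that] by simp
  show "k \<in> ell2 X"
    by (rule schur_ell2[OF f out dom, where n = L and m = n]) (use FE card thin_familyD[OF F] in auto)
  show "ell2_norm X k \<le> real L * sqrt (real (L * n)) * ell2_norm E f"
    by (rule schur_norm_le[OF f out dom]) (use FE card thin_familyD[OF F] in auto)
qed

text \<open>Each sum around a closed walk is dominated by \<open>d f\<close> on the polygons inside the walk. There are at
  most \<open>2 ^ L\<close> of them, since they are sets of edges of the walk; and a polygon lies only inside walks
  that pass through one chosen edge of it.\<close>

lemma (in polygon_complex)
  assumes F: "thin_family X F n" and L: "\<And>x. x \<in> X \<Longrightarrow> length (F x) \<le> L" "L \<le> D"
    and closed: "\<And>x. x \<in> X \<Longrightarrow> \<exists>u. walk G u (F x) u" and f: "f \<in> ell2 (arcs G)"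
  defines "k \<equiv> \<lambda>x. if x \<in> X then walk_sum f (F x) else 0"
  shows closed_walk_sums_ell2: "k \<in> ell2 X"
    and closed_walk_sums_norm_le:
      "ell2_norm X k \<le> real L * sqrt (real (2 ^ L * n)) * ell2_norm (polygons G D) (d1 f)"
proof -
  define N where "N x = {c \<in> polygons G D. c \<subseteq> fst ` set (F x)}" for x
  have out: "k x = 0" if "x \<notin> X" for x using that by (simp add: k_def)
  have df: "d1 f \<in> ell2 (polygons G D)" by (rule ell2_operatorD(2)[OF coboundary1_operator f])
  have dom: "\<bar>k x\<bar> \<le> real L * (\<Sum>c\<in>N x. \<bar>d1 f c\<bar>)" if x: "x \<in> X" for x
  proof -
    obtain u where u: "walk G u (F x) u" using closed[OF x] by auto
    have "\<bar>k x\<bar> \<le> real (length (F x)) * (\<Sum>c\<in>N x. \<bar>d1 f c\<bar>)"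
      using closed_walk_sum_le[OF wf orientation u, of f] L(1)[OF x] L(2) x by (simp add: k_def N_def)
    also have "\<dots> \<le> real L * (\<Sum>c\<in>N x. \<bar>d1 f c\<bar>)"
      using L(1)[OF x] by (intro mult_right_mono) (auto simp: sum_nonneg)
    finally show ?thesis .
  qed
  have N: "N x \<subseteq> polygons G D" "finite (N x)" "card (N x) \<le> 2 ^ L" if "x \<in> X" for x
  proof -
    have "card (fst ` set (F x)) \<le> L"
      using card_length[of "map fst (F x)"] L(1)[OF that] by simp
    then have "card (Pow (fst ` set (F x))) \<le> 2 ^ L" by (simp add: card_Pow)
    moreover have "card (N x) \<le> card (Pow (fst ` set (F x)))" by (rule card_mono) (auto simp: N_def)
    ultimately show "card (N x) \<le> 2 ^ L" by simp
  qed (auto simp: N_def finite_polygons_subset[OF wf])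
  have col: "finite {x\<in>X. c \<in> N x} \<and> card {x\<in>X. c \<in> N x} \<le> n" for c
  proof (cases "c \<in> polygons G D")
    case True
    then have "\<omega> c \<noteq> []" using polygonD(4) by (simp add: cycle_walk_def)
    then have "c \<noteq> {}" using polygonD(5)[OF True] by force
    then obtain e where "e \<in> c" by blast
    then have sub: "{x\<in>X. c \<in> N x} \<subseteq> {x\<in>X. e \<in> fst ` set (F x)}" by (auto simp: N_def)
    show ?thesis
      using card_mono[OF thin_familyD(1)[OF F] sub] thin_familyD(2)[OF F, of e]
        finite_subset[OF sub thin_familyD(1)[OF F]] by simp
  qed (auto simp: N_def)
  show "k \<in> ell2 X"
    by (rule schur_ell2[OF df out dom, where n = "2 ^ L" and m = n]) (use N col in auto)
  show "ell2_norm X k \<le> real L * sqrt (real (2 ^ L * n)) * ell2_norm (polygons G D) (d1 f)"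
    by (rule schur_norm_le[OF df out dom]) (use N col in auto)
qed

text \<open>The image of the chain \<open>z\<close> under the linear map that sends \<open>x\<close> to the chain of the walk \<open>F x\<close>; the
  inner \<^const>\<open>walk_sum\<close> counts the signed passages through \<open>e\<close>.\<close>

definition push_chain :: "('x \<Rightarrow> ('e \<times> bool) list) \<Rightarrow> ('x \<Rightarrow> real) \<Rightarrow> 'e \<Rightarrow> real" where
  "push_chain F z e = (\<Sum>x | z x \<noteq> 0. z x * walk_sum (\<lambda>e'. of_bool (e' = e)) (F x))"

lemma push_chain_outside:
  assumes "\<And>x. z x \<noteq> 0 \<Longrightarrow> e \<notin> fst ` set (F x)"
  shows "push_chain F z e = 0"
  unfolding push_chain_def
proof (rule sum.neutral, rule ballI)
  fix x assume "x \<in> {x. z x \<noteq> 0}"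
  then have "walk_sum (\<lambda>e'. of_bool (e' = e)) (F x) = walk_sum (\<lambda>_. 0) (F x)"
    using assms[of x] by (intro walk_sum_cong) auto
  moreover have "walk_sum (\<lambda>_. 0) p = 0" for p :: "('b \<times> bool) list" by (induction p) auto
  ultimately show "z x * walk_sum (\<lambda>e'. of_bool (e' = e)) (F x) = 0" by simp
qed

lemma finite_support_push_chain:
  assumes "finite {x. z x \<noteq> 0}"
  shows "finite {e. push_chain F z e \<noteq> 0}"
proof (rule finite_subset)
  show "{e. push_chain F z e \<noteq> 0} \<subseteq> (\<Union>x\<in>{x. z x \<noteq> 0}. fst ` set (F x))"
    using push_chain_outside[of z _ F] by blast
qed (use assms in auto)

text \<open>Transport of chains is adjoint to taking sums along the walks \<open>F x\<close>; both properties of transported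
  cycles below are read off from this.\<close>

lemma pairing_push_chain:
  assumes z: "finite {x. z x \<noteq> 0}"
  shows "pairing (push_chain F z) f = pairing z (\<lambda>x. walk_sum f (F x))"
proof -
  let ?S = "{x. z x \<noteq> 0}"
  let ?X = "\<Union>x\<in>?S. fst ` set (F x)"
  have X: "finite ?X" using z by auto
  have "pairing (push_chain F z) f = (\<Sum>e\<in>?X. push_chain F z e * f e)"
    by (rule pairing_eq_sum[OF X]) (use push_chain_outside[of z _ F] in fastforce)
  also have "\<dots> = (\<Sum>e\<in>?X. \<Sum>x\<in>?S. z x * (f e * walk_sum (\<lambda>e'. of_bool (e' = e)) (F x)))"
    by (simp add: push_chain_def sum_distrib_left sum_distrib_right mult_ac)
  also have "\<dots> = (\<Sum>x\<in>?S. z x * (\<Sum>e\<in>?X. f e * walk_sum (\<lambda>e'. of_bool (e' = e)) (F x)))"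
    by (subst sum.swap) (simp add: sum_distrib_left)
  also have "\<dots> = (\<Sum>x\<in>?S. z x * walk_sum f (F x))"
  proof (rule sum.cong)
    fix x assume "x \<in> ?S"
    then have "fst ` set (F x) \<subseteq> ?X" by blast
    from walk_sum_expand[OF X this, of f]
    show "z x * (\<Sum>e\<in>?X. f e * walk_sum (\<lambda>e'. of_bool (e' = e)) (F x)) = z x * walk_sum f (F x)" by simp
  qed simp
  also have "\<dots> = pairing z (\<lambda>x. walk_sum f (F x))"
    by (rule pairing_eq_sum[symmetric]) (use z in auto)
  finally show ?thesis .
qed

text \<open>The bounds on \<open>D2\<close> make room for the two kinds of closed walks that have to be filled in \<open>G2\<close>: the
  images under \<open>\<psi>\<close> of polygons of \<open>G1\<close>, and an edge followed by the reverse of its image under \<open>\<psi>\<phi>\<close>.\<close>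

locale complex_pair = G1: polygon_complex G1 D1 \<omega>1 m1 + G2: polygon_complex G2 D2 \<omega>2 m2
  for G1 :: "('v, 'e) pre_digraph" and D1 \<omega>1 m1 and G2 :: "('v, 'f) pre_digraph" and D2 \<omega>2 m2 +
  fixes \<phi> :: "'f \<Rightarrow> ('e \<times> bool) list" and \<psi> :: "'e \<Rightarrow> ('f \<times> bool) list" and K n :: nat
  assumes verts: "verts G1 = verts G2"
    and \<phi>_walk: "e \<in> arcs G2 \<Longrightarrow> walk G1 (tail G2 e) (\<phi> e) (head G2 e)"
    and \<psi>_walk: "e' \<in> arcs G1 \<Longrightarrow> walk G2 (tail G1 e') (\<psi> e') (head G1 e')"
    and \<phi>_length: "e \<in> arcs G2 \<Longrightarrow> length (\<phi> e) \<le> K"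
    and \<psi>_length: "e' \<in> arcs G1 \<Longrightarrow> length (\<psi> e') \<le> K"
    and \<phi>_thin: "thin_family (arcs G2) \<phi> n" and \<psi>_thin: "thin_family (arcs G1) \<psi> n"
    and D2: "K * D1 \<le> D2" "1 + K * K \<le> D2"
begin

lemma \<phi>_arcs: "e \<in> arcs G2 \<Longrightarrow> fst ` set (\<phi> e) \<subseteq> arcs G1"
  using walk_arcs[OF G1.wf \<phi>_walk] .

lemma \<psi>_arcs: "e \<in> arcs G1 \<Longrightarrow> fst ` set (\<psi> e) \<subseteq> arcs G2"
  using walk_arcs[OF G2.wf \<psi>_walk] .

text \<open>The walk \<open>\<phi> e\<close> has the same endpoints as \<open>e\<close>, so the sum of a coboundary along it is the value of that
  coboundary at \<open>e\<close>; hence transport preserves boundaries.\<close>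

lemma push_chain_finite_cycles:
  assumes z: "z \<in> finite_cycles G2"
  shows "push_chain \<phi> z \<in> finite_cycles G1"
proof -
  have fin: "finite {e. push_chain \<phi> z e \<noteq> 0}" by (rule finite_support_push_chain[OF finite_cyclesD(2)[OF z]])
  have out: "push_chain \<phi> z e = 0" if "e \<notin> arcs G1" for e
    using that \<phi>_arcs finite_cyclesD(1)[OF z] by (intro push_chain_outside) blast
  have "boundary1 G1 (push_chain \<phi> z) v = 0" if v: "v \<in> verts G1" for v
  proof -
    let ?\<delta> = "\<lambda>x. of_bool (x = v)"
    have "boundary1 G1 (push_chain \<phi> z) v = pairing z (\<lambda>e. walk_sum (coboundary0 G1 ?\<delta>) (\<phi> e))"
      using G1.boundary1_eq_pairing[OF fin out, of v] pairing_push_chain[OF finite_cyclesD(2)[OF z]] by simp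
    also have "\<dots> = pairing z (coboundary0 G2 ?\<delta>)"
    proof -
      have *: "z e * walk_sum (coboundary0 G1 ?\<delta>) (\<phi> e) = z e * coboundary0 G2 ?\<delta> e" for e
        using walk_sum_coboundary0[OF G1.wf \<phi>_walk, of e ?\<delta>] finite_cyclesD(1)[OF z]
        by (cases "e \<in> arcs G2") (auto simp: coboundary0_def)
      show ?thesis unfolding pairing_def * ..
    qed
    also have "\<dots> = boundary1 G2 z v"
      by (rule G2.boundary1_eq_pairing[symmetric, OF finite_cyclesD(2)[OF z] finite_cyclesD(1)[OF z]])
    also have "\<dots> = 0" using finite_cyclesD(3)[OF z] v verts by simp
    finally show ?thesis .
  qed
  then show ?thesis using fin out by (simp add: finite_cycles_def)
qed

abbreviation "mapnorm \<equiv> real K * sqrt (real (K * n))"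

text \<open>An operator and its adjoint have the same norm: pair the transported chain \<open>y\<close> with itself to get
  \<open>\<parallel>y\<parallel>\<^sup>2 \<le> mapnorm \<parallel>z\<parallel> \<parallel>y\<parallel>\<close>.\<close>

lemma push_chain_norm_le:
  assumes z: "z \<in> finite_cycles G2"
  shows "ell2_norm (arcs G1) (push_chain \<phi> z) \<le> mapnorm * ell2_norm (arcs G2) z"
proof -
  let ?y = "push_chain \<phi> z"
  let ?k = "\<lambda>e. if e \<in> arcs G2 then walk_sum ?y (\<phi> e) else 0"
  have y: "?y \<in> finite_cycles G1" by (rule push_chain_finite_cycles[OF z])
  have y2: "?y \<in> ell2 (arcs G1)" and z2: "z \<in> ell2 (arcs G2)" using y z finite_cycles_ell2 by blast+
  have k: "?k \<in> ell2 (arcs G2)" "ell2_norm (arcs G2) ?k \<le> mapnorm * ell2_norm (arcs G1) ?y"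
    using walk_sums_ell2[OF \<phi>_thin \<phi>_length \<phi>_arcs y2] walk_sums_norm_le[OF \<phi>_thin \<phi>_length \<phi>_arcs y2] by auto
  have "(ell2_norm (arcs G1) ?y)\<^sup>2 = pairing ?y ?y"
    by (rule pairing_self[symmetric]) (use finite_cyclesD[OF y] in auto)
  also have "\<dots> = pairing z (\<lambda>e. walk_sum ?y (\<phi> e))" by (rule pairing_push_chain[OF finite_cyclesD(2)[OF z]])
  also have "\<dots> = pairing z ?k"
  proof -
    have *: "z e * walk_sum ?y (\<phi> e) = z e * ?k e" for e using finite_cyclesD(1)[OF z] by auto
    show ?thesis unfolding pairing_def * ..
  qed
  also have "\<dots> \<le> ell2_norm (arcs G2) z * ell2_norm (arcs G2) ?k"
    using pairing_le_ell2_norm[OF finite_cyclesD(2)[OF z] z2 k(1)] by linarith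
  also have "\<dots> \<le> ell2_norm (arcs G2) z * (mapnorm * ell2_norm (arcs G1) ?y)"
    by (rule mult_left_mono[OF k(2)]) simp
  finally have "ell2_norm (arcs G1) ?y * ell2_norm (arcs G1) ?y \<le>
      mapnorm * ell2_norm (arcs G2) z * ell2_norm (arcs G1) ?y"
    by (simp add: power2_eq_square mult_ac)
  then show ?thesis
    using ell2_norm_nonneg[of "arcs G1" ?y]
    by (cases "ell2_norm (arcs G1) ?y = 0") (auto simp: mult_le_cancel_right)
qed

text \<open>Here \<open>\<theta> e\<close> is the closed walk \<open>e (\<psi>\<phi>e)\<inverse>\<close> and \<open>\<xi> c\<close> is the image of the boundary of the polygon \<open>c\<close>, while
  \<open>g\<close> is the pullback \<open>\<psi>\<^sup>*z\<close>. With \<open>y0 = \<phi>z\<close> and an approximate solution \<open>y\<close> of \<open>\<partial>d y = y0\<close>,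
  \<open>\<parallel>z\<parallel>\<^sup>2 = \<langle>z, z \<circ> \<theta>\<rangle> + \<langle>y0 - \<partial>d y, \<psi>\<^sup>*z\<rangle> + \<langle>z \<circ> \<xi>, d y\<rangle>\<close>, where \<open>z\<close> is summed along walks. The outer
  summands are bounded by \<open>\<parallel>d z\<parallel> \<parallel>z\<parallel>\<close> up to a constant, the middle one is an error term.\<close>

theorem coexact_spectral_gap_transfer:
  assumes gap: "coexact_spectral_gap G1 D1 \<omega>1"
  shows "coexact_spectral_gap G2 D2 \<omega>2"
proof -
  obtain c where c: "0 \<le> c" "\<And>z \<delta>. z \<in> finite_cycles G1 \<Longrightarrow> 0 < \<delta> \<Longrightarrow> \<exists>y\<in>finite_cycles G1.
    ell2_norm (arcs G1) (\<lambda>e. z e - G1.b2 (G1.d1 y) e) \<le> \<delta> * ell2_norm (arcs G1) z \<and>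
    ell2_norm (polygons G1 D1) (G1.d1 y) \<le> c * ell2_norm (arcs G1) z"
    using G1.gap_imp_approximate_solution[OF gap] by blast
  define \<theta> where "\<theta> = (\<lambda>e. (e, True) # rev_word (subst_word \<psi> (\<phi> e)))"
  define \<xi> where "\<xi> = (\<lambda>c. subst_word \<psi> (\<omega>1 c))"
  define L3 L4 where "L3 = 1 + K * K" and "L4 = K * D1"
  have \<theta>_thin: "thin_family (arcs G2) \<theta> (1 + n * n)"
    unfolding thin_family_def
  proof (intro allI)
    fix e
    let ?A = "{x\<in>arcs G2. e \<in> fst ` set (subst_word \<psi> (\<phi> x))}"
    have A: "finite ?A" "card ?A \<le> n * n"
      using thin_familyD[OF thin_family_subst_word[OF \<phi>_thin \<psi>_thin \<phi>_arcs]] by auto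
    have sub: "{x\<in>arcs G2. e \<in> fst ` set (\<theta> x)} \<subseteq> insert e ?A"
      unfolding \<theta>_def list.set image_insert rev_word_simps(4) by auto
    have "card {x\<in>arcs G2. e \<in> fst ` set (\<theta> x)} \<le> card (insert e ?A)"
      by (rule card_mono[OF _ sub]) (use A in auto)
    also have "\<dots> \<le> 1 + n * n" using A card_insert_le_m1[of "1 + n * n" ?A e] by simp
    finally show "finite {x\<in>arcs G2. e \<in> fst ` set (\<theta> x)} \<and> card {x\<in>arcs G2. e \<in> fst ` set (\<theta> x)} \<le> 1 + n * n"
      using finite_subset[OF sub] A by auto
  qed
  have \<theta>_length: "length (\<theta> e) \<le> L3" if e: "e \<in> arcs G2" for e
  proof -
    have "length (subst_word \<psi> (\<phi> e)) \<le> K * length (\<phi> e)"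
      by (rule length_subst_word_le) (use \<phi>_arcs[OF e] \<psi>_length in auto)
    also have "\<dots> \<le> K * K" using \<phi>_length[OF e] by simp
    finally show ?thesis by (simp add: \<theta>_def L3_def)
  qed
  have \<theta>_closed: "\<exists>u. walk G2 u (\<theta> e) u" if e: "e \<in> arcs G2" for e
  proof -
    have "walk G2 (tail G2 e) (subst_word \<psi> (\<phi> e)) (head G2 e)"
      by (rule walk_subst_word[OF G2.wf \<psi>_walk _ \<phi>_walk[OF e]]) (use verts in auto)
    from walk_rev_word[OF G2.wf this] show ?thesis
      using e by (auto simp: \<theta>_def step_src_def step_dst_def)
  qed
  have \<omega>_thin: "thin_family (polygons G1 D1) \<omega>1 m1"
  proof -
    have "{x\<in>polygons G1 D1. e \<in> fst ` set (\<omega>1 x)} = {x\<in>polygons G1 D1. e \<in> x}" for e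
      using G1.polygonD(5) by blast
    then show ?thesis using G1.polygons_through by (simp add: thin_family_def)
  qed
  have \<omega>_arcs: "fst ` set (\<omega>1 c) \<subseteq> arcs G1" if "c \<in> polygons G1 D1" for c
    using G1.polygonD(1,5)[OF that] by simp
  have \<xi>_thin: "thin_family (polygons G1 D1) \<xi> (n * m1)"
    unfolding \<xi>_def by (rule thin_family_subst_word[OF \<omega>_thin \<psi>_thin \<omega>_arcs])
  have \<xi>_length: "length (\<xi> c) \<le> L4" if c: "c \<in> polygons G1 D1" for c
  proof -
    have "length (subst_word \<psi> (\<omega>1 c)) \<le> K * length (\<omega>1 c)"
      by (rule length_subst_word_le) (use \<omega>_arcs[OF c] \<psi>_length in auto)
    also have "\<dots> \<le> K * D1" using G1.polygonD(6)[OF c] by simp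
    finally show ?thesis by (simp add: \<xi>_def L4_def)
  qed
  have \<xi>_closed: "\<exists>u. walk G2 u (\<xi> c) u" if c: "c \<in> polygons G1 D1" for c
    unfolding \<xi>_def using G1.polygonD(7)[OF c] walk_subst_word[OF G2.wf \<psi>_walk] verts by blast
  define C3 C4 where "C3 = real L3 * sqrt (real (2 ^ L3 * (1 + n * n)))"
    and "C4 = real L4 * sqrt (real (2 ^ L4 * (n * m1)))"
  have C: "0 \<le> C3" "0 \<le> C4" "0 \<le> mapnorm" by (auto simp: C3_def C4_def)
  \<comment> \<open>Small enough for the error term to be at most half of \<open>\<parallel>z\<parallel>\<^sup>2\<close>.\<close>
  define \<delta> where "\<delta> = 1 / (2 * (mapnorm * mapnorm + 1))"
  have \<delta>: "0 < \<delta>" "\<delta> * (mapnorm * mapnorm) \<le> 1 / 2"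
  proof -
    have "0 < 1 / (2 * (P + 1)) \<and> 1 / (2 * (P + 1)) * P \<le> 1 / 2" if "0 \<le> P" for P :: real
      using that by (simp add: field_simps)
    from this[OF zero_le_square[of mapnorm]]
    show "0 < \<delta>" "\<delta> * (mapnorm * mapnorm) \<le> 1 / 2" unfolding \<delta>_def by blast+
  qed
  show ?thesis
  proof (rule G2.inequality_imp_gap)
    show "0 \<le> 2 * (C3 + C4 * c * mapnorm)" 
      by (intro mult_nonneg_nonneg add_nonneg_nonneg C c(1)) simp
    fix z assume z: "z \<in> finite_cycles G2"
    let ?n = "ell2_norm (arcs G2) z" and ?w = "ell2_norm (polygons G2 D2) (G2.d1 z)"
    have z2: "z \<in> ell2 (arcs G2)" using z finite_cycles_ell2 by blast
    have zf: "finite {e. z e \<noteq> 0}" by (rule finite_cyclesD(2)[OF z])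
    define g where "g = (\<lambda>e. if e \<in> arcs G1 then walk_sum z (\<psi> e) else 0)"
    have g: "g \<in> ell2 (arcs G1)" "ell2_norm (arcs G1) g \<le> mapnorm * ?n"
      using walk_sums_ell2[OF \<psi>_thin \<psi>_length \<psi>_arcs z2] walk_sums_norm_le[OF \<psi>_thin \<psi>_length \<psi>_arcs z2]
      by (auto simp: g_def)
    have gf: "finite {e. g e \<noteq> 0}"
    proof (rule finite_subset)
      show "{e. g e \<noteq> 0} \<subseteq> (\<Union>x\<in>{x. z x \<noteq> 0}. {e \<in> arcs G1. x \<in> fst ` set (\<psi> e)})"
      proof
        fix e assume "e \<in> {e. g e \<noteq> 0}"
        then have e: "e \<in> arcs G1" "walk_sum z (\<psi> e) \<noteq> 0" by (auto simp: g_def split: if_splits)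
        have "0 < real (length (\<psi> e)) * (\<Sum>x\<in>fst ` set (\<psi> e). \<bar>z x\<bar>)"
          using e(2) abs_walk_sum_le[of z "\<psi> e"] by linarith
        then have "(\<Sum>x\<in>fst ` set (\<psi> e). \<bar>z x\<bar>) \<noteq> 0" by auto
        then obtain x where "x \<in> fst ` set (\<psi> e)" "z x \<noteq> 0" by (metis abs_zero sum.neutral)
        then show "e \<in> (\<Union>x\<in>{x. z x \<noteq> 0}. {e \<in> arcs G1. x \<in> fst ` set (\<psi> e)})" using e(1) by blast
      qed
      show "finite (\<Union>x\<in>{x. z x \<noteq> 0}. {e \<in> arcs G1. x \<in> fst ` set (\<psi> e)})"
        using zf thin_familyD(1)[OF \<psi>_thin] by blast
    qed
    define k3 where "k3 = (\<lambda>e. if e \<in> arcs G2 then walk_sum z (\<theta> e) else 0)"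
    have k3: "k3 \<in> ell2 (arcs G2)" "ell2_norm (arcs G2) k3 \<le> C3 * ?w"
      using G2.closed_walk_sums_ell2[OF \<theta>_thin \<theta>_length _ \<theta>_closed z2]
        G2.closed_walk_sums_norm_le[OF \<theta>_thin \<theta>_length _ \<theta>_closed z2] D2(2)
      by (auto simp: k3_def C3_def L3_def)
    define k4 where "k4 = (\<lambda>c. if c \<in> polygons G1 D1 then walk_sum z (\<xi> c) else 0)"
    have k4: "k4 \<in> ell2 (polygons G1 D1)" "ell2_norm (polygons G1 D1) k4 \<le> C4 * ?w"
      using G2.closed_walk_sums_ell2[OF \<xi>_thin \<xi>_length _ \<xi>_closed z2]
        G2.closed_walk_sums_norm_le[OF \<xi>_thin \<xi>_length _ \<xi>_closed z2] D2(1)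
      by (auto simp: k4_def C4_def L4_def)
    have walk_sum_g: "walk_sum g p = walk_sum z (subst_word \<psi> p)" if "fst ` set p \<subseteq> arcs G1" for p
      unfolding walk_sum_subst_word by (rule walk_sum_cong) (use that in \<open>auto simp: g_def\<close>)
    have d1g: "G1.d1 g = k4"
    proof
      fix c show "G1.d1 g c = k4 c"
        using coboundary1_eq_walk_sum[OF G1.wf G1.orientation, of c g] walk_sum_g[OF \<omega>_arcs, of c]
        by (cases "c \<in> polygons G1 D1") (auto simp: k4_def \<xi>_def coboundary1_def)
    qed
    define y0 where "y0 = push_chain \<phi> z"
    have y0: "y0 \<in> finite_cycles G1" "ell2_norm (arcs G1) y0 \<le> mapnorm * ?n"
      using push_chain_finite_cycles[OF z] push_chain_norm_le[OF z] by (auto simp: y0_def)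
    obtain y where y: "y \<in> finite_cycles G1"
      "ell2_norm (arcs G1) (\<lambda>e. y0 e - G1.b2 (G1.d1 y) e) \<le> \<delta> * ell2_norm (arcs G1) y0"
      "ell2_norm (polygons G1 D1) (G1.d1 y) \<le> c * ell2_norm (arcs G1) y0"
      using c(2)[OF y0(1) \<delta>(1)] by blast
    let ?r = "\<lambda>e. y0 e - G1.b2 (G1.d1 y) e"
    have Ly: "G1.b2 (G1.d1 y) \<in> finite_cycles G1" by (rule G1.laplacian_finite_cycles[OF y(1)])
    have r: "?r \<in> finite_cycles G1" by (rule fun_subspace_diff[OF fun_subspace_finite_cycles y0(1) Ly])
    have dy: "G1.d1 y \<in> ell2 (polygons G1 D1)"
      using ell2_operatorD(2)[OF G1.coboundary1_operator] y(1) finite_cycles_ell2 by blast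
    have "?n\<^sup>2 = pairing z z"
      by (rule pairing_self[symmetric, OF zf]) (rule finite_cyclesD(1)[OF z])
    also have "\<dots> = pairing z k3 + pairing z (\<lambda>e. walk_sum g (\<phi> e))"
    proof -
      have *: "z e * z e = z e * k3 e + z e * walk_sum g (\<phi> e)" for e
      proof (cases "e \<in> arcs G2")
        case True
        then show ?thesis
          using walk_sum_g[OF \<phi>_arcs[OF True]] by (simp add: k3_def \<theta>_def right_diff_distrib)
      qed (use finite_cyclesD(1)[OF z] in simp)
      have "pairing z h = (\<Sum>e | z e \<noteq> 0. z e * h e)" for h by (rule pairing_eq_sum) (use zf in auto)
      then show ?thesis by (simp add: * sum.distrib)
    qed
    also have "pairing z (\<lambda>e. walk_sum g (\<phi> e)) = pairing y0 g"
      unfolding y0_def by (rule pairing_push_chain[OF zf, symmetric])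
    also have "\<dots> = pairing ?r g + pairing (G1.b2 (G1.d1 y)) g"
      using pairing_diff_left[OF finite_cyclesD(2)[OF y0(1)] finite_cyclesD(2)[OF Ly], of g] by simp
    also have "pairing (G1.b2 (G1.d1 y)) g = pairing k4 (G1.d1 y)"
      unfolding d1g[symmetric] by (subst pairing_commute) (rule G1.pairing_boundary2[OF gf])
    finally have main: "?n\<^sup>2 = pairing z k3 + (pairing ?r g + pairing k4 (G1.d1 y))" .
    have "pairing z k3 \<le> ?n * ell2_norm (arcs G2) k3"
      using pairing_le_ell2_norm[OF zf z2 k3(1)] by linarith
    also have "\<dots> \<le> ?n * (C3 * ?w)" by (rule mult_left_mono[OF k3(2)]) simp
    finally have 1: "pairing z k3 \<le> ?n * (C3 * ?w)" .
    have "pairing ?r g \<le> ell2_norm (arcs G1) ?r * ell2_norm (arcs G1) g"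
      using pairing_le_ell2_norm[OF finite_cyclesD(2)[OF r] _ g(1)] r finite_cycles_ell2 by (smt (verit) subsetD)
    also have "\<dots> \<le> (\<delta> * (mapnorm * ?n)) * (mapnorm * ?n)"
      by (intro mult_mono g(2) order_trans[OF y(2)] mult_left_mono y0(2)) (use \<delta> C in auto)
    also have "\<dots> = (\<delta> * (mapnorm * mapnorm)) * ?n\<^sup>2" by (simp add: power2_eq_square)
    also have "\<dots> \<le> 1 / 2 * ?n\<^sup>2" by (rule mult_right_mono[OF \<delta>(2)]) simp
    finally have 2: "pairing ?r g \<le> 1 / 2 * ?n\<^sup>2" .
    have k4f: "finite {c. k4 c \<noteq> 0}" unfolding d1g[symmetric] by (rule G1.finite_support_coboundary1[OF gf])
    have "pairing k4 (G1.d1 y) \<le> ell2_norm (polygons G1 D1) k4 * ell2_norm (polygons G1 D1) (G1.d1 y)"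
      using pairing_le_ell2_norm[OF k4f k4(1) dy] by linarith
    also have "\<dots> \<le> (C4 * ?w) * (c * (mapnorm * ?n))"
      by (intro mult_mono k4(2) order_trans[OF y(3)] mult_left_mono y0(2)) (use c C in auto)
    finally have 3: "pairing k4 (G1.d1 y) \<le> (C4 * ?w) * (c * (mapnorm * ?n))" .
    have "?n * ?n \<le> (2 * (C3 + C4 * c * mapnorm) * ?w) * ?n"
      using main 1 2 3 by (simp add: power2_eq_square algebra_simps)
    then show "?n \<le> 2 * (C3 + C4 * c * mapnorm) * ?w"
      using ell2_norm_nonneg[of "arcs G2" z] C c(1)
      by (cases "?n = 0") (auto simp: mult_le_cancel_right)
  qed
qed

end


section \<open>Presentations over an arbitrary finite generating set\<close>

lemma words_iff: "w \<in> words X \<longleftrightarrow> fst ` set w \<subseteq> X"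
  by (auto simp: words_def lists_eq_set)

lemma words_simps [simp]:
  "[] \<in> words X"
  "l # w \<in> words X \<longleftrightarrow> fst l \<in> X \<and> w \<in> words X"
  "u @ v \<in> words X \<longleftrightarrow> u \<in> words X \<and> v \<in> words X"
  "rev_word w \<in> words X \<longleftrightarrow> w \<in> words X"
  by (simp_all add: words_iff image_Un)

lemma words_subst_word:
  "(\<And>x. x \<in> X \<Longrightarrow> \<alpha> x \<in> words Y) \<Longrightarrow> w \<in> words X \<Longrightarrow> subst_word \<alpha> w \<in> words Y"
  by (induction w) auto

definition short_words :: "'x set \<Rightarrow> nat \<Rightarrow> ('x \<times> bool) list set" where
  "short_words X D = {w \<in> words X. length w \<le> D}"

lemma finite_short_words: "finite X \<Longrightarrow> finite (short_words X D)"
  using finite_lists_length_le[of "X \<times> (UNIV :: bool set)" D]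
  by (simp add: short_words_def words_def lists_eq_set)

context group
begin

lemma eval_word_closed:
  "\<phi> ` X \<subseteq> carrier G \<Longrightarrow> w \<in> words X \<Longrightarrow> eval_word G \<phi> w \<in> carrier G"
  by (induction w) auto

lemma eval_word_append:
  "\<phi> ` X \<subseteq> carrier G \<Longrightarrow> u \<in> words X \<Longrightarrow> v \<in> words X \<Longrightarrow>
    eval_word G \<phi> (u @ v) = eval_word G \<phi> u \<otimes> eval_word G \<phi> v"
proof (induction u)
  case (Cons l u)
  then have "\<phi> (fst l) \<in> carrier G" by auto
  then show ?case using Cons by (simp add: m_assoc eval_word_closed[where X = X])
qed (simp add: eval_word_closed[where X = X])

lemma eval_word_rev_word:
  "\<phi> ` X \<subseteq> carrier G \<Longrightarrow> w \<in> words X \<Longrightarrow> eval_word G \<phi> (rev_word w) = inv (eval_word G \<phi> w)"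
proof (induction w)
  case (Cons l w)
  then have "\<phi> (fst l) \<in> carrier G" by auto
  then show ?case
    using Cons by (auto simp: eval_word_append[where X = X] eval_word_closed[where X = X] inv_mult_group)
qed simp

lemma eval_word_subst_word:
  assumes \<psi>: "\<psi> ` Y \<subseteq> carrier G" and \<alpha>: "\<And>x. x \<in> X \<Longrightarrow> \<alpha> x \<in> words Y"
    "\<And>x. x \<in> X \<Longrightarrow> eval_word G \<psi> (\<alpha> x) = \<phi> x"
  shows "w \<in> words X \<Longrightarrow> eval_word G \<psi> (subst_word \<alpha> w) = eval_word G \<phi> w"
proof (induction w)
  case (Cons l w)
  then show ?case
    using \<alpha> words_subst_word[of X \<alpha> Y w]
    by (auto simp: eval_word_append[OF \<psi>] eval_word_rev_word[OF \<psi>] eval_word_closed[OF \<psi>])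
qed simp

lemma generate_word:
  assumes X: "\<phi> ` X \<subseteq> carrier G" and "g \<in> generate G (\<phi> ` X)"
  shows "\<exists>w\<in>words X. eval_word G \<phi> w = g"
  using assms(2)
proof (induction rule: generate.induct)
  case one
  show ?case by (rule bexI[of _ "[]"]) auto
next
  case (incl h)
  then obtain x where "x \<in> X" "h = \<phi> x" by auto
  then show ?case using X by (intro bexI[of _ "[(x, True)]"]) auto
next
  case (inv h)
  then obtain x where "x \<in> X" "h = \<phi> x" by auto
  then show ?case using X by (intro bexI[of _ "[(x, False)]"]) auto
next
  case (eng h1 h2)
  then obtain u v where "u \<in> words X" "v \<in> words X" "eval_word G \<phi> u = h1" "eval_word G \<phi> v = h2" by auto
  then show ?case by (intro bexI[of _ "u @ v"]) (auto simp: eval_word_append[OF X])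
qed

lemma eval_backtrack:
  "\<phi> ` X \<subseteq> carrier G \<Longrightarrow> x \<in> X \<Longrightarrow> eval_word G \<phi> [(x, b), (x, \<not> b)] = \<one>"
  by (cases b) auto

lemma word_stepE:
  assumes R: "R \<subseteq> {w \<in> words X. eval_word G \<phi> w = \<one>}" and X: "\<phi> ` X \<subseteq> carrier G"
    and s: "word_step X R w w'"
  obtains u r v where "w = u @ r @ v" "w' = u @ v" "r \<in> words X" "eval_word G \<phi> r = \<one>"
    "r \<in> R \<or> (\<exists>x\<in>X. \<exists>b. r = [(x, b), (x, \<not> b)])"
proof -
  obtain u r v where urv: "w = u @ r @ v" "w' = u @ v" "r \<in> R \<or> (\<exists>x\<in>X. \<exists>b. r = [(x, b), (x, \<not> b)])"
    using s unfolding word_step_def by blast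
  from urv(3) have "r \<in> words X \<and> eval_word G \<phi> r = \<one>"
    using R eval_backtrack[OF X] by fastforce
  then show thesis using that urv by blast
qed

lemma equivclp_word_step_invariant:
  assumes R: "R \<subseteq> {w \<in> words X. eval_word G \<phi> w = \<one>}" and X: "\<phi> ` X \<subseteq> carrier G"
    and "equivclp (word_step X R) w w'" "w \<in> words X"
  shows "w' \<in> words X \<and> eval_word G \<phi> w' = eval_word G \<phi> w"
  using assms(3)
proof (induction rule: equivclp_induct)
  case base then show ?case using assms(4) by simp
next
  case (step y z)
  have *: "(z \<in> words X \<longleftrightarrow> y \<in> words X) \<and> (y \<in> words X \<longrightarrow> eval_word G \<phi> z = eval_word G \<phi> y)"
    if s: "word_step X R y z" for y z
  proof -
    obtain u r v where "y = u @ r @ v" "z = u @ v" "r \<in> words X" "eval_word G \<phi> r = \<one>"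
      using word_stepE[OF R X s] by metis
    then show ?thesis by (auto simp: eval_word_append[OF X] eval_word_closed[OF X])
  qed
  show ?case using step(2,3) *[of y z] *[of z y] by auto
qed

end

lemma equivclp_mono_map:
  assumes "equivclp r x y" and "\<And>x y. r x y \<Longrightarrow> equivclp r' (f x) (f y)"
  shows "equivclp r' (f x) (f y)"
  using assms(1)
proof (induction rule: equivclp_induct)
  case (step y z)
  then show ?case using assms(2)[of y z] assms(2)[of z y] by (meson equivclp_sym equivclp_trans)
qed simp

lemma word_step_context: "word_step X R w w' \<Longrightarrow> word_step X R (u @ w @ v) (u @ w' @ v)"
  unfolding word_step_def by (metis append.assoc)

lemma equivclp_word_step_context:
  "equivclp (word_step X R) w w' \<Longrightarrow> equivclp (word_step X R) (u @ w @ v) (u @ w' @ v)"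
  by (erule equivclp_mono_map[where f = "\<lambda>w. u @ w @ v"]) (intro r_into_equivclp word_step_context)

text \<open>All relations up to a given length. Taking all of them makes soundness trivial and turns the choice of
  relators into a choice of a sufficiently large length.\<close>

definition short_relators :: "('g, 'm) monoid_scheme \<Rightarrow> 'g set \<Rightarrow> nat \<Rightarrow> ('g \<times> bool) list set" where
  "short_relators \<Gamma> S D = {w \<in> short_words S D. eval_word \<Gamma> (\<lambda>s. s) w = \<one>\<^bsub>\<Gamma>\<^esub>}"

locale generated_group = group \<Gamma> for \<Gamma> :: "('g, 'm) monoid_scheme" (structure) +
  fixes S :: "'g set"
  assumes fin: "finite S" and S: "S \<subseteq> carrier \<Gamma>" and gen: "generate \<Gamma> S = carrier \<Gamma>"
begin

abbreviation "ev \<equiv> eval_word \<Gamma> (\<lambda>s. s)"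

lemma S': "(\<lambda>s. s) ` S \<subseteq> carrier \<Gamma>"
  using S by simp

lemma word_for: "g \<in> carrier \<Gamma> \<Longrightarrow> \<exists>w\<in>words S. ev w = g"
  using generate_word[OF S'] gen by simp

lemma short_relators_sound: "short_relators \<Gamma> S D \<subseteq> {w \<in> words S. ev w = \<one>}"
  by (auto simp: short_relators_def short_words_def)

text \<open>Tietze transformations: rewriting a word over \<open>S\<close> by \<open>\<beta>\<close> as a word over \<open>X\<close>, reducing it there with
  \<open>R\<close>, and carrying the reduction back by \<open>\<alpha>\<close>. The words that this makes trivial are images of
  relators and of cancelling pairs, and the relations between a generator and its double rewriting; the
  three bounds on \<open>D\<close> say that they are short relators.\<close>

lemma presents_short_relators_transfer:
  fixes \<phi> :: "'x \<Rightarrow> 'g"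
  assumes pres: "presents \<Gamma> X \<phi> R"
    and \<alpha>: "\<And>x. x \<in> X \<Longrightarrow> \<alpha> x \<in> words S" "\<And>x. x \<in> X \<Longrightarrow> ev (\<alpha> x) = \<phi> x"
    and \<beta>: "\<And>s. s \<in> S \<Longrightarrow> \<beta> s \<in> words X" "\<And>s. s \<in> S \<Longrightarrow> eval_word \<Gamma> \<phi> (\<beta> s) = s"
    and D: "\<And>r. r \<in> R \<Longrightarrow> length (subst_word \<alpha> r) \<le> D" "\<And>x. x \<in> X \<Longrightarrow> 2 * length (\<alpha> x) \<le> D"
      "\<And>s. s \<in> S \<Longrightarrow> length (subst_word \<alpha> (\<beta> s)) + 1 \<le> D"
  shows "presents \<Gamma> S (\<lambda>s. s) (short_relators \<Gamma> S D)"
proof -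
  let ?eq = "equivclp (word_step S (short_relators \<Gamma> S D))"
  have X: "\<phi> ` X \<subseteq> carrier \<Gamma>" and RX: "R \<subseteq> words X"
    and R: "\<And>w. w \<in> words X \<Longrightarrow> eval_word \<Gamma> \<phi> w = \<one> \<longleftrightarrow> equivclp (word_step X R) w []"
    using pres by (auto simp: presents_def)
  have R1: "R \<subseteq> {w \<in> words X. eval_word \<Gamma> \<phi> w = \<one>}"
  proof
    fix r assume r: "r \<in> R"
    then have "word_step X R r []" unfolding word_step_def by (intro exI[of _ "[]"] exI[of _ r]) simp
    then show "r \<in> {w \<in> words X. eval_word \<Gamma> \<phi> w = \<one>}" using r RX R[of r] by auto
  qed
  have relator: "?eq (u @ r @ v) (u @ v)" if "r \<in> words S" "ev r = \<one>" "length r \<le> D" for u r v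
    by (rule r_into_equivclp)
      (use that in \<open>auto simp: word_step_def short_relators_def short_words_def\<close>)
  have ev_subst: "ev (subst_word \<alpha> w) = eval_word \<Gamma> \<phi> w" if "w \<in> words X" for w
    by (rule eval_word_subst_word[OF S' \<alpha> that])
  have 1: "?eq (subst_word \<alpha> w) (subst_word \<alpha> w')" if "word_step X R w w'" for w w'
  proof -
    obtain u r v where urv: "w = u @ r @ v" "w' = u @ v" "r \<in> words X" "eval_word \<Gamma> \<phi> r = \<one>"
      "r \<in> R \<or> (\<exists>x\<in>X. \<exists>b. r = [(x, b), (x, \<not> b)])"
      using word_stepE[OF R1 X \<open>word_step X R w w'\<close>] by metis
    have "length (subst_word \<alpha> r) \<le> D" using urv(5) D(1,2) by fastforce
    then show ?thesis
      using relator[of "subst_word \<alpha> r"] urv ev_subst[OF urv(3)] words_subst_word[OF \<alpha>(1) urv(3)] by simp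
  qed
  have letter: "?eq [l] (subst_word \<alpha> (subst_word \<beta> [l]))" if l: "fst l \<in> S" for l
  proof -
    \<comment> \<open>\<open>q l\<inverse>\<close> is a short relator, so \<open>q\<close> and \<open>l\<close> are joined through \<open>q l\<inverse> l\<close>.\<close>
    let ?q = "subst_word \<alpha> (subst_word \<beta> [l])" and ?l' = "(fst l, \<not> snd l)"
    have \<beta>l: "subst_word \<beta> [l] \<in> words X" using \<beta>(1) l by auto
    have q: "?q \<in> words S" by (rule words_subst_word[OF \<alpha>(1) \<beta>l])
    have evq: "ev ?q = ev [l]"
      unfolding ev_subst[OF \<beta>l] using \<beta>[OF l] l S by (auto simp: eval_word_rev_word[OF X])
    have "length ?q \<le> length (subst_word \<alpha> (\<beta> (fst l)))"
    proof -
      have "length (subst_word \<alpha> (rev_word w)) = length (subst_word \<alpha> w)" for w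
        by (induction w) auto
      then show ?thesis by simp
    qed
    then have len: "length (?q @ [?l']) \<le> D" using D(3)[OF l] by simp
    have "ev (?q @ [?l']) = \<one>"
      using evq q l S by (auto simp: eval_word_append[OF S'])
    then have "?eq ([] @ (?q @ [?l']) @ [l]) ([] @ [l])"
      using q l len by (intro relator) auto
    then have a: "?eq (?q @ [?l', l]) [l]" by (simp only: append.assoc append_Nil append_Cons)
    have "?eq (?q @ [?l', l] @ []) (?q @ [])"
    proof (rule r_into_equivclp)
      have "\<exists>x\<in>S. \<exists>b. [?l', l] = [(x, b), (x, \<not> b)]" using l by (cases l) auto
      then show "word_step S (short_relators \<Gamma> S D) (?q @ [?l', l] @ []) (?q @ [])"
        unfolding word_step_def by blast
    qed
    then have b: "?eq (?q @ [?l', l]) ?q" by (simp only: append_Nil2)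
    show ?thesis by (rule equivclp_trans[OF equivclp_sym[OF a] b])
  qed
  have 2: "?eq w (subst_word \<alpha> (subst_word \<beta> w))" if "w \<in> words S" for w
    using that
  proof (induction w)
    case (Cons l w)
    have a: "?eq ([] @ [l] @ w) ([] @ subst_word \<alpha> (subst_word \<beta> [l]) @ w)"
      by (rule equivclp_word_step_context[OF letter]) (use Cons.prems in auto)
    have b: "?eq (subst_word \<alpha> (subst_word \<beta> [l]) @ w @ [])
        (subst_word \<alpha> (subst_word \<beta> [l]) @ subst_word \<alpha> (subst_word \<beta> w) @ [])"
      by (rule equivclp_word_step_context[OF Cons.IH]) (use Cons.prems in auto)
    have "subst_word \<alpha> (subst_word \<beta> (l # w)) =
        subst_word \<alpha> (subst_word \<beta> [l]) @ subst_word \<alpha> (subst_word \<beta> w)"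
      by (simp flip: subst_word_simps(3))
    then show ?case using equivclp_trans[OF a[unfolded append_Nil] b[unfolded append_Nil2]] by simp
  qed simp
  have "?eq w []" if w: "w \<in> words S" "ev w = \<one>" for w
  proof -
    have \<beta>w: "subst_word \<beta> w \<in> words X" by (rule words_subst_word[OF \<beta>(1) w(1)])
    have "eval_word \<Gamma> \<phi> (subst_word \<beta> w) = \<one>"
      using eval_word_subst_word[OF X \<beta> w(1)] w(2) by simp
    then have "equivclp (word_step X R) (subst_word \<beta> w) []" using R[OF \<beta>w] by simp
    from equivclp_mono_map[OF this, where f = "subst_word \<alpha>", OF 1]
    have "?eq (subst_word \<alpha> (subst_word \<beta> w)) []" by simp
    then show ?thesis by (rule equivclp_trans[OF 2[OF w(1)]])
  qed
  moreover have "ev w = \<one>" if "w \<in> words S" "?eq w []" for w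
    using equivclp_word_step_invariant[OF short_relators_sound S' that(2,1)] by simp
  ultimately show ?thesis
    unfolding presents_def using S' gen short_relators_sound by fastforce
qed

lemma finitely_presented_short_relators:
  assumes "finitely_presented \<Gamma>"
  obtains D0 where "\<And>D. D0 \<le> D \<Longrightarrow> presents \<Gamma> S (\<lambda>s. s) (short_relators \<Gamma> S D)"
proof -
  obtain n :: nat and \<phi> R where R: "finite R" and pres: "presents \<Gamma> {..<n} \<phi> R"
    using assms by (auto simp: finitely_presented_def)
  have X: "\<phi> ` {..<n} \<subseteq> carrier \<Gamma>" and genX: "generate \<Gamma> (\<phi> ` {..<n}) = carrier \<Gamma>"
    using pres by (auto simp: presents_def)
  have "\<forall>x\<in>{..<n}. \<exists>w. w \<in> words S \<and> ev w = \<phi> x" using word_for X by blast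
  then obtain \<alpha> where \<alpha>: "\<And>x. x \<in> {..<n} \<Longrightarrow> \<alpha> x \<in> words S" "\<And>x. x \<in> {..<n} \<Longrightarrow> ev (\<alpha> x) = \<phi> x"
    unfolding bchoice_iff by auto
  have "\<forall>s\<in>S. \<exists>w. w \<in> words {..<n} \<and> eval_word \<Gamma> \<phi> w = s"
    using generate_word[OF X] genX S by blast
  then obtain \<beta> where \<beta>: "\<And>s. s \<in> S \<Longrightarrow> \<beta> s \<in> words {..<n}" "\<And>s. s \<in> S \<Longrightarrow> eval_word \<Gamma> \<phi> (\<beta> s) = s"
    unfolding bchoice_iff by auto
  define D0 where "D0 = (\<Sum>r\<in>R. length (subst_word \<alpha> r)) + (\<Sum>x<n. 2 * length (\<alpha> x)) +
    (\<Sum>s\<in>S. length (subst_word \<alpha> (\<beta> s)) + 1)"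
  show thesis
  proof (rule that)
    fix D assume D: "D0 \<le> D"
    show "presents \<Gamma> S (\<lambda>s. s) (short_relators \<Gamma> S D)"
    proof (rule presents_short_relators_transfer[OF pres \<alpha> \<beta>])
      fix r assume "r \<in> R"
      then have "length (subst_word \<alpha> r) \<le> (\<Sum>r\<in>R. length (subst_word \<alpha> r))" using R by (intro member_le_sum) auto
      then show "length (subst_word \<alpha> r) \<le> D" using D by (simp add: D0_def)
    next
      fix x assume "x \<in> {..<n}"
      then have "2 * length (\<alpha> x) \<le> (\<Sum>x<n. 2 * length (\<alpha> x))" by (intro member_le_sum) auto
      then show "2 * length (\<alpha> x) \<le> D" using D by (simp add: D0_def)
    next
      fix s assume "s \<in> S"
      then have "length (subst_word \<alpha> (\<beta> s)) + 1 \<le> (\<Sum>s\<in>S. length (subst_word \<alpha> (\<beta> s)) + 1)"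
        using fin by (intro member_le_sum[where f = "\<lambda>s. length (subst_word \<alpha> (\<beta> s)) + 1"]) auto
      then show "length (subst_word \<alpha> (\<beta> s)) + 1 \<le> D" using D by (simp add: D0_def)
    qed
  qed
qed

end


section \<open>Simple connectedness from short closed walks\<close>

text \<open>The case split of closed walks again: cycles and backtrackings are removed by one step each, and a
  closed walk with a repeated vertex is removed in two pieces.\<close>

lemma homotopy_closed_subwalk:
  assumes wf: "wf_digraph G"
  shows "walk G a u c \<Longrightarrow> walk G c r c \<Longrightarrow> walk G c v b \<Longrightarrow> length r \<le> D \<Longrightarrow>
    equivclp (homotopy_step G D a b) (u @ r @ v) (u @ v)"
proof (induction "length r" arbitrary: u r v c rule: less_induct)
  case less
  have direct: "equivclp (homotopy_step G D a b) (u @ r @ v) (u @ v)"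
    if "(\<exists>e t. r = [(e, t), (e, \<not> t)]) \<or> (cycle_walk G r \<and> fst ` set r \<in> polygons G D)"
  proof (rule r_into_equivclp)
    have "walk G a (u @ r @ v) b" "walk G a (u @ v) b"
      using less.prems by (auto simp: walk_append[OF wf])
    then show "homotopy_step G D a b (u @ r @ v) (u @ v)"
      unfolding homotopy_step_def using that by blast
  qed
  show ?case
  proof (cases "r = []")
    case False
    from wf less.prems(2) this show ?thesis
    proof (cases rule: closed_walk_cases)
      case cycle
      then show ?thesis using direct less.prems(4) by (auto simp: polygons_def)
    next
      case (backtrack e t)
      then show ?thesis using direct by blast
    next
      case (split u' r' v' b')
      obtain x where "walk G c u' x" "walk G x (r' @ v') c"
        using less.prems(2) split(1) by (auto simp: walk_append[OF wf])
      moreover have "x = b'"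
        using \<open>walk G x (r' @ v') c\<close> split(2,4) by (cases r') auto
      ultimately have w: "walk G c u' b'" "walk G b' (r' @ v') c" by auto
      then obtain y where "walk G b' r' y" "walk G y v' c" by (auto simp: walk_append[OF wf])
      moreover have "walk G s p t1 \<Longrightarrow> walk G s p t2 \<Longrightarrow> t1 = t2" for s p t1 t2
        by (induction p arbitrary: s) auto
      ultimately have "walk G b' v' c" using split(4) by blast
      have "equivclp (homotopy_step G D a b) ((u @ u') @ r' @ (v' @ v)) ((u @ u') @ (v' @ v))"
      proof (rule less.hyps)
        show "length r' < length r" using split by auto
        show "walk G a (u @ u') b'" "walk G b' (v' @ v) b"
          using less.prems w \<open>walk G b' v' c\<close> by (auto simp: walk_append[OF wf])
      qed (use split less.prems in auto)
      moreover have "equivclp (homotopy_step G D a b) (u @ (u' @ v') @ v) (u @ v)"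
        by (rule less.hyps[OF _ less.prems(1) split(5) less.prems(3)]) (use split less.prems in auto)
      ultimately show ?thesis
        unfolding split(1) append.assoc by (rule equivclp_trans)
    qed
  qed simp
qed

section \<open>Cayley graphs\<close>

primrec cayley_walk :: "('g, 'm) monoid_scheme \<Rightarrow> 'g \<Rightarrow> ('g \<times> bool) list \<Rightarrow> (('g \<times> 'g) \<times> bool) list" where
  "cayley_walk \<Gamma> g [] = []"
| "cayley_walk \<Gamma> g (l # w) =
     (if snd l then ((g, fst l), True) # cayley_walk \<Gamma> (g \<otimes>\<^bsub>\<Gamma>\<^esub> fst l) w
      else ((g \<otimes>\<^bsub>\<Gamma>\<^esub> inv\<^bsub>\<Gamma>\<^esub> fst l, fst l), False) # cayley_walk \<Gamma> (g \<otimes>\<^bsub>\<Gamma>\<^esub> inv\<^bsub>\<Gamma>\<^esub> fst l) w)"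

definition walk_label :: "(('g \<times> 'g) \<times> bool) list \<Rightarrow> ('g \<times> bool) list" where
  "walk_label p = map (\<lambda>s. (snd (fst s), snd s)) p"

lemma length_cayley_walk [simp]: "length (cayley_walk \<Gamma> g w) = length w"
  by (induction w arbitrary: g) auto

context generated_group
begin

abbreviation "Cay \<equiv> cayley_graph \<Gamma> S"

lemma Cay_simps [simp]:
  "verts Cay = carrier \<Gamma>" "arcs Cay = carrier \<Gamma> \<times> S"
  "tail Cay e = fst e" "head Cay e = fst e \<otimes> snd e"
  by (auto simp: cayley_graph_def case_prod_unfold)

lemma wf_Cay: "wf_digraph Cay"
  using S by (auto simp: wf_digraph_def)

lemma ev_closed: "w \<in> words S \<Longrightarrow> ev w \<in> carrier \<Gamma>"
  by (rule eval_word_closed[OF S'])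

lemma walk_cayley_walk: "g \<in> carrier \<Gamma> \<Longrightarrow> w \<in> words S \<Longrightarrow> walk Cay g (cayley_walk \<Gamma> g w) (g \<otimes> ev w)"
proof (induction w arbitrary: g)
  case (Cons l w)
  then have l: "fst l \<in> carrier \<Gamma>" "fst l \<in> S" using S by auto
  show ?case
    using Cons.IH[of "g \<otimes> fst l"] Cons.IH[of "g \<otimes> inv fst l"] Cons.prems l ev_closed[of w]
    by (auto simp: step_src_def step_dst_def m_assoc)
qed simp

lemma cayley_walk_append:
  "g \<in> carrier \<Gamma> \<Longrightarrow> u \<in> words S \<Longrightarrow>
    cayley_walk \<Gamma> g (u @ v) = cayley_walk \<Gamma> g u @ cayley_walk \<Gamma> (g \<otimes> ev u) v"
proof (induction u arbitrary: g)
  case (Cons l u)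
  then have l: "fst l \<in> carrier \<Gamma>" using S by auto
  show ?case using Cons l ev_closed[of u] by (auto simp: m_assoc)
qed simp

lemma walk_label_words: "walk Cay g p h \<Longrightarrow> walk_label p \<in> words S"
  by (induction p arbitrary: g) (auto simp: walk_label_def)

lemma cayley_walk_walk_label: "walk Cay g p h \<Longrightarrow> cayley_walk \<Gamma> g (walk_label p) = p"
proof (induction p arbitrary: g)
  case (Cons s p)
  obtain x y b where s: "s = ((x, y), b)" by (metis prod.exhaust)
  have xy: "x \<in> carrier \<Gamma>" "y \<in> carrier \<Gamma>" using Cons.prems S by (auto simp: s)
  show ?case
  proof (cases b)
    case True
    then show ?thesis using Cons by (auto simp: s walk_label_def step_src_def step_dst_def)
  next
    case False
    then have g: "g = x \<otimes> y" using Cons.prems by (auto simp: s step_src_def)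
    then have "g \<otimes> inv y = x" using xy by (simp add: m_assoc)
    then show ?thesis using Cons False by (auto simp: s walk_label_def step_dst_def)
  qed
qed (simp add: walk_label_def)

text \<open>A prefix \<open>u\<close> of the label leads from \<open>g\<close> to the tail of \<open>e\<close>; so short walks through a given edge have
  boundedly many starting points. All bounds on overlaps in Cayley graphs come from this.\<close>

lemma start_of_cayley_walk:
  assumes "g \<in> carrier \<Gamma>" "w \<in> words S" "e \<in> fst ` set (cayley_walk \<Gamma> g w)" "length w \<le> L"
  shows "g \<in> (\<lambda>u. fst e \<otimes> inv (ev u)) ` short_words S L"
proof -
  have "\<exists>u\<in>words S. length u \<le> length w \<and> g \<otimes> ev u = fst e"
    using assms(1-3)
  proof (induction w arbitrary: g)
    case (Cons l w)
    then have l: "fst l \<in> carrier \<Gamma>" "fst l \<in> S" using S by auto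
    let ?x = "if snd l then fst l else inv (fst l)"
    have x: "?x \<in> carrier \<Gamma>" using l by simp
    have "e = (if snd l then g else g \<otimes> ?x, fst l) \<or> e \<in> fst ` set (cayley_walk \<Gamma> (g \<otimes> ?x) w)"
      using Cons.prems(3) by (auto split: if_splits)
    then show ?case
    proof
      assume e: "e = (if snd l then g else g \<otimes> ?x, fst l)"
      show ?thesis
        using e l Cons.prems(1) by (intro bexI[of _ "if snd l then [] else [l]"]) auto
    next
      assume "e \<in> fst ` set (cayley_walk \<Gamma> (g \<otimes> ?x) w)"
      then obtain u where u: "u \<in> words S" "length u \<le> length w" "(g \<otimes> ?x) \<otimes> ev u = fst e"
        using Cons.IH[of "g \<otimes> ?x"] Cons.prems x by auto
      have "g \<otimes> ev (l # u) = fst e" using u(3) x Cons.prems(1) ev_closed[OF u(1)] by (simp add: m_assoc)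
      then show ?thesis using u l by (intro bexI[of _ "l # u"]) auto
    qed
  qed simp
  then obtain u where u: "u \<in> words S" "length u \<le> length w" "g \<otimes> ev u = fst e" by blast
  have "g = fst e \<otimes> inv (ev u)"
    using u(3)[symmetric] assms(1) ev_closed[OF u(1)] by (simp add: m_assoc)
  then show ?thesis using u assms(4) by (auto simp: short_words_def)
qed

lemma thin_family_cayley_walks:
  assumes "finite T" and \<beta>: "\<And>t. t \<in> T \<Longrightarrow> \<beta> t \<in> short_words S L"
  shows "thin_family (carrier \<Gamma> \<times> T) (\<lambda>(g, t). cayley_walk \<Gamma> g (\<beta> t)) (card (short_words S L) * card T)"
  unfolding thin_family_def
proof (intro allI)
  fix e
  let ?A = "{x \<in> carrier \<Gamma> \<times> T. e \<in> fst ` set ((\<lambda>(g, t). cayley_walk \<Gamma> g (\<beta> t)) x)}"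
  let ?B = "(\<lambda>(u, t). (fst e \<otimes> inv (ev u), t)) ` (short_words S L \<times> T)"
  have sub: "?A \<subseteq> ?B"
  proof
    fix x assume x: "x \<in> ?A"
    obtain g t where gt: "x = (g, t)" by fastforce
    have "g \<in> (\<lambda>u. fst e \<otimes> inv (ev u)) ` short_words S L"
      using x \<beta>[of t] by (intro start_of_cayley_walk[of g "\<beta> t"]) (auto simp: gt short_words_def)
    then show "x \<in> ?B" using x by (auto simp: gt)
  qed
  have fin: "finite (short_words S L \<times> T)" using finite_short_words[OF fin] assms(1) by blast
  have "card ?A \<le> card ?B" by (rule card_mono[OF finite_imageI[OF fin] sub])
  also have "\<dots> \<le> card (short_words S L \<times> T)" by (rule card_image_le[OF fin])
  finally show "finite ?A \<and> card ?A \<le> card (short_words S L) * card T"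
    using finite_subset[OF sub finite_imageI[OF fin]] by (simp add: card_cartesian_product)
qed

text \<open>A polygon is determined by the starting point and the label of a walk around it.\<close>

lemma polygons_through_edge:
  "finite {c \<in> polygons Cay D. e \<in> c} \<and>
   card {c \<in> polygons Cay D. e \<in> c} \<le> card (short_words S D \<times> short_words S D)"
proof -
  let ?A = "{c \<in> polygons Cay D. e \<in> c}"
  let ?B = "(\<lambda>(u, w). fst ` set (cayley_walk \<Gamma> (fst e \<otimes> inv (ev u)) w)) ` (short_words S D \<times> short_words S D)"
  have sub: "?A \<subseteq> ?B"
  proof
    fix c assume c: "c \<in> ?A"
    then obtain p g where p: "c = fst ` set p" "length p \<le> D" "walk Cay g p g"
      by (auto simp: polygons_def cycle_walk_def)
    have w: "walk_label p \<in> words S" "cayley_walk \<Gamma> g (walk_label p) = p"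
      using walk_label_words cayley_walk_walk_label p(3) by auto
    have len: "length (walk_label p) \<le> D" using p(2) by (simp add: walk_label_def)
    have "g \<in> carrier \<Gamma>" using walk_verts[OF wf_Cay p(3)] by simp
    then have "g \<in> (\<lambda>u. fst e \<otimes> inv (ev u)) ` short_words S D"
      by (rule start_of_cayley_walk[OF _ w(1) _ len]) (use c p w in auto)
    then obtain u where u: "u \<in> short_words S D" "g = fst e \<otimes> inv (ev u)" by auto
    have "c = (\<lambda>(u, w). fst ` set (cayley_walk \<Gamma> (fst e \<otimes> inv (ev u)) w)) (u, walk_label p)"
      using w(2) p(1) u(2) by simp
    moreover have "(u, walk_label p) \<in> short_words S D \<times> short_words S D"
      using u(1) w(1) len by (simp add: short_words_def)
    ultimately show "c \<in> ?B" by (rule image_eqI)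
  qed
  have fin: "finite (short_words S D \<times> short_words S D)" using finite_short_words[OF fin] by blast
  have "card ?A \<le> card ?B" by (rule card_mono[OF finite_imageI[OF fin] sub])
  also have "\<dots> \<le> card (short_words S D \<times> short_words S D)" by (rule card_image_le[OF fin])
  finally show ?thesis using finite_subset[OF sub finite_imageI[OF fin]] by simp
qed

lemma polygon_complex_Cay:
  assumes "polygon_orientation Cay D \<omega>"
  shows "polygon_complex Cay D \<omega> (card (short_words S D \<times> short_words S D))"
proof (rule polygon_complex.intro)
  fix v e
  show "finite {e \<in> arcs Cay. head Cay e = v}"
  proof (rule finite_subset)
    show "{e \<in> arcs Cay. head Cay e = v} \<subseteq> (\<lambda>s. (v \<otimes> inv s, s)) ` S"
    proof
      fix e assume e: "e \<in> {e \<in> arcs Cay. head Cay e = v}"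
      obtain x s where xs: "e = (x, s)" by fastforce
      have "x \<in> carrier \<Gamma>" "s \<in> S" "v = x \<otimes> s" "s \<in> carrier \<Gamma>" using e S by (auto simp: xs)
      then have "x = v \<otimes> inv s" by (simp add: m_assoc)
      then show "e \<in> (\<lambda>s. (v \<otimes> inv s, s)) ` S" using \<open>s \<in> S\<close> by (auto simp: xs)
    qed
  qed (use fin in simp)
  show "finite {e \<in> arcs Cay. tail Cay e = v}"
    by (rule finite_subset[of _ "{v} \<times> S"]) (use fin in auto)
qed (use wf_Cay assms polygons_through_edge in auto)

text \<open>Closed walks correspond to words representing the identity. A subword deleted or inserted by a rewriting
  step of the presentation labels a closed walk of length at most \<open>D\<close>; the bound \<open>2 \<le> D\<close> covers
  cancelling pairs.\<close>

lemma simply_connected_Cay: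
  assumes pres: "presents \<Gamma> S (\<lambda>s. s) (short_relators \<Gamma> S D)" and D: "2 \<le> D"
  shows "simply_connected_complex Cay D"
  unfolding simply_connected_complex_def
proof (intro conjI ballI allI impI)
  show "verts Cay \<noteq> {}" using one_closed by auto
next
  fix a b assume ab: "a \<in> verts Cay" "b \<in> verts Cay"
  then obtain w where w: "w \<in> words S" "ev w = inv a \<otimes> b" using word_for[of "inv a \<otimes> b"] by auto
  have "a \<otimes> ev w = b" using w ab by (simp flip: m_assoc)
  then show "\<exists>p. walk Cay a p b" using walk_cayley_walk[of a w] ab w by auto
next
  fix a p assume p: "walk Cay a p a"
  let ?eq = "equivclp (homotopy_step Cay D a a)"
  have a: "a \<in> carrier \<Gamma>" using walk_verts[OF wf_Cay p] by simp
  define w where "w = walk_label p"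
  have w: "w \<in> words S" "cayley_walk \<Gamma> a w = p"
    using walk_label_words[OF p] cayley_walk_walk_label[OF p] by (auto simp: w_def)
  have unique: "walk Cay s q t1 \<Longrightarrow> walk Cay s q t2 \<Longrightarrow> t1 = t2" for s q t1 t2
    by (induction q arbitrary: s) auto
  have "a \<otimes> ev w = a" using unique[OF walk_cayley_walk[OF a w(1)]] p w(2) by simp
  then have evw: "ev w = \<one>" using a ev_closed[OF w(1)] by simp
  have cut: "?eq (cayley_walk \<Gamma> a y) (cayley_walk \<Gamma> a z)"
    if s: "word_step S (short_relators \<Gamma> S D) y z" and y: "y \<in> words S" "ev y = \<one>" for y z
  proof -
    obtain u r v where urv: "y = u @ r @ v" "z = u @ v" "r \<in> words S" "ev r = \<one>"
      "r \<in> short_relators \<Gamma> S D \<or> (\<exists>x\<in>S. \<exists>b. r = [(x, b), (x, \<not> b)])"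
      using word_stepE[OF short_relators_sound S' s] by metis
    have len: "length r \<le> D" using urv(5) D by (auto simp: short_relators_def short_words_def)
    have uv: "u \<in> words S" "v \<in> words S" using y urv by auto
    let ?c = "a \<otimes> ev u"
    have c: "?c \<in> carrier \<Gamma>" "?c \<otimes> ev r = ?c" "?c \<otimes> ev v = a"
    proof -
      show c: "?c \<in> carrier \<Gamma>" using a ev_closed[OF uv(1)] by simp
      then show "?c \<otimes> ev r = ?c" using urv(4) by simp
      have "ev u \<otimes> ev v = \<one>"
        using y(2) urv(3,4) uv by (simp add: urv(1) eval_word_append[OF S'] ev_closed)
      then show "?c \<otimes> ev v = a" using a ev_closed[OF uv(1)] ev_closed[OF uv(2)] by (simp add: m_assoc)
    qed
    have "?eq (cayley_walk \<Gamma> a u @ cayley_walk \<Gamma> ?c r @ cayley_walk \<Gamma> ?c v)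
        (cayley_walk \<Gamma> a u @ cayley_walk \<Gamma> ?c v)"
      using walk_cayley_walk[OF a uv(1)] walk_cayley_walk[OF c(1) urv(3)] walk_cayley_walk[OF c(1) uv(2)] c len
      by (intro homotopy_closed_subwalk[OF wf_Cay]) auto
    then show ?thesis
      using cayley_walk_append[OF a uv(1)] cayley_walk_append[OF c(1) urv(3)] c(2) by (simp add: urv)
  qed
  have "equivclp (word_step S (short_relators \<Gamma> S D)) w []"
    using pres w(1) evw by (auto simp: presents_def)
  then have "?eq (cayley_walk \<Gamma> a w) (cayley_walk \<Gamma> a [])"
  proof (induction rule: equivclp_induct)
    case (step y z)
    have "y \<in> words S \<and> ev y = \<one>"
      using equivclp_word_step_invariant[OF short_relators_sound S' step(1) w(1)] evw by simp
    moreover have "z \<in> words S \<and> ev z = \<one>"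
      using equivclp_word_step_invariant[OF short_relators_sound S' equivclp_into_equivclp[OF step(1,2)] w(1)]
        evw by simp
    ultimately have "?eq (cayley_walk \<Gamma> a y) (cayley_walk \<Gamma> a z)"
      using step(2) cut[of y z] cut[of z y] \<open>y \<in> words S \<and> ev y = \<one>\<close> by (metis equivclp_sym)
    then show ?case by (rule equivclp_trans[OF step(3)])
  qed simp
  then show "?eq p []" using w(2) by simp
qed

lemma admissible_length_eventually:
  assumes "finitely_presented \<Gamma>"
  obtains D0 where "\<And>D. D0 \<le> D \<Longrightarrow> admissible_length \<Gamma> S D"
proof -
  obtain D1 where D1: "\<And>D. D1 \<le> D \<Longrightarrow> presents \<Gamma> S (\<lambda>s. s) (short_relators \<Gamma> S D)"
    using finitely_presented_short_relators[OF assms] by blast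
  have "finite (short_relators \<Gamma> S D)" for D
    by (rule finite_subset[OF _ finite_short_words[OF fin]]) (auto simp: short_relators_def)
  then have "admissible_length \<Gamma> S D" if "max D1 2 \<le> D" for D
    unfolding admissible_length_def
    using D1[of D] simply_connected_Cay[OF D1, of D] that
    by (auto simp: short_relators_def short_words_def intro!: exI[of _ "short_relators \<Gamma> S D"])
  then show thesis by (rule that)
qed

text \<open>An edge \<open>(g, t)\<close> of the other Cayley graph is replaced by the walk from \<open>g\<close> that is labelled by a word
  for \<open>t\<close>.\<close>

lemma edge_substitution:
  assumes T: "finite T" "T \<subseteq> carrier \<Gamma>"
  obtains \<phi> L where
    "\<And>e. e \<in> arcs (cayley_graph \<Gamma> T) \<Longrightarrow>
      walk Cay (tail (cayley_graph \<Gamma> T) e) (\<phi> e) (head (cayley_graph \<Gamma> T) e)"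
    "\<And>e. e \<in> arcs (cayley_graph \<Gamma> T) \<Longrightarrow> length (\<phi> e) \<le> L"
    "thin_family (arcs (cayley_graph \<Gamma> T)) \<phi> (card (short_words S L) * card T)"
proof -
  have "\<forall>t\<in>T. \<exists>w. w \<in> words S \<and> ev w = t" using word_for T by blast
  then obtain \<beta> where \<beta>: "\<And>t. t \<in> T \<Longrightarrow> \<beta> t \<in> words S" "\<And>t. t \<in> T \<Longrightarrow> ev (\<beta> t) = t"
    unfolding bchoice_iff by auto
  define L where "L = (\<Sum>t\<in>T. length (\<beta> t))"
  have L: "length (\<beta> t) \<le> L" if "t \<in> T" for t
    unfolding L_def using that T by (intro member_le_sum[where f = "\<lambda>t. length (\<beta> t)"]) auto
  have arcs: "arcs (cayley_graph \<Gamma> T) = carrier \<Gamma> \<times> T" by (simp add: cayley_graph_def)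
  show thesis
  proof (rule that[of "\<lambda>(g, t). cayley_walk \<Gamma> g (\<beta> t)" L])
    show "thin_family (arcs (cayley_graph \<Gamma> T)) (\<lambda>(g, t). cayley_walk \<Gamma> g (\<beta> t)) (card (short_words S L) * card T)"
      unfolding arcs by (rule thin_family_cayley_walks[OF T(1)]) (use \<beta> L in \<open>auto simp: short_words_def\<close>)
    fix e assume "e \<in> arcs (cayley_graph \<Gamma> T)"
    then obtain g t where e: "e = (g, t)" "g \<in> carrier \<Gamma>" "t \<in> T" by (auto simp: arcs)
    show "length ((\<lambda>(g, t). cayley_walk \<Gamma> g (\<beta> t)) e) \<le> L" using L e by simp
    show "walk Cay (tail (cayley_graph \<Gamma> T) e) ((\<lambda>(g, t). cayley_walk \<Gamma> g (\<beta> t)) e) (head (cayley_graph \<Gamma> T) e)"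
      using walk_cayley_walk[OF e(2) \<beta>(1)[OF e(3)]] \<beta>(2)[OF e(3)] by (simp add: e cayley_graph_def)
  qed
qed

end

section \<open>Change of generators\<close>

lemma thin_family_mono: "thin_family X F n \<Longrightarrow> n \<le> n' \<Longrightarrow> thin_family X F n'"
  unfolding thin_family_def using order_trans by blast

theorem spectral_gap_change_of_generators:
  fixes \<Gamma> :: "('g, 'm) monoid_scheme"
  assumes "generated_group \<Gamma> S" "generated_group \<Gamma> T" and fp: "finitely_presented \<Gamma>"
    and \<omega>: "polygon_orientation (cayley_graph \<Gamma> S) D \<omega>"
    and \<omega>': "\<And>D. polygon_orientation (cayley_graph \<Gamma> T) D (\<omega>' D)"
    and gap: "coexact_spectral_gap (cayley_graph \<Gamma> S) D \<omega>"
  shows "\<exists>D'. admissible_length \<Gamma> T D' \<and> coexact_spectral_gap (cayley_graph \<Gamma> T) D' (\<omega>' D')"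
proof -
  interpret S: generated_group \<Gamma> S by fact
  interpret T: generated_group \<Gamma> T by fact
  obtain D0 where D0: "\<And>D. D0 \<le> D \<Longrightarrow> admissible_length \<Gamma> T D"
    using T.admissible_length_eventually[OF fp] by blast
  obtain \<phi> K1 where \<phi>: "\<And>e. e \<in> arcs T.Cay \<Longrightarrow> walk S.Cay (tail T.Cay e) (\<phi> e) (head T.Cay e)"
    "\<And>e. e \<in> arcs T.Cay \<Longrightarrow> length (\<phi> e) \<le> K1"
    "thin_family (arcs T.Cay) \<phi> (card (short_words S K1) * card T)"
    using S.edge_substitution[OF T.fin T.S] by blast
  obtain \<psi> K2 where \<psi>: "\<And>e. e \<in> arcs S.Cay \<Longrightarrow> walk T.Cay (tail S.Cay e) (\<psi> e) (head S.Cay e)"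
    "\<And>e. e \<in> arcs S.Cay \<Longrightarrow> length (\<psi> e) \<le> K2"
    "thin_family (arcs S.Cay) \<psi> (card (short_words T K2) * card S)"
    using T.edge_substitution[OF S.fin S.S] by blast
  define K n where "K = max K1 K2"
    and "n = max (card (short_words S K1) * card T) (card (short_words T K2) * card S)"
  define D' where "D' = D0 + K * D + (1 + K * K)"
  interpret G1: polygon_complex S.Cay D \<omega> "card (short_words S D \<times> short_words S D)"
    by (rule S.polygon_complex_Cay[OF \<omega>])
  interpret G2: polygon_complex T.Cay D' "\<omega>' D'" "card (short_words T D' \<times> short_words T D')"
    by (rule T.polygon_complex_Cay[OF \<omega>'])
  interpret complex_pair S.Cay D \<omega> "card (short_words S D \<times> short_words S D)"
    T.Cay D' "\<omega>' D'" "card (short_words T D' \<times> short_words T D')" \<phi> \<psi> K n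
  proof
    show "verts S.Cay = verts T.Cay" by simp
    show "thin_family (arcs T.Cay) \<phi> n" "thin_family (arcs S.Cay) \<psi> n"
      using thin_family_mono[OF \<phi>(3)] thin_family_mono[OF \<psi>(3)] by (auto simp: n_def)
    show "length (\<phi> e) \<le> K" if "e \<in> arcs T.Cay" for e using \<phi>(2)[OF that] by (simp add: K_def)
    show "length (\<psi> e) \<le> K" if "e \<in> arcs S.Cay" for e using \<psi>(2)[OF that] by (simp add: K_def)
  qed (use \<phi>(1) \<psi>(1) in \<open>auto simp: D'_def\<close>)
  have "coexact_spectral_gap T.Cay D' (\<omega>' D')" by (rule coexact_spectral_gap_transfer[OF gap])
  moreover have "admissible_length \<Gamma> T D'" by (rule D0) (simp add: D'_def)
  ultimately show ?thesis by blast
qed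

theorem corollary1p4:
  fixes \<Gamma> :: "('g, 'm) monoid_scheme"
    and S\<^sub>1 S\<^sub>2 :: "'g set"
    and \<omega>\<^sub>1 \<omega>\<^sub>2 :: "nat \<Rightarrow> ('g \<times> 'g) set \<Rightarrow> (('g \<times> 'g) \<times> bool) list"
  assumes "group \<Gamma>" and "finitely_presented \<Gamma>"
    and "finite S\<^sub>1" and "S\<^sub>1 \<subseteq> carrier \<Gamma>" and "generate \<Gamma> S\<^sub>1 = carrier \<Gamma>"
    and "finite S\<^sub>2" and "S\<^sub>2 \<subseteq> carrier \<Gamma>" and "generate \<Gamma> S\<^sub>2 = carrier \<Gamma>"
    and "\<And>D. polygon_orientation (cayley_graph \<Gamma> S\<^sub>1) D (\<omega>\<^sub>1 D)"
    and "\<And>D. polygon_orientation (cayley_graph \<Gamma> S\<^sub>2) D (\<omega>\<^sub>2 D)"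
  shows "(\<exists>D. admissible_length \<Gamma> S\<^sub>1 D \<and> coexact_spectral_gap (cayley_graph \<Gamma> S\<^sub>1) D (\<omega>\<^sub>1 D)) \<longleftrightarrow>
         (\<exists>D'. admissible_length \<Gamma> S\<^sub>2 D' \<and> coexact_spectral_gap (cayley_graph \<Gamma> S\<^sub>2) D' (\<omega>\<^sub>2 D'))"
proof -
  have S: "generated_group \<Gamma> S\<^sub>1" "generated_group \<Gamma> S\<^sub>2"
    using assms by (simp_all add: generated_group_def generated_group_axioms_def)
  show ?thesis
    using spectral_gap_change_of_generators[OF S assms(2) assms(9,10)]
      spectral_gap_change_of_generators[OF S(2,1) assms(2) assms(10,9)] by blast
qed

end
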